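(* Let $\mathfrak{g}$ be an AE-Lie algebra over $\mathbb{K}$ and $R\ge1$. Then for all $x,y\in\widehat{\mathrm{S}}_R^\bullet(\mathfrak{g})$ the map $$\mathbb{K}\ni z\longmapsto x\star_z y\in\widehat{\mathrm{S}}_R^\bullet(\mathfrak{g})$$ is analytic, with (absolutely convergent) Taylor expansion at $z=0$ given by $x\star_z y=\sum_{n=0}^\infty z^nC_n(x,y)$. For $\mathbb{K}=\mathbb{C}$, the collection of algebras $\{(\widehat{\mathrm{S}}_R^\bullet(\mathfrak{g}),\star_z)\}_{z\in\mathbb{C}}$ is an entire holomorphic deformation of the completed symmetric tensor algebra $(\widehat{\mathrm{S}}_R^\bullet(\mathfrak{g}),\vee)$ (where $\vee=\star_0$ is the symmetric product).
   Context: $\mathbb{K}$ is $\mathbb{R}$ or $\mathbb{C}$. An AE-Lie algebra is a (Hausdorff) locally convex Lie algebra with continuous bracket in which every continuous seminorm $p$ has an asymptotic estimate: a continuous seminorm $q$ with $p(w_n(x_1,\ldots,x_n))\le q(x_1)\cdots q(x_n)$ for all $n\ge1$, all $x_i\in\mathfrak{g}$ and all words $w_n$ made out of $n-1$ Lie brackets of $x_1,\ldots,x_n$ with arbitrary bracketing. $p^n$ is the $n$-th projective tensor power of a continuous seminorm $p$ on $\mathfrak{g}^{\otimes n}$ ($p^0=|\cdot|$), $p_R=\sum_{n\ge0}n!^Rp^n$; $\mathrm{S}_R^\bullet(\mathfrak{g})$ is the symmetric tensor algebra (symmetric tensors inside $\mathrm{T}^\bullet(\mathfrak{g})$, with product $\xi_1\cdots\xi_n=\frac1{n!}\sum_\sigma\xi_{\sigma(1)}\otimes\cdots\otimes\xi_{\sigma(n)}$)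 with the topology of all $p_R$, and $\widehat{\mathrm{S}}_R^\bullet(\mathfrak{g})$ its completion. Let $\mathfrak{q}\colon \mathrm{S}^\bullet(\mathfrak{g})\to\mathcal{U}(\mathfrak{g})$, $\mathfrak{q}(\xi_1\cdots\xi_n)=\frac1{n!}\sum_\sigma\xi_{\sigma(1)}\odot\cdots\odot\xi_{\sigma(n)}$, $\odot$ being the product of the universal enveloping algebra, and $\pi_n$ the projection onto $\mathrm{S}^n(\mathfrak{g})$. For $f\in \mathrm{S}^k(\mathfrak{g})$, $g\in \mathrm{S}^\ell(\mathfrak{g})$ put $C_n(f,g)=\pi_{k+\ell-n}\big(\mathfrak{q}^{-1}(\mathfrak{q}(f)\odot\mathfrak{q}(g))\big)$; the Gutt star product is $f\star_z g=\sum_nz^nC_n(f,g)$. Explicitly, for $\xi,\eta\in\mathfrak{g}$ and $r=k+\ell-n\geq 1$, $C_n(\xi^k,\eta^\ell)=\frac{k!\,\ell!}{r!}\sum\mathrm{BCH}_{a_1,b_1}(\xi,\eta)\cdots\mathrm{BCH}_{a_r,b_r}(\xi,\eta)$, the sum over $a_i,b_i\ge0$ with $a_i+b_i\ge1$, $\sum a_i=k$, $\sum b_i=\ell$, where $\mathrm{BCH}_{a,b}(\xi,\eta)$ is the part of degree $a$ in $\xi$ and $b$ in $\eta$ of $\log(\exp\xi\exp\eta)$. For $R\ge1$, $C_n$ and $\star_z$ are continuous on $\mathrm{S}_R^\bullet(\mathfrak{g})$ and are extended to $\widehat{\mathrm{S}}_R^\bullet(\mathfrak{g})$ by continuity. "Entire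 holomorphic deformation" means: each $\star_z$ is an associative continuous product, $\star_0=\vee$, and $z\mapsto x\star_z y$ is an entire holomorphic map for all $x,y$. "Absolutely convergent" means $\sum_n|z|^np_R(C_n(x,y))<\infty$ for all continuous seminorms $p$ on $\mathfrak{g}$. *)

theory Defs
  imports
    "HOL-Analysis.Analysis"
    "HOL-Library.Function_Algebras"
    "HOL-Combinatorics.Permutations"
    "HOL-Algebra.QuotRing"
begin

text \<open>
  The ground field is a type \<open>'k\<close> of class \<^class>\<open>real_normed_field\<close>; it is instantiated by
  \<^typ>\<open>real\<close> and \<^typ>\<open>complex\<close>. Scalar multiplications are explicit parameters, as
  in the locale \<^locale>\<open>vector_space\<close>.
\<close>

section \<open>Locally convex spaces\<close>

locale locally_convex_space = vector_space scl
  for scl :: "'k::real_normed_field \<Rightarrow> 'a::{topological_ab_group_add, t2_space} \<Rightarrow> 'a" +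
  assumes continuous_scale: "continuous_on UNIV (\<lambda>(c, x). scl c x)"
    and locally_convex: "\<lbrakk>open U; 0 \<in> U\<rbrakk> \<Longrightarrow>
      \<exists>V. open V \<and> 0 \<in> V \<and> V \<subseteq> U \<and>
        (\<forall>x\<in>V. \<forall>y\<in>V. \<forall>t\<in>{0..1::real}. scl (of_real (1 - t)) x + scl (of_real t) y \<in> V)"

definition cauchy_filter_add :: "'a::{topological_space, ab_group_add} filter \<Rightarrow> bool" where
  "cauchy_filter_add F \<longleftrightarrow>
    (\<forall>U. open U \<and> 0 \<in> U \<longrightarrow> (\<exists>A. (\<forall>\<^sub>F x in F. x \<in> A) \<and> (\<forall>x\<in>A. \<forall>y\<in>A. x - y \<in> U)))"

locale complete_locally_convex_space = locally_convex_space scl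
  for scl :: "'k::real_normed_field \<Rightarrow> 'a::{topological_ab_group_add, t2_space} \<Rightarrow> 'a" +
  assumes complete: "\<lbrakk>F \<noteq> bot; cauchy_filter_add (F :: 'a filter)\<rbrakk> \<Longrightarrow> \<exists>x. F \<le> nhds x"

definition continuous_seminorm ::
  "('k::real_normed_field \<Rightarrow> 'a::{topological_space, ab_group_add} \<Rightarrow> 'a) \<Rightarrow> ('a \<Rightarrow> real) \<Rightarrow> bool"
where
  "continuous_seminorm scl p \<longleftrightarrow>
    (\<forall>x y. p (x + y) \<le> p x + p y) \<and> (\<forall>c x. p (scl c x) = norm c * p x) \<and>
    continuous_on UNIV p"

definition seminorm_topology :: "'a::ab_group_add set \<Rightarrow> ('a \<Rightarrow> real) set \<Rightarrow> 'a topology" where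
  "seminorm_topology S P =
    topology_generated_by {{y \<in> S. p (y - x) < e} | x p e. x \<in> S \<and> p \<in> P \<and> 0 < e}"


section \<open>AE-Lie algebras\<close>

text \<open>
  The letters of a word appear in order. This loses nothing in the estimate below, whose right-hand
  side is invariant under permuting them.
\<close>

inductive lie_word :: "('a \<Rightarrow> 'a \<Rightarrow> 'a) \<Rightarrow> 'a list \<Rightarrow> 'a \<Rightarrow> bool" for br where
  lie_word_leaf: "lie_word br [x] x"
| lie_word_bracket: "\<lbrakk>lie_word br xs v; lie_word br ys w\<rbrakk> \<Longrightarrow> lie_word br (xs @ ys) (br v w)"

definition asymptotic_estimate :: "('a \<Rightarrow> 'a \<Rightarrow> 'a) \<Rightarrow> ('a \<Rightarrow> real) \<Rightarrow> ('a \<Rightarrow> real) \<Rightarrow> bool" where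
  "asymptotic_estimate br p q \<longleftrightarrow> (\<forall>xs w. lie_word br xs w \<longrightarrow> p w \<le> prod_list (map q xs))"

locale lie_algebra = vector_space scl
  for scl :: "'k::field \<Rightarrow> 'a::ab_group_add \<Rightarrow> 'a" and br :: "'a \<Rightarrow> 'a \<Rightarrow> 'a" +
  assumes bracket_add_left: "br (x + y) z = br x z + br y z"
    and bracket_add_right: "br x (y + z) = br x y + br x z"
    and bracket_scale_left: "br (scl c x) y = scl c (br x y)"
    and bracket_scale_right: "br x (scl c y) = scl c (br x y)"
    and bracket_alternating: "br x x = 0"
    and jacobi: "br x (br y z) + br y (br z x) + br z (br x y) = 0"

locale AE_lie_algebra = locally_convex_space scl + lie_algebra scl br
  for scl :: "'k::real_normed_field \<Rightarrow> 'a::{topological_ab_group_add, t2_space} \<Rightarrow> 'a"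
    and br :: "'a \<Rightarrow> 'a \<Rightarrow> 'a" +
  assumes continuous_bracket: "continuous_on UNIV (\<lambda>(x, y). br x y)"
    and asymptotic_estimates: "continuous_seminorm scl p \<Longrightarrow>
      \<exists>q. continuous_seminorm scl q \<and> asymptotic_estimate br p q"


section \<open>The tensor algebra\<close>

text \<open>
  A function on lists that is multilinear in the entries is a sequence of \<open>n\<close>-linear maps, one for
  each length \<open>n\<close>. Over a field, multilinear forms separate the points of an algebraic tensor power,
  so \<open>x\<^sub>1 \<otimes> \<dots> \<otimes> x\<^sub>n\<close> is realised as the evaluation \<open>\<phi> \<mapsto> \<phi> [x\<^sub>1, \<dots>, x\<^sub>n]\<close> on such families of forms,
  and the tensor algebra as the span of these evaluations (with value \<open>0\<close> off the multilinear forms,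
  to make equality of tensors equality of functions). The universal property is proved below
  (\<open>tensor_universal\<close>).
\<close>

definition multilinear ::
  "('k \<Rightarrow> 'a::ab_group_add \<Rightarrow> 'a) \<Rightarrow> ('k \<Rightarrow> 'w::ab_group_add \<Rightarrow> 'w) \<Rightarrow> ('a list \<Rightarrow> 'w) \<Rightarrow> bool"
where
  "multilinear scl scl' f \<longleftrightarrow> (\<forall>xs i. i < length xs \<longrightarrow>
    (\<forall>x y. f (xs[i := x + y]) = f (xs[i := x]) + f (xs[i := y])) \<and>
    (\<forall>c x. f (xs[i := scl c x]) = scl' c (f (xs[i := x]))))"

type_synonym ('a, 'k) tensor = "('a list \<Rightarrow> 'k) \<Rightarrow> 'k"

abbreviation multilinear_form ::
  "('k::field \<Rightarrow> 'a::ab_group_add \<Rightarrow> 'a) \<Rightarrow> ('a list \<Rightarrow> 'k) \<Rightarrow> bool" where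
  "multilinear_form scl \<equiv> multilinear scl (*)"

definition tscale :: "'k::field \<Rightarrow> ('a, 'k) tensor \<Rightarrow> ('a, 'k) tensor" where
  "tscale c t = (\<lambda>\<phi>. c * t \<phi>)"

definition tens :: "('k::field \<Rightarrow> 'a::ab_group_add \<Rightarrow> 'a) \<Rightarrow> 'a list \<Rightarrow> ('a, 'k) tensor" where
  "tens scl xs = (\<lambda>\<phi>. if multilinear_form scl \<phi> then \<phi> xs else 0)"

definition tensors :: "('k::field \<Rightarrow> 'a::ab_group_add \<Rightarrow> 'a) \<Rightarrow> ('a, 'k) tensor set" where
  "tensors scl = module.span tscale (range (tens scl))"

definition tmult ::
  "('k::field \<Rightarrow> 'a::ab_group_add \<Rightarrow> 'a) \<Rightarrow> ('a, 'k) tensor \<Rightarrow> ('a, 'k) tensor \<Rightarrow> ('a, 'k) tensor"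
where
  "tmult scl t s =
    (\<lambda>\<phi>. if multilinear_form scl \<phi> then t (\<lambda>xs. s (\<lambda>ys. \<phi> (xs @ ys))) else 0)"

definition tproj ::
  "('k::field \<Rightarrow> 'a::ab_group_add \<Rightarrow> 'a) \<Rightarrow> nat \<Rightarrow> ('a, 'k) tensor \<Rightarrow> ('a, 'k) tensor"
where
  "tproj scl n t =
    (\<lambda>\<phi>. if multilinear_form scl \<phi> then t (\<lambda>xs. if length xs = n then \<phi> xs else 0) else 0)"

text \<open>The permutation action on the component of degree \<open>n\<close>; only for \<open>\<sigma> permutes {..<n}\<close>.\<close>

definition tperm ::
  "('k::field \<Rightarrow> 'a::ab_group_add \<Rightarrow> 'a) \<Rightarrow> nat \<Rightarrow> (nat \<Rightarrow> nat) \<Rightarrow> ('a, 'k) tensor \<Rightarrow> ('a, 'k) tensor"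
where
  "tperm scl n \<sigma> t =
    (\<lambda>\<phi>. if multilinear_form scl \<phi>
      then t (\<lambda>xs. if length xs = n then \<phi> (permute_list \<sigma> xs) else 0) else 0)"

definition tensor_ring :: "('k::field \<Rightarrow> 'a::ab_group_add \<Rightarrow> 'a) \<Rightarrow> ('a, 'k) tensor ring" where
  "tensor_ring scl =
    \<lparr>carrier = tensors scl, mult = tmult scl, one = tens scl [], zero = 0, add = (+)\<rparr>"


section \<open>The symmetric algebra\<close>

definition symtensors :: "('k::field_char_0 \<Rightarrow> 'a::ab_group_add \<Rightarrow> 'a) \<Rightarrow> ('a, 'k) tensor set" where
  "symtensors scl =
    {t \<in> tensors scl. \<forall>n \<sigma>. \<sigma> permutes {..<n} \<longrightarrow> tperm scl n \<sigma> t = tproj scl n t}"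

definition symmetrize ::
  "('k::field_char_0 \<Rightarrow> 'a::ab_group_add \<Rightarrow> 'a) \<Rightarrow> ('a, 'k) tensor \<Rightarrow> ('a, 'k) tensor"
where
  "symmetrize scl t = (\<Sum>n | tproj scl n t \<noteq> 0.
    tscale (1 / fact n) (\<Sum>\<sigma> | \<sigma> permutes {..<n}. tperm scl n \<sigma> t))"

definition symmult ::
  "('k::field_char_0 \<Rightarrow> 'a::ab_group_add \<Rightarrow> 'a) \<Rightarrow> ('a, 'k) tensor \<Rightarrow> ('a, 'k) tensor \<Rightarrow> ('a, 'k) tensor"
where
  "symmult scl f g = symmetrize scl (tmult scl f g)"

text \<open>
  \<open>symprod scl [x\<^sub>1, \<dots>, x\<^sub>n]\<close> is \<open>x\<^sub>1 \<cdots> x\<^sub>n\<close>. By \<open>symmult_symprod\<close> below, \<^const>\<open>symmult\<close> is the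
  corresponding bilinear product.
\<close>

definition symprod :: "('k::field_char_0 \<Rightarrow> 'a::ab_group_add \<Rightarrow> 'a) \<Rightarrow> 'a list \<Rightarrow> ('a, 'k) tensor" where
  "symprod scl xs = tscale (1 / fact (length xs))
    (\<Sum>\<sigma> | \<sigma> permutes {..<length xs}. tens scl (permute_list \<sigma> xs))"


section \<open>The topology\<close>

text \<open>
  The coefficients in the representations of \<open>t\<close> matter only for \<open>n = 0\<close>, where they give
  \<open>p\<^sup>0 = \<bar>\<cdot>\<bar>\<close>.
\<close>

definition proj_seminorm ::
  "('k::real_normed_field \<Rightarrow> 'a::ab_group_add \<Rightarrow> 'a) \<Rightarrow> ('a \<Rightarrow> real) \<Rightarrow> nat \<Rightarrow> ('a, 'k) tensor \<Rightarrow> real"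
where
  "proj_seminorm scl p n t =
    Inf {(\<Sum>(c, xs)\<leftarrow>L. norm c * prod_list (map p xs)) | L.
      (\<forall>(c, xs)\<in>set L. length xs = n) \<and> t = (\<Sum>(c, xs)\<leftarrow>L. tscale c (tens scl xs))}"

definition tensor_seminorm ::
  "('k::real_normed_field \<Rightarrow> 'a::ab_group_add \<Rightarrow> 'a) \<Rightarrow> real \<Rightarrow> ('a \<Rightarrow> real) \<Rightarrow> ('a, 'k) tensor \<Rightarrow> real"
where
  "tensor_seminorm scl R p t =
    (\<Sum>n. fact n powr R * proj_seminorm scl p n (tproj scl n t))"

definition sym_topology ::
  "('k::real_normed_field \<Rightarrow> 'a::{topological_space, ab_group_add} \<Rightarrow> 'a) \<Rightarrow> real \<Rightarrow> ('a, 'k) tensor topology"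
where
  "sym_topology scl R =
    seminorm_topology (symtensors scl) (tensor_seminorm scl R ` {p. continuous_seminorm scl p})"

locale sym_completion = complete_locally_convex_space cscale
  for scl :: "'k::real_normed_field \<Rightarrow> 'a::{topological_ab_group_add, t2_space} \<Rightarrow> 'a"
    and R :: real
    and cscale :: "'k \<Rightarrow> 'c::{topological_ab_group_add, t2_space} \<Rightarrow> 'c"
    and \<iota> :: "('a, 'k) tensor \<Rightarrow> 'c" +
  assumes iota_add: "\<lbrakk>f \<in> symtensors scl; g \<in> symtensors scl\<rbrakk> \<Longrightarrow> \<iota> (f + g) = \<iota> f + \<iota> g"
    and iota_scale: "f \<in> symtensors scl \<Longrightarrow> \<iota> (tscale c f) = cscale c (\<iota> f)"
    and iota_embedding: "embedding_map (sym_topology scl R) euclidean \<iota>"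
    and iota_dense: "closure (\<iota> ` symtensors scl) = UNIV"


section \<open>The universal enveloping algebra\<close>

definition env_ideal ::
  "('k::field \<Rightarrow> 'a::ab_group_add \<Rightarrow> 'a) \<Rightarrow> ('a \<Rightarrow> 'a \<Rightarrow> 'a) \<Rightarrow> ('a, 'k) tensor set"
where
  "env_ideal scl br = Idl\<^bsub>tensor_ring scl\<^esub>
    {tens scl [x, y] - tens scl [y, x] - tens scl [br x y] | x y. True}"

definition env_algebra ::
  "('k::field \<Rightarrow> 'a::ab_group_add \<Rightarrow> 'a) \<Rightarrow> ('a \<Rightarrow> 'a \<Rightarrow> 'a) \<Rightarrow> ('a, 'k) tensor set ring"
where
  "env_algebra scl br = tensor_ring scl Quot env_ideal scl br"

definition env_class ::
  "('k::field \<Rightarrow> 'a::ab_group_add \<Rightarrow> 'a) \<Rightarrow> ('a \<Rightarrow> 'a \<Rightarrow> 'a) \<Rightarrow> ('a, 'k) tensor \<Rightarrow> ('a, 'k) tensor set"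
where
  "env_class scl br t = env_ideal scl br +>\<^bsub>tensor_ring scl\<^esub> t"

text \<open>
  Because \<open>x\<^sub>1 \<cdots> x\<^sub>n\<close> is the tensor \<open>1/n! \<Sum>\<^sub>\<sigma> x\<^bsub>\<sigma>(1)\<^esub> \<otimes> \<dots> \<otimes> x\<^bsub>\<sigma>(n)\<^esub>\<close>, the symmetrization map
  \<open>\<qq>\<close> is the restriction of the quotient map to the symmetric tensors
  (see \<open>quantization_symprod\<close>).
\<close>

definition quantization ::
  "('k::field_char_0 \<Rightarrow> 'a::ab_group_add \<Rightarrow> 'a) \<Rightarrow> ('a \<Rightarrow> 'a \<Rightarrow> 'a) \<Rightarrow> ('a, 'k) tensor \<Rightarrow> ('a, 'k) tensor set"
where
  "quantization scl br f = env_class scl br f"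


section \<open>The Gutt star product\<close>

text \<open>
  The case \<open>n > k + l\<close> is separate because there \<open>k + l - n\<close> truncates, while the projection onto a
  component of negative degree is \<open>0\<close>. \<open>gutt_C\<close> is the bilinear extension of \<open>gutt_C_hom\<close>, by
  decomposition into homogeneous components; the sums there and in \<open>gutt_star\<close> are finite.
\<close>

definition gutt_C_hom ::
  "('k::field_char_0 \<Rightarrow> 'a::ab_group_add \<Rightarrow> 'a) \<Rightarrow> ('a \<Rightarrow> 'a \<Rightarrow> 'a) \<Rightarrow> nat \<Rightarrow> nat \<Rightarrow> nat
    \<Rightarrow> ('a, 'k) tensor \<Rightarrow> ('a, 'k) tensor \<Rightarrow> ('a, 'k) tensor"
where
  "gutt_C_hom scl br n k l f g =
    (if n \<le> k + l
     then tproj scl (k + l - n)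
       (inv_into (symtensors scl) (quantization scl br)
         (quantization scl br f \<otimes>\<^bsub>env_algebra scl br\<^esub> quantization scl br g))
     else 0)"

definition gutt_C ::
  "('k::field_char_0 \<Rightarrow> 'a::ab_group_add \<Rightarrow> 'a) \<Rightarrow> ('a \<Rightarrow> 'a \<Rightarrow> 'a) \<Rightarrow> nat
    \<Rightarrow> ('a, 'k) tensor \<Rightarrow> ('a, 'k) tensor \<Rightarrow> ('a, 'k) tensor"
where
  "gutt_C scl br n f g = (\<Sum>k | tproj scl k f \<noteq> 0. \<Sum>l | tproj scl l g \<noteq> 0.
    gutt_C_hom scl br n k l (tproj scl k f) (tproj scl l g))"

definition gutt_star ::
  "('k::field_char_0 \<Rightarrow> 'a::ab_group_add \<Rightarrow> 'a) \<Rightarrow> ('a \<Rightarrow> 'a \<Rightarrow> 'a) \<Rightarrow> 'k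
    \<Rightarrow> ('a, 'k) tensor \<Rightarrow> ('a, 'k) tensor \<Rightarrow> ('a, 'k) tensor"
where
  "gutt_star scl br z f g =
    (\<Sum>n | gutt_C scl br n f g \<noteq> 0. tscale (z ^ n) (gutt_C scl br n f g))"


section \<open>Extension to the completion\<close>

text \<open>
  By density of the image of \<open>\<iota>\<close> and the Hausdorff property there is at most one continuous
  extension.
\<close>

definition ext_seminorm ::
  "('k::real_normed_field \<Rightarrow> 'a::ab_group_add \<Rightarrow> 'a) \<Rightarrow> (('a, 'k) tensor \<Rightarrow> 'c::topological_space)
    \<Rightarrow> (('a, 'k) tensor \<Rightarrow> real) \<Rightarrow> 'c \<Rightarrow> real"
where
  "ext_seminorm scl \<iota> p =
    (THE P. continuous_on UNIV P \<and> (\<forall>f\<in>symtensors scl. P (\<iota> f) = p f))"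

definition ext_binary ::
  "('k::real_normed_field \<Rightarrow> 'a::ab_group_add \<Rightarrow> 'a) \<Rightarrow> (('a, 'k) tensor \<Rightarrow> 'c::topological_space)
    \<Rightarrow> (('a, 'k) tensor \<Rightarrow> ('a, 'k) tensor \<Rightarrow> ('a, 'k) tensor) \<Rightarrow> 'c \<Rightarrow> 'c \<Rightarrow> 'c"
where
  "ext_binary scl \<iota> B =
    (THE F. continuous_on UNIV (\<lambda>(x, y). F x y) \<and>
      (\<forall>f\<in>symtensors scl. \<forall>g\<in>symtensors scl. F (\<iota> f) (\<iota> g) = \<iota> (B f g)))"

definition gutt_C_hat ::
  "('k::real_normed_field \<Rightarrow> 'a::ab_group_add \<Rightarrow> 'a) \<Rightarrow> ('a \<Rightarrow> 'a \<Rightarrow> 'a)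
    \<Rightarrow> (('a, 'k) tensor \<Rightarrow> 'c::topological_space) \<Rightarrow> nat \<Rightarrow> 'c \<Rightarrow> 'c \<Rightarrow> 'c"
where
  "gutt_C_hat scl br \<iota> n = ext_binary scl \<iota> (gutt_C scl br n)"

definition gutt_star_hat ::
  "('k::real_normed_field \<Rightarrow> 'a::ab_group_add \<Rightarrow> 'a) \<Rightarrow> ('a \<Rightarrow> 'a \<Rightarrow> 'a)
    \<Rightarrow> (('a, 'k) tensor \<Rightarrow> 'c::topological_space) \<Rightarrow> 'k \<Rightarrow> 'c \<Rightarrow> 'c \<Rightarrow> 'c"
where
  "gutt_star_hat scl br \<iota> z = ext_binary scl \<iota> (gutt_star scl br z)"

definition symmult_hat ::
  "('k::real_normed_field \<Rightarrow> 'a::ab_group_add \<Rightarrow> 'a)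
    \<Rightarrow> (('a, 'k) tensor \<Rightarrow> 'c::topological_space) \<Rightarrow> 'c \<Rightarrow> 'c \<Rightarrow> 'c"
where
  "symmult_hat scl \<iota> = ext_binary scl \<iota> (symmult scl)"

definition tensor_seminorm_hat ::
  "('k::real_normed_field \<Rightarrow> 'a::ab_group_add \<Rightarrow> 'a) \<Rightarrow> real
    \<Rightarrow> (('a, 'k) tensor \<Rightarrow> 'c::topological_space) \<Rightarrow> ('a \<Rightarrow> real) \<Rightarrow> 'c \<Rightarrow> real"
where
  "tensor_seminorm_hat scl R \<iota> p = ext_seminorm scl \<iota> (tensor_seminorm scl R p)"


section \<open>Analytic and holomorphic maps, deformations\<close>

definition analytic_map ::
  "('k::real_normed_field \<Rightarrow> 'c::{topological_space, ab_group_add} \<Rightarrow> 'c) \<Rightarrow> ('k \<Rightarrow> 'c) \<Rightarrow> bool"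
where
  "analytic_map cscale f \<longleftrightarrow>
    (\<forall>z0. \<exists>r>0. \<exists>a. \<forall>z. norm (z - z0) < r \<longrightarrow> (\<lambda>n. cscale ((z - z0) ^ n) (a n)) sums f z)"

definition entire_map ::
  "(complex \<Rightarrow> 'c::{topological_space, ab_group_add} \<Rightarrow> 'c) \<Rightarrow> (complex \<Rightarrow> 'c) \<Rightarrow> bool"
where
  "entire_map cscale f \<longleftrightarrow>
    (\<forall>z. \<exists>d. ((\<lambda>h. cscale (1 / h) (f (z + h) - f z)) \<longlongrightarrow> d) (at 0))"

definition continuous_assoc_product ::
  "('k \<Rightarrow> 'c::{topological_space, ab_group_add} \<Rightarrow> 'c) \<Rightarrow> ('c \<Rightarrow> 'c \<Rightarrow> 'c) \<Rightarrow> bool"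
where
  "continuous_assoc_product cscale m \<longleftrightarrow>
    (\<forall>x y z. m (x + y) z = m x z + m y z \<and> m x (y + z) = m x y + m x z) \<and>
    (\<forall>c x y. m (cscale c x) y = cscale c (m x y) \<and> m x (cscale c y) = cscale c (m x y)) \<and>
    (\<forall>x y z. m (m x y) z = m x (m y z)) \<and>
    continuous_on UNIV (\<lambda>(x, y). m x y)"

definition entire_holomorphic_deformation ::
  "(complex \<Rightarrow> 'c::{topological_space, ab_group_add} \<Rightarrow> 'c) \<Rightarrow> ('c \<Rightarrow> 'c \<Rightarrow> 'c)
    \<Rightarrow> (complex \<Rightarrow> 'c \<Rightarrow> 'c \<Rightarrow> 'c) \<Rightarrow> bool"
where
  "entire_holomorphic_deformation cscale m star \<longleftrightarrow>
    (\<forall>z. continuous_assoc_product cscale (star z)) \<and> star 0 = m \<and>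
    (\<forall>x y. entire_map cscale (\<lambda>z. star z x y))"


section \<open>The model satisfies the defining properties\<close>

text \<open>
  \<open>0\<close> and \<open>+\<close> on tensors are those of function spaces; they are kept folded below.
\<close>


context
  notes plus_fun_apply [simp del] zero_fun_apply [simp del]
begin


lemma multilinearI:
  assumes "\<And>xs i x y. i < length xs \<Longrightarrow> f (xs[i := x + y]) = f (xs[i := x]) + f (xs[i := y])"
    and "\<And>xs i c x. i < length xs \<Longrightarrow> f (xs[i := scl c x]) = scl' c (f (xs[i := x]))"
  shows "multilinear scl scl' f"
  using assms by (simp add: multilinear_def)

lemma multilinear_add:
  "multilinear scl scl' f \<Longrightarrow> i < length xs \<Longrightarrow> f (xs[i := x + y]) = f (xs[i := x]) + f (xs[i := y])"
  by (simp add: multilinear_def)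

lemma multilinear_scale:
  "multilinear scl scl' f \<Longrightarrow> i < length xs \<Longrightarrow> f (xs[i := scl c x]) = scl' c (f (xs[i := x]))"
  by (simp add: multilinear_def)

lemma multilinear_append_right:
  assumes "multilinear scl scl' f" shows "multilinear scl scl' (\<lambda>ys. f (xs @ ys))"
proof -
  have *: "xs @ ys[i := z] = (xs @ ys)[length xs + i := z]" for ys i z
    by (simp add: list_update_append)
  show ?thesis
    by (rule multilinearI) (simp_all add: * multilinear_add[OF assms] multilinear_scale[OF assms])
qed

lemma multilinear_append_left:
  assumes "multilinear scl scl' f" shows "multilinear scl scl' (\<lambda>xs. f (xs @ ys))"
proof -
  have *: "xs[i := z] @ ys = (xs @ ys)[i := z]" if "i < length xs" for xs i z
    using that by (simp add: list_update_append)
  show ?thesis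
    by (rule multilinearI) (simp_all add: * multilinear_add[OF assms] multilinear_scale[OF assms])
qed

lemma multilinear_form_add:
  "multilinear_form scl \<phi> \<Longrightarrow> multilinear_form scl \<psi> \<Longrightarrow> multilinear_form scl (\<lambda>xs. \<phi> xs + \<psi> xs)"
  by (rule multilinearI) (simp_all add: multilinear_add multilinear_scale algebra_simps)

lemma multilinear_form_scale:
  "multilinear_form scl \<phi> \<Longrightarrow> multilinear_form scl (\<lambda>xs. c * \<phi> xs)"
  by (rule multilinearI) (simp_all add: multilinear_add multilinear_scale algebra_simps)

lemma multilinear_form_degree:
  "multilinear_form scl \<phi> \<Longrightarrow> multilinear_form scl (\<lambda>xs. if length xs = n then \<phi> xs else 0)"
  by (rule multilinearI) (simp_all add: multilinear_add multilinear_scale)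

lemma multilinear_form_permute:
  assumes "multilinear_form scl \<phi>" and \<sigma>: "\<sigma> permutes {..<n}"
  shows "multilinear_form scl (\<lambda>xs. if length xs = n then \<phi> (permute_list \<sigma> xs) else 0)"
proof -
  have *: "permute_list \<sigma> (xs[i := z]) = (permute_list \<sigma> xs)[inv_into UNIV \<sigma> i := z]" "inv_into UNIV \<sigma> i < n"
    if "length xs = n" "i < length xs" for xs i z
  proof -
    show "inv_into UNIV \<sigma> i < n"
      using permutes_in_image[OF permutes_inv[OF \<sigma>], of i] that by simp
    show "permute_list \<sigma> (xs[i := z]) = (permute_list \<sigma> xs)[inv_into UNIV \<sigma> i := z]"
    proof (rule nth_equalityI)
      fix j assume "j < length (permute_list \<sigma> (xs[i := z]))"
      then have "j < n" using that by simp
      then have "\<sigma> j < n" using permutes_in_image[OF \<sigma>, of j] by simp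
      with \<open>j < n\<close> show "permute_list \<sigma> (xs[i := z]) ! j = (permute_list \<sigma> xs)[inv_into UNIV \<sigma> i := z] ! j"
        using that \<sigma> permutes_inverses[OF \<sigma>] \<open>inv_into UNIV \<sigma> i < n\<close>
        by (auto simp: permute_list_nth nth_list_update)
    qed simp
  qed
  show ?thesis
    by (rule multilinearI)
      (auto simp: * multilinear_add[OF assms(1)] multilinear_scale[OF assms(1)])
qed

end

interpretation tensor_space: vector_space "tscale :: 'k::field \<Rightarrow> ('a, 'k) tensor \<Rightarrow> ('a, 'k) tensor"
  by unfold_locales (simp_all add: tscale_def fun_eq_iff algebra_simps)

context
  notes plus_fun_apply [simp del] zero_fun_apply [simp del]
begin

lemma tens_in_tensors [simp]: "tens scl xs \<in> tensors scl"
  by (simp add: tensors_def tensor_space.span_base)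

lemma tensors_add: "t \<in> tensors scl \<Longrightarrow> s \<in> tensors scl \<Longrightarrow> t + s \<in> tensors scl"
  by (simp add: tensors_def tensor_space.span_add)

lemma tensors_scale: "t \<in> tensors scl \<Longrightarrow> tscale c t \<in> tensors scl"
  by (simp add: tensors_def tensor_space.span_scale)

lemma tensors_zero [simp]: "0 \<in> tensors scl"
  by (simp add: tensors_def tensor_space.span_zero)

lemma tensors_sum: "(\<And>i. i \<in> I \<Longrightarrow> t i \<in> tensors scl) \<Longrightarrow> sum t I \<in> tensors scl"
  by (simp add: tensors_def tensor_space.span_sum)

lemma tensors_diff: "t \<in> tensors scl \<Longrightarrow> s \<in> tensors scl \<Longrightarrow> t - s \<in> tensors scl"
  by (simp add: tensors_def tensor_space.span_diff)

lemma tensors_induct [consumes 1, case_names zero add scale_tens]: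
  assumes "t \<in> tensors scl" and "P 0"
    and add: "\<And>s t. s \<in> tensors scl \<Longrightarrow> t \<in> tensors scl \<Longrightarrow> P s \<Longrightarrow> P t \<Longrightarrow> P (s + t)"
    and sc: "\<And>c xs. P (tscale c (tens scl xs))"
  shows "P t"
proof -
  have "t \<in> tensors scl \<and> P t"
    using assms(1) unfolding tensors_def
  proof (induction rule: tensor_space.span_induct_alt)
    case base
    then show ?case using assms(2) tensors_zero[unfolded tensors_def] by blast
  next
    case (step c x y)
    then obtain xs where "x = tens scl xs" by auto
    then show ?case
      using add[of "tscale c x" y] sc step.IH
      by (simp add: tensors_def tensor_space.span_base tensor_space.span_scale tensor_space.span_add)
  qed
  then show ?thesis ..
qed

lemma tensor_apply:
  assumes "t \<in> tensors scl"
  shows "\<not> multilinear_form scl \<phi> \<Longrightarrow> t \<phi> = 0"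
    and "multilinear_form scl \<phi> \<Longrightarrow> multilinear_form scl \<psi> \<Longrightarrow> t (\<lambda>xs. \<phi> xs + \<psi> xs) = t \<phi> + t \<psi>"
    and "multilinear_form scl \<phi> \<Longrightarrow> t (\<lambda>xs. c * \<phi> xs) = c * t \<phi>"
  using assms
  by (induction t rule: tensors_induct)
    (auto simp: plus_fun_apply zero_fun_apply tscale_def tens_def multilinear_form_add multilinear_form_scale algebra_simps)

lemma multilinear_form_apply:
  assumes "s \<in> tensors scl" "multilinear_form scl \<phi>"
  shows "multilinear_form scl (\<lambda>xs. s (\<lambda>ys. \<phi> (xs @ ys)))"
  using assms(1)
proof (induction s rule: tensors_induct)
  case zero
  then show ?case by (auto simp: zero_fun_apply intro: multilinearI)
next
  case (add s t)
  then show ?case by (simp add: plus_fun_apply multilinear_form_add)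
next
  case (scale_tens c zs)
  then show ?case
    using multilinear_append_right[OF assms(2)]
    by (simp add: tscale_def tens_def multilinear_form_scale multilinear_append_left[OF assms(2)])
qed

lemma tmult_tens: "tmult scl (tens scl xs) (tens scl ys) = tens scl (xs @ ys)"
proof
  fix \<phi>
  show "tmult scl (tens scl xs) (tens scl ys) \<phi> = tens scl (xs @ ys) \<phi>"
    by (cases "multilinear_form scl \<phi>")
      (simp_all add: tmult_def tens_def multilinear_append_right multilinear_append_left)
qed

lemma tmult_add_left: "tmult scl (t + t') s = tmult scl t s + tmult scl t' s"
  by (auto simp: tmult_def fun_eq_iff plus_fun_apply zero_fun_apply)

lemma tmult_scale_left: "tmult scl (tscale c t) s = tscale c (tmult scl t s)"
  by (auto simp: tmult_def tscale_def)

lemma tmult_add_right: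
  assumes "t \<in> tensors scl" "s \<in> tensors scl" "s' \<in> tensors scl"
  shows "tmult scl t (s + s') = tmult scl t s + tmult scl t s'"
  by (auto simp: tmult_def fun_eq_iff plus_fun_apply tensor_apply(2)[OF assms(1)] multilinear_form_apply assms)

lemma tmult_scale_right:
  assumes "t \<in> tensors scl" "s \<in> tensors scl"
  shows "tmult scl t (tscale c s) = tscale c (tmult scl t s)"
  by (auto simp: tmult_def tscale_def tensor_apply(3)[OF assms(1)] multilinear_form_apply assms)

lemma tmult_zero_left [simp]: "tmult scl 0 s = 0"
  by (auto simp: tmult_def fun_eq_iff plus_fun_apply zero_fun_apply)

lemma tmult_zero_right:
  assumes "t \<in> tensors scl" shows "tmult scl t 0 = 0"
  using tmult_scale_right[OF assms tensors_zero, of 0] by simp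

lemma tmult_in_tensors:
  assumes t: "t \<in> tensors scl" and s: "s \<in> tensors scl"
  shows "tmult scl t s \<in> tensors scl"
proof -
  have *: "tmult scl (tens scl xs) s \<in> tensors scl" for xs
    using s
    by (induction s rule: tensors_induct)
      (simp_all add: tmult_zero_right tmult_add_right tmult_scale_right tmult_tens tensors_add tensors_scale)
  show ?thesis
    using t
    by (induction t rule: tensors_induct)
      (simp_all add: tmult_add_left tmult_scale_left * tensors_add tensors_scale)
qed

lemma tmult_assoc:
  "tmult scl (tmult scl t s) r = tmult scl t (tmult scl s r)"
  if "t \<in> tensors scl" "s \<in> tensors scl" "r \<in> tensors scl"
proof
  fix \<phi>
  show "tmult scl (tmult scl t s) r \<phi> = tmult scl t (tmult scl s r) \<phi>"
    using that
    by (cases "multilinear_form scl \<phi>")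
      (simp_all add: tmult_def multilinear_append_right multilinear_form_apply)
qed

lemma tmult_unit:
  assumes "t \<in> tensors scl"
  shows "tmult scl (tens scl []) t = t" "tmult scl t (tens scl []) = t"
  using tensor_apply(1)[OF assms]
  by (auto simp: tmult_def tens_def fun_eq_iff multilinear_append_right multilinear_form_apply[OF assms])

lemma ring_tensor_ring: "ring (tensor_ring scl)"
proof (rule ringI)
  show "abelian_group (tensor_ring scl)"
  proof (rule abelian_groupI, goal_cases)
    case (6 x)
    then have "x \<in> tensors scl"
      by (simp add: tensor_ring_def)
    then have "tscale (-1) x \<in> tensors scl"
      by (rule tensors_scale)
    then have "- x \<in> tensors scl" by simp
    then show ?case
      by (intro bexI[of _ "- x"]) (simp_all add: tensor_ring_def)
  qed (auto simp: tensor_ring_def tensors_add add.assoc add.commute)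
  show "Group.monoid (tensor_ring scl)"
    by unfold_locales (auto simp: tensor_ring_def tmult_in_tensors tmult_assoc tmult_unit)
qed (auto simp: tensor_ring_def tmult_add_left tmult_add_right)

lemma tproj_tens: "tproj scl n (tens scl xs) = (if length xs = n then tens scl xs else 0)"
  by (auto simp: plus_fun_apply zero_fun_apply tproj_def tens_def fun_eq_iff multilinear_form_degree)

lemma tperm_tens:
  "\<sigma> permutes {..<n} \<Longrightarrow>
    tperm scl n \<sigma> (tens scl xs) = (if length xs = n then tens scl (permute_list \<sigma> xs) else 0)"
  by (auto simp: plus_fun_apply zero_fun_apply tperm_def tens_def fun_eq_iff multilinear_form_permute)

lemma tproj_add: "tproj scl n (t + s) = tproj scl n t + tproj scl n s"
  and tproj_scale: "tproj scl n (tscale c t) = tscale c (tproj scl n t)"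
  and tperm_add: "tperm scl n \<sigma> (t + s) = tperm scl n \<sigma> t + tperm scl n \<sigma> s"
  and tperm_scale: "tperm scl n \<sigma> (tscale c t) = tscale c (tperm scl n \<sigma> t)"
  by (auto simp: plus_fun_apply zero_fun_apply tproj_def tperm_def tscale_def fun_eq_iff)

lemma tproj_zero [simp]: "tproj scl n 0 = 0" and tperm_zero [simp]: "tperm scl n \<sigma> 0 = 0"
  by (auto simp: plus_fun_apply zero_fun_apply tproj_def tperm_def fun_eq_iff)

lemma finite_degrees: "t \<in> tensors scl \<Longrightarrow> finite {n. tproj scl n t \<noteq> 0}"
proof (induction t rule: tensors_induct)
  case (add s t)
  have "{n. tproj scl n (s + t) \<noteq> 0} \<subseteq> {n. tproj scl n s \<noteq> 0} \<union> {n. tproj scl n t \<noteq> 0}"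
    by (auto simp: tproj_add)
  then show ?case using add by (meson finite_UnI finite_subset)
next
  case (scale_tens c xs)
  have "{n. tproj scl n (tscale c (tens scl xs)) \<noteq> 0} \<subseteq> {length xs}"
    by (auto simp: tproj_scale tproj_tens)
  then show ?case by (meson finite.emptyI finite_insert finite_subset)
qed simp

text \<open>\<open>tensors scl\<close> is the tensor algebra: a multilinear family extends uniquely to a linear map.\<close>

lemma tensor_universal:
  fixes scl' :: "'k::field \<Rightarrow> 'w::ab_group_add \<Rightarrow> 'w"
  assumes "vector_space scl'" and f: "multilinear scl scl' f"
  shows "\<exists>F. Vector_Spaces.linear tscale scl' F \<and> (\<forall>xs. F (tens scl xs) = f xs)"
proof -
  interpret W: vector_space scl' by fact
  interpret TW: vector_space_pair "tscale :: 'k \<Rightarrow> ('a, 'k) tensor \<Rightarrow> ('a, 'k) tensor" scl'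
    by unfold_locales
  interpret WK: vector_space_pair scl' "(*) :: 'k \<Rightarrow> 'k \<Rightarrow> 'k"
    by unfold_locales (simp_all add: algebra_simps)
  obtain B where B: "B \<subseteq> range (tens scl)" "tensor_space.independent B"
    "range (tens scl) \<subseteq> tensor_space.span B"
    using tensor_space.maximal_independent_subset by metis
  define h where "h b = f (SOME xs. tens scl xs = b)" for b
  obtain F where F: "Vector_Spaces.linear tscale scl' F" "\<forall>b\<in>B. F b = h b"
    using TW.linear_independent_extend[OF B(2)] by blast
  interpret F: Vector_Spaces.linear tscale scl' F by fact
  have form: "multilinear_form scl (\<lambda>xs. g (f xs))"
    if "Vector_Spaces.linear scl' (*) g" for g :: "'w \<Rightarrow> 'k"
  proof -
    interpret g: Vector_Spaces.linear scl' "(*)" g by fact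
    show ?thesis
      by (rule multilinearI)
        (simp_all add: multilinear_add[OF f] multilinear_scale[OF f] g.add g.scale)
  qed
  have eval: "g (F t) = t (\<lambda>xs. g (f xs))"
    if g: "Vector_Spaces.linear scl' (*) g" and t: "t \<in> tensor_space.span B" for g :: "'w \<Rightarrow> 'k" and t
  proof -
    interpret g: Vector_Spaces.linear scl' "(*)" g by fact
    show ?thesis
      using t
    proof (induction t rule: tensor_space.span_induct_alt)
      case base
      have "g (F 0) = 0" by (simp only: F.zero g.zero)
      moreover have "(0 :: ('a, 'k) tensor) (\<lambda>xs. g (f xs)) = 0" by (rule zero_fun_apply)
      ultimately show ?case by (rule trans[OF _ sym])
    next
      case (step c x y)
      define ys where "ys = (SOME xs. tens scl xs = x)"
      have "tens scl ys = x"
        unfolding ys_def by (rule someI_ex) (use step.hyps B(1) in auto)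
      then have "x (\<lambda>xs. g (f xs)) = g (f ys)"
        using form[OF g] by (auto simp: tens_def)
      moreover have "F x = f ys"
        using F(2) step.hyps by (simp add: h_def ys_def)
      moreover have "g (F (tscale c x + y)) = c * g (F x) + g (F y)"
        by (simp only: F.add F.scale g.add g.scale)
      moreover have "(tscale c x + y) (\<lambda>xs. g (f xs)) = c * x (\<lambda>xs. g (f xs)) + y (\<lambda>xs. g (f xs))"
        by (simp only: plus_fun_apply tscale_def)
      ultimately have "g (F (tscale c x + y)) = (tscale c x + y) (\<lambda>xs. g (f xs))"
        using step.IH by (simp only:)
      then show ?case .
    qed
  qed
  have "F (tens scl xs) = f xs" for xs
  proof (rule ccontr)
    assume "F (tens scl xs) \<noteq> f xs"
    then have "W.independent {F (tens scl xs) - f xs}" by simp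
    then obtain g where g: "Vector_Spaces.linear scl' (*) g" "g (F (tens scl xs) - f xs) = (1::'k)"
      using WK.linear_independent_extend[of "{F (tens scl xs) - f xs}" "\<lambda>_. 1"] by auto
    interpret g: Vector_Spaces.linear scl' "(*)" g by fact
    have "g (F (tens scl xs)) = g (f xs)"
      using eval[OF g(1), of "tens scl xs"] B(3) form[OF g(1)] by (auto simp: tens_def)
    then show False
      using g(2) by (simp add: g.diff)
  qed
  with F show "\<exists>F. Vector_Spaces.linear tscale scl' F \<and> (\<forall>xs. F (tens scl xs) = f xs)"
    by blast
qed

lemma tensor_universal_unique:
  assumes "vector_space scl'"
    and "Vector_Spaces.linear tscale scl' F" "Vector_Spaces.linear tscale scl' G"
    and "\<And>xs. F (tens scl xs) = G (tens scl xs)" "t \<in> tensors scl"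
  shows "F t = G t"
proof -
  interpret W: vector_space scl' by fact
  interpret F: Vector_Spaces.linear tscale scl' F by fact
  interpret G: Vector_Spaces.linear tscale scl' G by fact
  have "F 0 = G 0" by (simp only: F.zero G.zero)
  with assms(5) show ?thesis
    by (induction t rule: tensors_induct) (simp_all only: F.add G.add F.scale G.scale assms(4))
qed

lemma symmetrize_eq:
  fixes t :: "('a::ab_group_add, 'k::field_char_0) tensor"
  assumes "finite N" "{n. tproj scl n t \<noteq> 0} \<subseteq> N"
  shows "symmetrize scl t =
    (\<Sum>n\<in>N. tscale (1 / fact n) (\<Sum>\<sigma> | \<sigma> permutes {..<n}. tperm scl n \<sigma> t))"
  unfolding symmetrize_def
proof (rule sum.mono_neutral_left[OF assms(1,2)], intro ballI)
  fix n assume "n \<in> N - {n. tproj scl n t \<noteq> 0}"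
  then have t: "tproj scl n t = 0" by blast
  have "tperm scl n \<sigma> t = 0" if \<sigma>: "\<sigma> permutes {..<n}" for \<sigma>
  proof -
    have "tperm scl n \<sigma> (tproj scl n t) = tperm scl n \<sigma> t"
    proof
      fix \<phi> :: "'a list \<Rightarrow> 'k"
      have "(\<lambda>xs. if length xs = n then (if length xs = n then \<phi> (permute_list \<sigma> xs) else 0) else 0) =
          (\<lambda>xs. if length xs = n then \<phi> (permute_list \<sigma> xs) else 0)"
        by auto
      then show "tperm scl n \<sigma> (tproj scl n t) \<phi> = tperm scl n \<sigma> t \<phi>"
        using multilinear_form_permute[OF _ \<sigma>, of scl \<phi>] by (simp only: tperm_def tproj_def if_True if_False split: if_split) blast
    qed
    then show ?thesis by (simp add: t)
  qed
  then show "tscale (1 / fact n) (\<Sum>\<sigma> | \<sigma> permutes {..<n}. tperm scl n \<sigma> t) = 0"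
    by simp
qed

lemma symmetrize_tens: "symmetrize scl (tens scl xs) = symprod scl xs"
  by (subst symmetrize_eq[of "{length xs}"]) (auto simp: tproj_tens tperm_tens symprod_def)

lemma symmetrize_add:
  assumes "t \<in> tensors scl" "s \<in> tensors scl"
  shows "symmetrize scl (t + s) = symmetrize scl t + symmetrize scl s"
proof -
  let ?N = "{n. tproj scl n t \<noteq> 0} \<union> {n. tproj scl n s \<noteq> 0}"
  have "finite ?N" using assms by (simp add: finite_degrees)
  moreover have "{n. tproj scl n (t + s) \<noteq> 0} \<subseteq> ?N" by (auto simp: tproj_add)
  ultimately show ?thesis
    using assms
    by (simp add: symmetrize_eq[of ?N] tensors_add tperm_add sum.distrib tensor_space.scale_right_distrib)
qed

lemma symmetrize_scale:
  assumes "t \<in> tensors scl"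
  shows "symmetrize scl (tscale c t) = tscale c (symmetrize scl t)"
proof -
  let ?N = "{n. tproj scl n t \<noteq> 0}"
  have "finite ?N" using assms by (simp add: finite_degrees)
  moreover have "{n. tproj scl n (tscale c t) \<noteq> 0} \<subseteq> ?N" by (auto simp: tproj_scale)
  ultimately show ?thesis
    using assms
    by (simp add: symmetrize_eq[of ?N] tensors_scale tperm_scale tensor_space.scale_sum_right
        mult.commute)
qed

lemma symmetrize_sum:
  assumes "\<And>i. i \<in> I \<Longrightarrow> t i \<in> tensors scl"
  shows "symmetrize scl (sum t I) = (\<Sum>i\<in>I. symmetrize scl (t i))"
proof -
  have "symmetrize scl 0 = 0" by (simp add: symmetrize_def)
  then show ?thesis
    using assms by (induction I rule: infinite_finite_induct) (simp_all add: symmetrize_add tensors_sum)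
qed

lemma symprod_permute:
  assumes "mset xs = mset ys"
  shows "symprod scl xs = symprod scl ys"
proof -
  obtain \<rho> where \<rho>: "\<rho> permutes {..<length ys}" "permute_list \<rho> ys = xs"
    using mset_eq_permutation[OF assms] by blast
  have len: "length xs = length ys" using assms by (rule mset_eq_length)
  have "(\<Sum>\<sigma> | \<sigma> permutes {..<length ys}. tens scl (permute_list \<sigma> ys)) =
      (\<Sum>\<sigma> | \<sigma> permutes {..<length ys}. tens scl (permute_list (\<rho> \<circ> \<sigma>) ys))"
    by (rule setum_permutations_compose_left[OF \<rho>(1)])
  also have "\<dots> = (\<Sum>\<sigma> | \<sigma> permutes {..<length ys}. tens scl (permute_list \<sigma> xs))"
    by (rule sum.cong) (simp_all add: permute_list_compose \<rho>(2))
  finally show ?thesis by (simp add: symprod_def len)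
qed

lemma symprod_in_tensors: "symprod scl xs \<in> tensors scl"
  unfolding symprod_def by (intro tensors_scale tensors_sum tens_in_tensors)

lemma symmult_symprod:
  fixes scl :: "'k::field_char_0 \<Rightarrow> 'a::ab_group_add \<Rightarrow> 'a"
  shows "symmult scl (symprod scl xs) (symprod scl ys) = symprod scl (xs @ ys)"
proof -
  let ?m = "length xs" and ?n = "length ys"
  have "tmult scl (tens scl zs) (symprod scl ys) =
      tscale (1 / fact ?n) (\<Sum>\<tau> | \<tau> permutes {..<?n}. tens scl (zs @ permute_list \<tau> ys))" for zs
  proof -
    have "tmult scl (tens scl zs) (sum t I) = (\<Sum>i\<in>I. tmult scl (tens scl zs) (t i))"
      if "\<And>i. i \<in> I \<Longrightarrow> t i \<in> tensors scl" for t and I :: "(nat \<Rightarrow> nat) set"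
      using that
      by (induction I rule: infinite_finite_induct)
        (simp_all add: tmult_zero_right tmult_add_right tensors_sum)
    then show ?thesis
      by (simp add: symprod_def tmult_scale_right tensors_sum tmult_tens)
  qed
  moreover have "tmult scl (sum t I) s = (\<Sum>i\<in>I. tmult scl (t i) s)" for t s and I :: "(nat \<Rightarrow> nat) set"
    by (induction I rule: infinite_finite_induct) (simp_all add: tmult_add_left)
  ultimately have "tmult scl (symprod scl xs) (symprod scl ys) =
      tscale (1 / fact ?m) (\<Sum>\<sigma> | \<sigma> permutes {..<?m}.
        tscale (1 / fact ?n) (\<Sum>\<tau> | \<tau> permutes {..<?n}.
          tens scl (permute_list \<sigma> xs @ permute_list \<tau> ys)))"
    by (simp add: symprod_def[of scl xs] tmult_scale_left)
  then have "symmult scl (symprod scl xs) (symprod scl ys) =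
      symmetrize scl (tscale (1 / fact ?m) (\<Sum>\<sigma> | \<sigma> permutes {..<?m}.
        tscale (1 / fact ?n) (\<Sum>\<tau> | \<tau> permutes {..<?n}.
          tens scl (permute_list \<sigma> xs @ permute_list \<tau> ys))))"
    by (simp only: symmult_def)
  also have "\<dots> =
      tscale (1 / fact ?m) (\<Sum>\<sigma> | \<sigma> permutes {..<?m}.
        tscale (1 / fact ?n) (\<Sum>\<tau> | \<tau> permutes {..<?n}.
          symprod scl (permute_list \<sigma> xs @ permute_list \<tau> ys)))"
    by (simp add: symmetrize_scale symmetrize_sum symmetrize_tens tensors_scale tensors_sum)
  also have "\<dots> =
      tscale (1 / fact ?m) (\<Sum>\<sigma> | \<sigma> permutes {..<?m}.
        tscale (1 / fact ?n) (\<Sum>\<tau> | \<tau> permutes {..<?n}. symprod scl (xs @ ys)))"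
  proof -
    have "symprod scl (permute_list \<sigma> xs @ permute_list \<tau> ys) = symprod scl (xs @ ys)"
      if "\<sigma> permutes {..<?m}" "\<tau> permutes {..<?n}" for \<sigma> \<tau>
      using that by (intro symprod_permute) simp
    then show ?thesis
      by (intro arg_cong[where f = "tscale _"] sum.cong refl) simp_all
  qed
  also have "\<dots> = symprod scl (xs @ ys)"
  proof -
    have const: "(\<Sum>\<sigma> | \<sigma> permutes {..<k}. u) = tscale (fact k) u" for u :: "('a, 'k) tensor" and k
    proof -
      have "(\<Sum>\<sigma>\<in>I. u) = tscale (of_nat (card I)) u" if "finite I" for I :: "(nat \<Rightarrow> nat) set"
        using that by (induction I rule: finite_induct) (simp_all add: tensor_space.scale_left_distrib del: sum_constant)
      then show ?thesis
        by (simp add: finite_permutations card_permutations[OF refl] del: sum_constant)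
    qed
    show ?thesis by (simp add: const del: sum_constant)
  qed
  finally show ?thesis .
qed

lemma quantization_symprod:
  "quantization scl br (symprod scl xs) =
    env_class scl br (tscale (1 / fact (length xs)) (tens scl [])) \<otimes>\<^bsub>env_algebra scl br\<^esub>
    (\<Oplus>\<^bsub>env_algebra scl br\<^esub>\<sigma>\<in>{\<sigma>. \<sigma> permutes {..<length xs}}.
      foldr (\<lambda>x u. env_class scl br (tens scl [x]) \<otimes>\<^bsub>env_algebra scl br\<^esub> u)
        (permute_list \<sigma> xs) \<one>\<^bsub>env_algebra scl br\<^esub>)"
proof -
  let ?T = "tensor_ring scl" and ?U = "env_algebra scl br" and ?q = "env_class scl br"
  have carrier: "carrier ?T = tensors scl" and mult: "mult ?T = tmult scl" and add: "add ?T = (+)"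
    and zero: "\<zero>\<^bsub>?T\<^esub> = 0" and one: "\<one>\<^bsub>?T\<^esub> = tens scl []"
    by (simp_all add: tensor_ring_def)
  interpret T: ring ?T by (rule ring_tensor_ring)
  have "ideal (env_ideal scl br) ?T"
    unfolding env_ideal_def by (rule T.genideal_ideal) (auto simp: carrier intro!: tensors_diff)
  then interpret I: ideal "env_ideal scl br" ?T .
  have q: "?q = (+>\<^bsub>?T\<^esub>) (env_ideal scl br)"
    by (simp add: env_class_def fun_eq_iff)
  interpret q: ring_hom_ring ?T ?U ?q
    unfolding q env_algebra_def by (rule I.rcos_ring_hom_ring)
  have tens: "?q (tens scl zs) =
      foldr (\<lambda>x u. ?q (tens scl [x]) \<otimes>\<^bsub>?U\<^esub> u) zs \<one>\<^bsub>?U\<^esub>" for zs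
  proof (induction zs)
    case Nil
    then show ?case using q.hom_one by (simp add: one)
  next
    case (Cons x zs)
    have "?q (tens scl (x # zs)) = ?q (tens scl [x] \<otimes>\<^bsub>?T\<^esub> tens scl zs)"
      by (simp add: mult tmult_tens)
    also have "\<dots> = ?q (tens scl [x]) \<otimes>\<^bsub>?U\<^esub> ?q (tens scl zs)"
      by (rule q.hom_mult) (simp_all add: carrier)
    finally show ?case by (simp add: Cons.IH)
  qed
  have fin: "finite {\<sigma>. \<sigma> permutes {..<length xs}}" by (simp add: finite_permutations)
  have sum: "?q (\<Sum>i\<in>J. t i) = (\<Oplus>\<^bsub>?U\<^esub>i\<in>J. ?q (t i))"
    if "finite J" "\<And>i. i \<in> J \<Longrightarrow> t i \<in> tensors scl" for t and J :: "(nat \<Rightarrow> nat) set"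
    using that
  proof (induction J rule: finite_induct)
    case empty
    then show ?case using q.hom_zero by (simp add: zero)
  next
    case (insert i J)
    have "?q (\<Sum>i\<in>insert i J. t i) = ?q (t i \<oplus>\<^bsub>?T\<^esub> (\<Sum>i\<in>J. t i))"
      using insert.hyps by (simp add: add)
    also have "\<dots> = ?q (t i) \<oplus>\<^bsub>?U\<^esub> ?q (\<Sum>i\<in>J. t i)"
      by (rule q.hom_add) (simp_all add: carrier insert.prems tensors_sum)
    also have "\<dots> = (\<Oplus>\<^bsub>?U\<^esub>i\<in>insert i J. ?q (t i))"
      using insert q.hom_closed by (subst q.S.finsum_insert) (auto simp: carrier)
    finally show ?case .
  qed
  let ?s = "\<Sum>\<sigma> | \<sigma> permutes {..<length xs}. tens scl (permute_list \<sigma> xs)"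
  have s: "?s \<in> tensors scl" by (simp add: tensors_sum)
  have "symprod scl xs = tscale (1 / fact (length xs)) (tens scl []) \<otimes>\<^bsub>?T\<^esub> ?s"
    by (simp add: symprod_def mult tmult_scale_left tmult_unit(1)[OF s])
  then have "?q (symprod scl xs) = ?q (tscale (1 / fact (length xs)) (tens scl [])) \<otimes>\<^bsub>?U\<^esub> ?q ?s"
    using s by (simp add: carrier tensors_scale)
  also have "?q ?s = (\<Oplus>\<^bsub>?U\<^esub>\<sigma>\<in>{\<sigma>. \<sigma> permutes {..<length xs}}. ?q (tens scl (permute_list \<sigma> xs)))"
    using fin by (rule sum) simp
  also have "(\<lambda>\<sigma>. ?q (tens scl (permute_list \<sigma> xs))) = (\<lambda>\<sigma>.
      foldr (\<lambda>x u. ?q (tens scl [x]) \<otimes>\<^bsub>?U\<^esub> u) (permute_list \<sigma> xs) \<one>\<^bsub>?U\<^esub>)"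
    by (rule ext) (rule tens)
  finally show ?thesis unfolding quantization_def .
qed

end

end

theory Submission
  imports Defs "HOL-Computational_Algebra.Polynomial"
begin

text \<open>
  Left multiplication by \<open>x \<in> \<gg>\<close> in the enveloping algebra is transported to symmetric tensors by
  the formula \<open>x \<star> \<xi>\<^sup>l = \<Sum>\<^sub>j (l choose j) B\<^sub>j (ad \<xi>)\<^sup>j(x) \<xi>\<^bsup>l-j\<^esup>\<close> with the Bernoulli numbers \<open>B\<^sub>j\<close>. These
  operators represent \<open>\<gg>\<close>, which comes down to the functional equation
  \<open>h(s) h(t) = h(s + t) (1 + h(s) + h(t))\<close> of \<open>h(t) = 1 / (exp t - 1)\<close>. Hence tensors act on symmetric
  tensors, the ideal acts by \<open>0\<close>, and applying \<open>t\<close> to \<open>1\<close> gives the symmetric representative \<open>N t\<close>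
  of the class of \<open>t\<close>: this proves Poincare-Birkhoff-Witt, and \<open>q\<^sup>-\<^sup>1(q f \<odot> q g) = N (f \<otimes> g)\<close>.

  Since \<open>\<bar>B\<^sub>j\<bar> \<le> j!\<close>, counting terms shows that \<open>N (x\<^sub>1 \<otimes> \<dots> \<otimes> x\<^sub>n)\<close> is a combination of tensors of Lie words
  whose coefficients, weighted by (degree)\<open>!\<close>, sum up to at most \<open>4\<^sup>n n!\<close>. With the asymptotic estimates
  this bounds \<open>p\<^sub>R\<close> of \<open>N\<close> for \<open>R \<ge> 1\<close>. As \<open>C\<^sub>n\<close> vanishes for \<open>n > k + l\<close>, any factor \<open>c\<^sup>n\<close> is absorbed
  by rescaling the seminorm; the same bound therefore covers \<open>C\<^sub>n\<close>, \<open>\<star>\<^sub>z\<close>, all Taylor coefficients in \<open>z\<close>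
  and the Taylor remainders, and it passes to the completion.
\<close>

text \<open>The Bernoulli series is the part of log (exp x exp \<xi>) that is linear in x, namely ad
  \<xi> / (exp (ad \<xi>) - 1) applied to x. Multiplying by one letter at a time meets only this
  part of the BCH series, and so a single sequence of scalars. Polarization restricts the
  verification to powers of one \<xi>. There every bracket that occurs is built from x, y and ad
  \<xi>, and since ad \<xi> is a derivation, the Lie identity becomes a polynomial identity in one
  variable.

  The obstacle in the estimates is the case R = 1. A word of n letters carries the weight n!, so
  normal ordering may cost one n! and powers of constants, but no second factorial. Each of the n
  multiplications, however, creates a number of terms that grows with the length. The choice of
  \<open>word_weight\<close> settles this.

  A second constraint comes from degree 0: rescaling a seminorm p has no effect there, because p^0
  is the absolute value. Factors c^n are therefore absorbed by rescaling, but constants in front are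
  carried along separately.\<close>

declare plus_fun_apply [simp del] zero_fun_apply [simp del]

section \<open>Polarization\<close>

lemma multilinear_tens: "multilinear scl tscale (tens scl)"
  by (rule multilinearI) (auto simp: tens_def tscale_def fun_eq_iff plus_fun_apply multilinear_add multilinear_scale)

lemma multilinear_symprod:
  fixes scl :: "'k::field_char_0 \<Rightarrow> 'a::ab_group_add \<Rightarrow> 'a"
  shows "multilinear scl tscale (symprod scl)"
  by (rule multilinearI)
    (simp_all add: symmetrize_tens[symmetric] multilinear_add[OF multilinear_tens]
      multilinear_scale[OF multilinear_tens] symmetrize_add symmetrize_scale)

text \<open>The universal property provides a map that is linear on the whole function space but
  pinned down only on \<open>tensors scl\<close>; hence a choice instead of a description.\<close>

definition tensor_lift ::
  "('k::field \<Rightarrow> 'a::ab_group_add \<Rightarrow> 'a) \<Rightarrow> ('a list \<Rightarrow> ('a, 'k) tensor) \<Rightarrow> ('a, 'k) tensor \<Rightarrow> ('a, 'k) tensor"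
where
  "tensor_lift scl f =
    (SOME F. Vector_Spaces.linear tscale tscale F \<and> (\<forall>xs. F (tens scl xs) = f xs))"

lemma
  assumes "multilinear scl tscale f"
  shows linear_tensor_lift: "Vector_Spaces.linear tscale tscale (tensor_lift scl f)"
    and tensor_lift_tens: "tensor_lift scl f (tens scl xs) = f xs"
  using someI_ex[OF tensor_universal[OF tensor_space.vector_space_axioms assms]]
  unfolding tensor_lift_def by blast+

text \<open>The value at \<open>2 * s\<close> minus \<open>2 ^ Suc n\<close> times the value at
  \<open>s\<close> has no top coefficient, while \<open>c i\<close> gets the factor
  \<open>2 ^ i - 2 ^ Suc n\<close>, nonzero in characteristic 0. This is again a polynomial with all
  values in \<open>W\<close>, so induction on the degree applies.\<close>

lemma vector_polynomial_coeffs: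
  fixes c :: "nat \<Rightarrow> ('a, 'k::field_char_0) tensor"
  assumes W: "tensor_space.subspace W"
    and "\<And>s. (\<Sum>i\<le>n. tscale (s ^ i) (c i)) \<in> W" "i \<le> n"
  shows "c i \<in> W"
  using assms(2,3)
proof (induction n arbitrary: c i)
  case 0
  then show ?case using "0.prems"(1)[of 1] by simp
next
  case (Suc n)
  have low: "c i \<in> W" if "i \<le> n" for i
  proof -
    have "(\<Sum>i\<le>n. tscale (s ^ i) (tscale (2 ^ i - 2 ^ Suc n) (c i))) \<in> W" for s
    proof -
      have "(\<Sum>i\<le>Suc n. tscale ((2 * s) ^ i) (c i)) - tscale (2 ^ Suc n) (\<Sum>i\<le>Suc n. tscale (s ^ i) (c i)) \<in> W"
        by (intro tensor_space.subspace_diff tensor_space.subspace_scale W Suc.prems)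
      also have "(\<Sum>i\<le>Suc n. tscale ((2 * s) ^ i) (c i)) - tscale (2 ^ Suc n) (\<Sum>i\<le>Suc n. tscale (s ^ i) (c i))
          = (\<Sum>i\<le>Suc n. tscale (s ^ i) (tscale (2 ^ i - 2 ^ Suc n) (c i)))"
        unfolding tensor_space.scale_sum_right sum_subtractf[symmetric]
        by (rule sum.cong) (simp_all add: power_mult_distrib tensor_space.scale_right_diff_distrib
              tensor_space.scale_left_diff_distrib mult.commute del: power_Suc)
      finally show ?thesis by simp
    qed
    then have "tscale (2 ^ i - 2 ^ Suc n) (c i) \<in> W"
      using that by (rule Suc.IH)
    then have "tscale (inverse (2 ^ i - 2 ^ Suc n)) (tscale (2 ^ i - 2 ^ Suc n) (c i)) \<in> W"
      by (rule tensor_space.subspace_scale[OF W])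
    moreover have "(2::'k) ^ i \<noteq> 2 ^ Suc n"
    proof -
      have "(2::nat) ^ i \<noteq> 2 ^ Suc n" using that by (simp del: power_Suc)
      then have "of_nat (2 ^ i) \<noteq> (of_nat (2 ^ Suc n) :: 'k)" by (simp only: of_nat_eq_iff not_False_eq_True)
      then show ?thesis by (metis of_nat_numeral of_nat_power)
    qed
    ultimately show ?thesis by simp
  qed
  have "(\<Sum>i\<le>Suc n. tscale (1 ^ i) (c i)) - (\<Sum>i\<le>n. c i) \<in> W"
    by (intro tensor_space.subspace_diff W Suc.prems tensor_space.subspace_sum low) simp
  then have "c (Suc n) \<in> W" by simp
  with low Suc.prems(2) show ?case by (cases "i = Suc n") auto
qed

text \<open>The coefficient of \<open>s\<close>, the sum over all positions of \<eta> among the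
  \<xi>, is the directional derivative on which polarization rests.\<close>

lemma multilinear_expand_power:
  fixes scl :: "'k::field \<Rightarrow> 'a::ab_group_add \<Rightarrow> 'a" and g :: "'a list \<Rightarrow> ('b, 'k) tensor"
  assumes "multilinear scl tscale g"
  obtains c where "c 1 = (\<Sum>a<m. g (replicate a \<xi> @ \<eta> # replicate (m - 1 - a) \<xi>))"
    "\<And>s. g (replicate m (\<xi> + scl s \<eta>)) = (\<Sum>i\<le>m. tscale (s ^ i) (c i))"
proof -
  \<comment> \<open>Splitting off the first slot adds a second expansion shifted by one degree. Its
    constant coefficient is the new term with \<eta> in front, and vanishing beyond \<open>m\<close>
    lets both sums run to the same bound; the induction therefore carries both facts.\<close>
  have "\<exists>c. c 0 = g (replicate m \<xi>) \<and>
      c 1 = (\<Sum>a<m. g (replicate a \<xi> @ \<eta> # replicate (m - 1 - a) \<xi>)) \<and> (\<forall>i>m. c i = 0) \<and>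
      (\<forall>s. g (replicate m (\<xi> + scl s \<eta>)) = (\<Sum>i\<le>m. tscale (s ^ i) (c i)))"
    using assms
  proof (induction m arbitrary: g)
    case 0
    then show ?case by (intro exI[of _ "\<lambda>i. if i = 0 then g [] else 0"]) simp
  next
    case (Suc m)
    have g: "multilinear scl tscale (\<lambda>zs. g (x # zs))" for x
      using multilinear_append_right[OF Suc.prems, of "[x]"] by simp
    obtain c where c: "c 0 = g (\<xi> # replicate m \<xi>)"
      "c 1 = (\<Sum>a<m. g (\<xi> # replicate a \<xi> @ \<eta> # replicate (m - 1 - a) \<xi>))" "\<forall>i>m. c i = 0"
      "\<And>s. g (\<xi> # replicate m (\<xi> + scl s \<eta>)) = (\<Sum>i\<le>m. tscale (s ^ i) (c i))"
      using Suc.IH[OF g[of \<xi>]] by blast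
    obtain d where d: "d 0 = g (\<eta> # replicate m \<xi>)" "\<forall>i>m. d i = 0"
      "\<And>s. g (\<eta> # replicate m (\<xi> + scl s \<eta>)) = (\<Sum>i\<le>m. tscale (s ^ i) (d i))"
      using Suc.IH[OF g[of \<eta>]] by blast
    define e where "e i = c i + (case i of 0 \<Rightarrow> 0 | Suc j \<Rightarrow> d j)" for i
    have "g (replicate (Suc m) (\<xi> + scl s \<eta>)) = (\<Sum>i\<le>Suc m. tscale (s ^ i) (e i))" for s
    proof -
      have "g (replicate (Suc m) (\<xi> + scl s \<eta>)) =
          g (\<xi> # replicate m (\<xi> + scl s \<eta>)) + tscale s (g (\<eta> # replicate m (\<xi> + scl s \<eta>)))"
        using multilinear_add[OF Suc.prems, of 0 "\<xi> # replicate m (\<xi> + scl s \<eta>)" \<xi> "scl s \<eta>"]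
          multilinear_scale[OF Suc.prems, of 0 "\<xi> # replicate m (\<xi> + scl s \<eta>)" s \<eta>]
        by simp
      also have "\<dots> = (\<Sum>i\<le>Suc m. tscale (s ^ i) (c i)) + (\<Sum>i\<le>m. tscale (s ^ Suc i) (d i))"
        using c(3) by (simp add: c(4) d(3) tensor_space.scale_sum_right)
      also have "(\<Sum>i\<le>m. tscale (s ^ Suc i) (d i)) =
          (\<Sum>i\<le>Suc m. tscale (s ^ i) (case i of 0 \<Rightarrow> 0 | Suc j \<Rightarrow> d j))"
        unfolding sum.atMost_Suc_shift by simp
      finally show ?thesis
        by (simp only: e_def sum.distrib tensor_space.scale_right_distrib)
    qed
    moreover have "e 0 = g (replicate (Suc m) \<xi>)" by (simp add: e_def c(1))
    moreover have "e 1 = (\<Sum>a<Suc m. g (replicate a \<xi> @ \<eta> # replicate (Suc m - 1 - a) \<xi>))"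
    proof -
      have "e 1 = d 0 + (\<Sum>a<m. g (\<xi> # replicate a \<xi> @ \<eta> # replicate (m - 1 - a) \<xi>))"
        using c(2) by (simp add: e_def)
      then show ?thesis
        unfolding sum.lessThan_Suc_shift d(1) by simp
    qed
    moreover have "\<forall>i>Suc m. e i = 0"
      using c(3) d(2) by (auto simp: e_def split: nat.split)
    ultimately show ?case by blast
  qed
  with that show ?thesis by blast
qed

lemma mset_insert_replicate:
  assumes "a \<le> m"
  shows "replicate_mset a \<xi> + replicate_mset (m - a) \<xi> = replicate_mset m \<xi>"
  using assms by (metis le_add_diff_inverse mset_append mset_replicate replicate_add)

lemma tproj_sum: "tproj scl n (sum t I) = (\<Sum>i\<in>I. tproj scl n (t i))"
  by (induction I rule: infinite_finite_induct) (simp_all add: tproj_add)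

lemma tperm_sum: "tperm scl n \<sigma> (sum t I) = (\<Sum>i\<in>I. tperm scl n \<sigma> (t i))"
  by (induction I rule: infinite_finite_induct) (simp_all add: tperm_add)

lemma tensors_decompose:
  assumes "t \<in> tensors scl" "finite N" "{n. tproj scl n t \<noteq> 0} \<subseteq> N"
  shows "t = (\<Sum>n\<in>N. tproj scl n t)"
proof -
  have "\<exists>M. finite M \<and> (\<forall>N. finite N \<longrightarrow> M \<subseteq> N \<longrightarrow> t = (\<Sum>n\<in>N. tproj scl n t))"
    using assms(1)
  proof (induction t rule: tensors_induct)
    case zero
    then show ?case by (intro exI[of _ "{}"]) simp
  next
    case (add s t)
    then obtain A B where "finite A" "\<forall>N. finite N \<longrightarrow> A \<subseteq> N \<longrightarrow> s = (\<Sum>n\<in>N. tproj scl n s)"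
      "finite B" "\<forall>N. finite N \<longrightarrow> B \<subseteq> N \<longrightarrow> t = (\<Sum>n\<in>N. tproj scl n t)"
      by blast
    then show ?case
      by (intro exI[of _ "A \<union> B"]) (simp add: tproj_add sum.distrib)
  next
    case (scale_tens c xs)
    have "tscale c (tens scl xs) = (\<Sum>n\<in>N. tproj scl n (tscale c (tens scl xs)))"
      if "finite N" "{length xs} \<subseteq> N" for N
      using that by (simp add: tproj_scale tproj_tens if_distrib[of "tscale c"] cong: if_cong)
    then show ?case by (intro exI[of _ "{length xs}"]) auto
  qed
  then obtain M where M: "finite M" "\<And>N. finite N \<Longrightarrow> M \<subseteq> N \<Longrightarrow> t = (\<Sum>n\<in>N. tproj scl n t)"
    by blast
  have "t = (\<Sum>n\<in>M \<union> N. tproj scl n t)" using M assms(2) by blast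
  also have "\<dots> = (\<Sum>n\<in>N. tproj scl n t)"
    using M(1) assms(2,3) by (intro sum.mono_neutral_right) auto
  finally show ?thesis .
qed

context
  fixes scl :: "'k::field_char_0 \<Rightarrow> 'a::ab_group_add \<Rightarrow> 'a"
begin

lemma symtensors_in_tensors: "f \<in> symtensors scl \<Longrightarrow> f \<in> tensors scl"
  by (simp add: symtensors_def)

lemma symtensors_subspace: "tensor_space.subspace (symtensors scl)"
  by (rule tensor_space.subspaceI)
    (auto simp: symtensors_def tensors_add tensors_scale tproj_add tproj_scale tperm_add tperm_scale)

lemmas symtensors_closed =
  tensor_space.subspace_0[OF symtensors_subspace] tensor_space.subspace_add[OF symtensors_subspace]
  tensor_space.subspace_scale[OF symtensors_subspace]

lemma power_in_symtensors: "tens scl (replicate n \<xi>) \<in> symtensors scl"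
proof -
  have "permute_list \<sigma> (replicate n \<xi>) = replicate n \<xi>" if "\<sigma> permutes {..<n}" for \<sigma>
    using that permutes_in_image[OF that] by (intro nth_equalityI) (auto simp: permute_list_nth)
  then show ?thesis
    by (simp add: symtensors_def tperm_tens tproj_tens)
qed

lemma symprod_in_symtensors: "symprod scl xs \<in> symtensors scl"
proof -
  have "tperm scl n \<tau> (symprod scl xs) = tproj scl n (symprod scl xs)"
    if \<tau>: "\<tau> permutes {..<n}" for n \<tau>
  proof (cases "n = length xs")
    case True
    have "(\<Sum>\<sigma> | \<sigma> permutes {..<n}. tperm scl n \<tau> (tens scl (permute_list \<sigma> xs))) =
        (\<Sum>\<sigma> | \<sigma> permutes {..<n}. tens scl (permute_list (\<sigma> \<circ> \<tau>) xs))"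
      by (rule sum.cong) (use \<tau> True in \<open>simp_all add: tperm_tens permute_list_compose\<close>)
    also have "\<dots> = (\<Sum>\<sigma> | \<sigma> permutes {..<n}. tens scl (permute_list \<sigma> xs))"
      by (rule sum_permutations_compose_right[OF \<tau>, symmetric])
    finally show ?thesis
      using True by (simp add: symprod_def tperm_scale tproj_scale tperm_sum tproj_sum tproj_tens)
  next
    case False
    then show ?thesis
      using \<tau> by (simp add: symprod_def tperm_scale tproj_scale tperm_sum tproj_sum tproj_tens tperm_tens)
  qed
  then show ?thesis by (simp add: symtensors_def symprod_in_tensors)
qed

lemma symmetrize_symtensor:
  assumes "f \<in> symtensors scl" shows "symmetrize scl f = f"
proof -
  have t: "f \<in> tensors scl" using assms by (rule symtensors_in_tensors)
  have const: "(\<Sum>\<sigma> | \<sigma> permutes {..<n}. u) = tscale (fact n) u" for u :: "('a, 'k) tensor" and n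
    using tensor_space.sum_constant_scale[of u "{\<sigma>. \<sigma> permutes {..<n}}"]
    by (simp add: card_permutations[OF refl] del: sum_constant)
  have "symmetrize scl f = (\<Sum>n | tproj scl n f \<noteq> 0.
      tscale (1 / fact n) (\<Sum>\<sigma> | \<sigma> permutes {..<n}. tproj scl n f))"
    unfolding symmetrize_def using assms by (simp add: symtensors_def)
  also have "\<dots> = (\<Sum>n | tproj scl n f \<noteq> 0. tproj scl n f)"
    by (simp add: const del: sum_constant)
  also have "\<dots> = f"
    using tensors_decompose[OF t finite_degrees[OF t]] by simp
  finally show ?thesis .
qed

text \<open>The sum over the insertions is the coefficient of \<open>s\<close> in the power of
  \<open>\<xi> + scl s u\<close>. All values of that polynomial are symmetric tensors, hence so is
  the coefficient, and it equals its own symmetrization, to which each of the \<open>Suc m\<close>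
  insertions contributes the same product.\<close>

lemma insertion_average:
  "symprod scl (u # replicate m \<xi>) = tscale (1 / of_nat (Suc m))
    (\<Sum>a\<le>m. tens scl (replicate a \<xi> @ u # replicate (m - a) \<xi>))"
proof -
  let ?t = "\<Sum>a\<le>m. tens scl (replicate a \<xi> @ u # replicate (m - a) \<xi>)"
  obtain c where c: "c 1 = (\<Sum>a<Suc m. tens scl (replicate a \<xi> @ u # replicate (Suc m - 1 - a) \<xi>))"
    "\<And>s. tens scl (replicate (Suc m) (\<xi> + scl s u)) = (\<Sum>i\<le>Suc m. tscale (s ^ i) (c i))"
    by (rule multilinear_expand_power[OF multilinear_tens[of scl],
          where m = "Suc m" and \<xi> = \<xi> and \<eta> = u]) (rule that)
  have "(\<Sum>i\<le>Suc m. tscale (s ^ i) (c i)) \<in> symtensors scl" for s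
    unfolding c(2)[symmetric] by (rule power_in_symtensors)
  then have "c 1 \<in> symtensors scl"
    by (rule vector_polynomial_coeffs[OF symtensors_subspace]) simp
  then have "?t = symmetrize scl ?t"
    using c(1) by (simp add: symmetrize_symtensor lessThan_Suc_atMost)
  also have "\<dots> = (\<Sum>a\<le>m. symprod scl (replicate a \<xi> @ u # replicate (m - a) \<xi>))"
    by (simp add: symmetrize_sum symmetrize_tens)
  also have "\<dots> = (\<Sum>a\<le>m. symprod scl (u # replicate m \<xi>))"
    by (intro sum.cong refl symprod_permute)
      (simp add: mset_insert_replicate)
  also have "\<dots> = tscale (of_nat (Suc m)) (symprod scl (u # replicate m \<xi>))"
    using tensor_space.sum_constant_scale[of "symprod scl (u # replicate m \<xi>)" "{..m}"]
    by (simp del: sum_constant)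
  finally show ?thesis by (simp del: of_nat_Suc)
qed

text \<open>Polarization, the principle by which linear statements about symmetric tensors are
  reduced to powers of one vector. Differentiating \<open>ys @ replicate (Suc m) \<xi>\<close> in
  the direction \<eta> gives \<open>Suc m\<close> times the product with one \<xi> exchanged for
  \<eta>, so the free letters are produced one by one; \<open>m = 0\<close> leaves an arbitrary
  product.\<close>

lemma symtensors_subset_if_powers:
  assumes W: "tensor_space.subspace W" and powers: "\<And>n \<xi>. tens scl (replicate n \<xi>) \<in> W"
  shows "symtensors scl \<subseteq> W"
proof -
  have "symprod scl (ys @ replicate m \<xi>) \<in> W" for ys m \<xi>
  proof (induction ys arbitrary: m \<xi>)
    case Nil
    have "symprod scl (replicate m \<xi>) = tens scl (replicate m \<xi>)"
      using symmetrize_symtensor[OF power_in_symtensors[of m \<xi>]] by (simp add: symmetrize_tens)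
    then show ?case by (simp add: powers)
  next
    case (Cons \<eta> ys)
    have ml: "multilinear scl tscale (\<lambda>zs. symprod scl (ys @ zs))"
      by (rule multilinear_append_right[OF multilinear_symprod])
    obtain c where c: "c 1 = (\<Sum>a<Suc m. symprod scl (ys @ replicate a \<xi> @ \<eta> # replicate (Suc m - 1 - a) \<xi>))"
      "\<And>s. symprod scl (ys @ replicate (Suc m) (\<xi> + scl s \<eta>)) = (\<Sum>i\<le>Suc m. tscale (s ^ i) (c i))"
      by (rule multilinear_expand_power[OF ml, where m = "Suc m" and \<xi> = \<xi> and \<eta> = \<eta>])
        (rule that)
    have "(\<Sum>i\<le>Suc m. tscale (s ^ i) (c i)) \<in> W" for s
      unfolding c(2)[symmetric] by (rule Cons.IH)
    then have "c 1 \<in> W"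
      by (rule vector_polynomial_coeffs[OF W]) simp
    also have "c 1 = (\<Sum>a<Suc m. symprod scl ((\<eta> # ys) @ replicate m \<xi>))"
      unfolding c(1)
      by (intro sum.cong refl symprod_permute)
        (simp add: mset_insert_replicate)
    also have "\<dots> = tscale (of_nat (Suc m)) (symprod scl ((\<eta> # ys) @ replicate m \<xi>))"
      using tensor_space.sum_constant_scale[of "symprod scl ((\<eta> # ys) @ replicate m \<xi>)" "{..<Suc m}"]
      by (simp del: sum_constant)
    finally have "tscale (1 / of_nat (Suc m)) (tscale (of_nat (Suc m)) (symprod scl ((\<eta> # ys) @ replicate m \<xi>))) \<in> W"
      by (rule tensor_space.subspace_scale[OF W])
    then show ?case by (simp del: of_nat_Suc)
  qed
  from this[where m = 0] have symprod: "symprod scl ys \<in> W" for ys by simp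
  have "symmetrize scl t \<in> W" if "t \<in> tensors scl" for t
    using that
    by (induction t rule: tensors_induct)
      (simp_all add: symmetrize_def[of scl 0] symmetrize_add symmetrize_scale symmetrize_tens symprod
        tensor_space.subspace_0[OF W] tensor_space.subspace_add[OF W] tensor_space.subspace_scale[OF W])
  then show ?thesis
    using symmetrize_symtensor symtensors_in_tensors by fastforce
qed

end

section \<open>Bernoulli numbers\<close>

text \<open>The coefficients \<open>B\<^sub>n / n!\<close> of \<open>t / (exp t - 1)\<close>.\<close>

definition bern_fps :: "'k::field_char_0 fps" where
  "bern_fps = inverse (Abs_fps (\<lambda>n. 1 / fact (Suc n)))"

abbreviation bern :: "nat \<Rightarrow> 'k::field_char_0" where
  "bern \<equiv> fps_nth bern_fps"

lemma bern_fps_mult: "bern_fps * Abs_fps (\<lambda>n. 1 / fact (Suc n)) = (1 :: 'k::field_char_0 fps)"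
  unfolding bern_fps_def by (rule inverse_mult_eq_1) simp

lemma bern_0: "bern 0 = (1 :: 'k::field_char_0)"
  by (simp add: bern_fps_def)

lemma bern_rec:
  assumes "n > 0"
  shows "(bern n :: 'k::field_char_0) = - (\<Sum>i<n. bern i / fact (Suc (n - i)))"
proof -
  have "(\<Sum>i\<le>n. bern i * (1 / fact (Suc (n - i)))) = (0::'k)"
    using arg_cong[OF bern_fps_mult, of "\<lambda>f. fps_nth f n"] assms by (simp add: fps_mult_nth atLeast0AtMost)
  then have "(\<Sum>i<n. bern i * (1 / fact (Suc (n - i)))) + bern n = (0::'k)"
    by (simp add: lessThan_Suc_atMost[symmetric])
  then show ?thesis by (simp add: eq_neg_iff_add_eq_0 add.commute)
qed

text \<open>Comparison with the geometric series, as \<open>2 ^ k\<close> is at most the factorial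
  of \<open>k + 1\<close>.\<close>

lemma sum_inverse_fact_le: "(\<Sum>i<n. 1 / fact (Suc (n - i)) :: real) \<le> 1 - 1 / 2 ^ n"
proof (induction n)
  case (Suc n)
  have "(2::nat) ^ Suc n \<le> fact (Suc (Suc n))"
  proof (induction n)
    case (Suc n)
    have "2 * (2::nat) ^ Suc n \<le> Suc (Suc (Suc n)) * fact (Suc (Suc n))"
      using Suc by (intro mult_mono) auto
    then show ?case by (simp only: power_Suc[of _ "Suc n"] fact_Suc[of "Suc (Suc n)"] of_nat_id)
  qed (simp add: numeral_2_eq_2)
  then have "real (2 ^ Suc n) \<le> real (fact (Suc (Suc n)))" by (simp only: of_nat_le_iff)
  then have "1 / fact (Suc (Suc n)) \<le> (1 / 2 ^ Suc n :: real)"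
    by (intro divide_left_mono) (simp_all only: of_nat_power of_nat_fact of_nat_numeral, simp_all)
  then show ?case
    using Suc unfolding sum.lessThan_Suc_shift by (simp add: field_simps)
qed simp

text \<open>The recursion expresses \<open>bern n\<close> by its predecessors with weights of total
  at most 1, so the bound 1 reproduces itself.\<close>

lemma norm_bern_le: "norm (bern n :: 'k::real_normed_field) \<le> 1"
proof (induction n rule: less_induct)
  case (less n)
  show ?case
  proof (cases "n = 0")
    case False
    have "norm (bern n :: 'k) \<le> (\<Sum>i<n. norm (bern i / fact (Suc (n - i)) :: 'k))"
      using False by (simp only: bern_rec norm_minus_cancel norm_sum neq0_conv)
    also have "\<dots> \<le> (\<Sum>i<n. 1 / fact (Suc (n - i)))"
    proof (rule sum_mono)
      fix i assume "i \<in> {..<n}"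
      then have "norm (bern i :: 'k) \<le> 1" using less by simp
      then show "norm (bern i / fact (Suc (n - i)) :: 'k) \<le> 1 / fact (Suc (n - i))"
        by (simp only: norm_divide norm_fact) (rule divide_right_mono, simp_all)
    qed
    also have "\<dots> \<le> 1" using sum_inverse_fact_le[of n] by (smt (verit) zero_le_divide_1_iff zero_le_power)
    finally show ?thesis .
  qed (simp add: bern_0)
qed

text \<open>The coefficient of degree \<open>Suc n\<close> in the functional equation for h(t) = 1 /
  (exp t - 1), taken at the arguments sX and X and cleared of denominators: with
  \<open>\<psi> c\<close> = cX / (exp (cX) - 1) it reads (T - P) Q s + (T - Q) P + s X T = 0. The
  two excluded values of \<open>s\<close> are those at which a cancelled factor exp (cX) - 1
  vanishes.\<close>

lemma bern_functional_equation:
  fixes s :: "'k::field_char_0"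
  assumes s: "s \<noteq> 0" "s + 1 \<noteq> 0"
  shows "(\<Sum>i\<le>Suc n. bern i * bern (Suc n - i) * ((s + 1) ^ (Suc n - i) - s ^ (Suc n - i))) * s +
    (\<Sum>i\<le>Suc n. bern i * s ^ i * bern (Suc n - i) * ((s + 1) ^ (Suc n - i) - 1)) =
    - (s * bern n * (s + 1) ^ n)"
proof -
  define \<psi> :: "'k \<Rightarrow> 'k fps" where "\<psi> c = Abs_fps (\<lambda>n. bern n * c ^ n)" for c
  have \<psi>: "\<psi> c * (fps_exp c - 1) = fps_const c * fps_X" for c
  proof -
    have \<psi>c: "\<psi> c = bern_fps oo (fps_const c * fps_X)"
      unfolding fps_compose_linear by (simp add: \<psi>_def mult.commute)
    have "fps_exp c - 1 = fps_const c * fps_X * (Abs_fps (\<lambda>n. 1 / fact (Suc n)) oo (fps_const c * fps_X))"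
    proof (rule fps_ext)
      have G: "Abs_fps (\<lambda>n. 1 / fact (Suc n)) oo (fps_const c * fps_X) = Abs_fps (\<lambda>n. c ^ n / fact (Suc n))"
        unfolding fps_compose_linear by simp
      show "fps_nth (fps_exp c - 1) n =
          fps_nth (fps_const c * fps_X * (Abs_fps (\<lambda>n. 1 / fact (Suc n)) oo (fps_const c * fps_X))) n" for n
        unfolding G by (cases n) (simp_all add: mult.assoc fps_X_mult_nth del: fact_Suc)
    qed
    then have "\<psi> c * (fps_exp c - 1) =
        fps_const c * fps_X * ((bern_fps * Abs_fps (\<lambda>n. 1 / fact (Suc n))) oo (fps_const c * fps_X))"
      by (simp add: \<psi>c fps_compose_mult_distrib mult_ac)
    then show ?thesis unfolding bern_fps_mult by simp
  qed
  define A B :: "'k fps" where "A = fps_exp s" and "B = fps_exp 1"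
  have AB: "fps_exp (s + 1) = A * B" by (simp add: A_def B_def fps_exp_add_mult)
  have nz: "fps_exp c - 1 \<noteq> 0" if "c \<noteq> 0" for c :: 'k
  proof -
    have "fps_nth (fps_exp c - 1) 1 \<noteq> 0" using that by simp
    then show ?thesis by force
  qed
  define S where "S = fps_const s"
  define P Q T where "P = \<psi> s" and "Q = \<psi> 1" and "T = \<psi> (s + 1)"
  have p: "P * (A - 1) = S * fps_X" "Q * (B - 1) = fps_X" "T * (A * B - 1) = (S + 1) * fps_X"
    using \<psi>[of s] \<psi>[of 1] \<psi>[of "s + 1"]
    by (simp_all add: P_def Q_def T_def A_def B_def S_def AB[unfolded A_def B_def] fps_const_add[symmetric])
  have "((T - P) * Q * S + (T - Q) * P + S * fps_X * T) * ((A - 1) * (B - 1) * (A * B - 1)) = 0"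
  proof -
    \<comment> \<open>With generic factors the product can be regrouped into \<open>P * a\<close>,
      \<open>Q * b\<close> and \<open>T * c\<close>, which is the form that the defining equations
      \<open>p\<close> rewrite.\<close>
    have "((T - P) * Q * S + (T - Q) * P + S * fps_X * T) * (a * b * c) =
        S * (T * c) * (Q * b) * a - S * (P * a) * (Q * b) * c + (T * c) * (P * a) * b -
        (Q * b) * (P * a) * c + S * fps_X * (T * c) * a * b" for a b c
      by (simp add: algebra_simps)
    from this[of "A - 1" "B - 1" "A * B - 1"] show ?thesis
      unfolding p by (simp add: algebra_simps)
  qed
  moreover have "(A - 1) * (B - 1) * (A * B - 1) \<noteq> 0"
    using nz[of s] nz[of 1] nz[of "s + 1"] s by (simp add: AB A_def B_def)
  ultimately have "(T - P) * Q * S + (T - Q) * P + S * fps_X * T = 0" by simp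
  then have "fps_nth ((Q * (T - P)) * S + P * (T - Q) + S * (fps_X * T)) (Suc n) = 0"
    by (simp add: mult_ac)
  then have "fps_nth (Q * (T - P)) (Suc n) * s + fps_nth (P * (T - Q)) (Suc n) + s * fps_nth T n = 0"
    by (simp add: S_def fps_X_mult_nth del: fps_mult_nth_0)
  moreover have "fps_nth (Q * (T - P)) (Suc n) =
      (\<Sum>i\<le>Suc n. bern i * bern (Suc n - i) * ((s + 1) ^ (Suc n - i) - s ^ (Suc n - i)))"
    unfolding fps_mult_nth atLeast0AtMost
    by (rule sum.cong) (simp_all add: P_def Q_def T_def \<psi>_def algebra_simps)
  moreover have "fps_nth (P * (T - Q)) (Suc n) =
      (\<Sum>i\<le>Suc n. bern i * s ^ i * bern (Suc n - i) * ((s + 1) ^ (Suc n - i) - 1))"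
    unfolding fps_mult_nth atLeast0AtMost
    by (rule sum.cong) (simp_all add: P_def Q_def T_def \<psi>_def algebra_simps)
  moreover have "fps_nth T n = bern n * (s + 1) ^ n" by (simp add: T_def \<psi>_def)
  ultimately show ?thesis by (simp only: eq_neg_iff_add_eq_0 mult.assoc)
qed

section \<open>The Lie algebra acts on symmetric tensors\<close>

text \<open>
  Only the restriction of \<open>left_mult\<close> to symmetric tensors matters, so that \<open>left_term\<close> need not be
  symmetrized in \<open>ys\<close>; on \<open>ys = [\<xi>, \<dots>, \<xi>]\<close> it is the Bernoulli formula for \<open>x \<star> \<xi>\<^sup>l\<close>.
\<close>

definition left_term ::
  "('k::field_char_0 \<Rightarrow> 'a::ab_group_add \<Rightarrow> 'a) \<Rightarrow> ('a \<Rightarrow> 'a \<Rightarrow> 'a) \<Rightarrow> 'a \<Rightarrow> 'a list \<Rightarrow> ('a, 'k) tensor"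
where
  "left_term scl br x ys = (\<Sum>j\<le>length ys.
    tscale (bern j * fact (length ys) / fact (length ys - j))
      (symprod scl (foldr br (take j ys) x # drop j ys)))"

definition left_mult ::
  "('k::field_char_0 \<Rightarrow> 'a::ab_group_add \<Rightarrow> 'a) \<Rightarrow> ('a \<Rightarrow> 'a \<Rightarrow> 'a) \<Rightarrow> 'a \<Rightarrow> ('a, 'k) tensor \<Rightarrow> ('a, 'k) tensor"
where
  "left_mult scl br x = tensor_lift scl (left_term scl br x)"

definition left_action ::
  "('k::field_char_0 \<Rightarrow> 'a::ab_group_add \<Rightarrow> 'a) \<Rightarrow> ('a \<Rightarrow> 'a \<Rightarrow> 'a)
    \<Rightarrow> ('a, 'k) tensor \<Rightarrow> ('a, 'k) tensor \<Rightarrow> ('a, 'k) tensor"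
where
  "left_action scl br t f = tensor_lift scl (\<lambda>xs. foldr (left_mult scl br) xs f) t"

locale char_0_lie_algebra = lie_algebra scl br
  for scl :: "'k::field_char_0 \<Rightarrow> 'a::ab_group_add \<Rightarrow> 'a" and br
begin

abbreviation "M \<equiv> left_mult scl br"
abbreviation "sprod \<equiv> symprod scl"

lemma bracket_zero_right [simp]: "br x 0 = 0"
  using bracket_add_right[of x 0 0] by simp

lemma bracket_minus_right: "br x (- y) = - br x y"
  using bracket_add_right[of x y "- y"] by (simp add: eq_neg_iff_add_eq_0 add.commute)

lemma bracket_anticommute: "br x y = - br y x"
proof -
  have "br (x + y) (x + y) = br x y + br y x"
    unfolding bracket_add_left bracket_add_right by (simp add: bracket_alternating add.commute)
  then show ?thesis by (simp only: bracket_alternating eq_neg_iff_add_eq_0)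
qed

lemma bracket_sum_right: "br x (sum f I) = (\<Sum>i\<in>I. br x (f i))"
  by (induction I rule: infinite_finite_induct) (simp_all add: bracket_add_right)

lemma bracket_derivation: "br \<xi> (br x y) = br (br \<xi> x) y + br x (br \<xi> y)"
proof -
  have "br \<xi> (br x y) = - br x (br y \<xi>) - br y (br \<xi> x)"
    using jacobi[of \<xi> x y] by (simp add: eq_neg_iff_add_eq_0 algebra_simps)
  also have "\<dots> = br x (br \<xi> y) + br (br \<xi> x) y"
    by (metis bracket_anticommute bracket_minus_right add.inverse_inverse diff_minus_eq_add add_uminus_conv_diff)
  finally show ?thesis by (simp add: add.commute)
qed

lemma multilinear_foldr_bracket: "multilinear scl scl (\<lambda>ys. foldr br ys x)"
proof (rule multilinearI)
  show "foldr br (ys[i := y + z]) x = foldr br (ys[i := y]) x + foldr br (ys[i := z]) x"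
    if "i < length ys" for ys i y z
    using that
    by (induction ys arbitrary: i) (auto simp: bracket_add_left bracket_add_right split: nat.split)
  show "foldr br (ys[i := scl c y]) x = scl c (foldr br (ys[i := y]) x)"
    if "i < length ys" for ys i c y
    using that
    by (induction ys arbitrary: i) (auto simp: bracket_scale_left bracket_scale_right split: nat.split)
qed

lemma
  shows sprod_add: "sprod ((x + y) # zs) = sprod (x # zs) + sprod (y # zs)"
    and sprod_scale: "sprod (scl c x # zs) = tscale c (sprod (x # zs))"
  using multilinear_add[OF multilinear_symprod[of scl], of 0 "x # zs"]
    multilinear_scale[OF multilinear_symprod[of scl], of 0 "x # zs"] by simp_all

lemma multilinear_left_term: "multilinear scl tscale (left_term scl br x)"
proof -
  let ?g = "\<lambda>j ys. sprod (foldr br (take j ys) x # drop j ys)"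
  have *: "?g j (ys[i := y + z]) = ?g j (ys[i := y]) + ?g j (ys[i := z]) \<and>
      ?g j (ys[i := scl c y]) = tscale c (?g j (ys[i := y]))"
    if "i < length ys" for i j ys y z c
  proof (cases "i < j")
    case True
    then show ?thesis
      using that
      by (simp_all add: take_update_swap multilinear_add[OF multilinear_foldr_bracket]
          multilinear_scale[OF multilinear_foldr_bracket] sprod_add sprod_scale)
  next
    case False
    let ?zs = "foldr br (take j ys) x # drop j ys"
    \<comment> \<open>The bracket at the head shifts the remaining letters by one, whence the
      \<open>Suc\<close>.\<close>
    have "?g j (ys[i := w]) = sprod (?zs[Suc (i - j) := w])" for w
      using False by (simp add: drop_update_swap)
    moreover have "Suc (i - j) < length ?zs" using that False by simp
    ultimately show ?thesis
      by (simp_all only: multilinear_add[OF multilinear_symprod] multilinear_scale[OF multilinear_symprod])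
  qed
  show ?thesis
    by (rule multilinearI)
      (simp_all add: left_term_def * sum.distrib tensor_space.scale_right_distrib
        tensor_space.scale_sum_right mult.commute)
qed

lemma M_tens: "M x (tens scl ys) = left_term scl br x ys"
  by (simp add: left_mult_def tensor_lift_tens[OF multilinear_left_term])

lemma M_linear: "Vector_Spaces.linear tscale tscale (M x)"
  unfolding left_mult_def by (rule linear_tensor_lift[OF multilinear_left_term])

lemma M_add: "M x (s + t) = M x s + M x t"
  and M_scale: "M x (tscale c t) = tscale c (M x t)"
  and M_zero: "M x 0 = 0"
  and M_sum: "M x (sum u I) = (\<Sum>i\<in>I. M x (u i))"
proof -
  interpret Vector_Spaces.linear tscale tscale "M x" by (rule M_linear)
  show "M x (s + t) = M x s + M x t" "M x (tscale c t) = tscale c (M x t)" "M x 0 = 0"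
    "M x (sum u I) = (\<Sum>i\<in>I. M x (u i))"
    by (rule add scale zero sum)+
qed

lemma M_in_symtensors:
  assumes "t \<in> tensors scl" shows "M x t \<in> symtensors scl"
  using assms
proof (induction t rule: tensors_induct)
  case zero
  then show ?case by (simp add: M_zero tensor_space.subspace_0[OF symtensors_subspace])
next
  case (add s t)
  then show ?case by (simp add: M_add tensor_space.subspace_add[OF symtensors_subspace])
next
  case (scale_tens c xs)
  have "M x (tens scl xs) \<in> symtensors scl"
    unfolding M_tens left_term_def
    by (intro tensor_space.subspace_sum tensor_space.subspace_scale symtensors_subspace symprod_in_symtensors)
  then show ?case by (simp add: M_scale tensor_space.subspace_scale[OF symtensors_subspace])
qed

lemma
  assumes "t \<in> tensors scl"
  shows M_add_left: "M (x + y) t = M x t + M y t"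
    and M_scale_left: "M (scl c x) t = tscale c (M x t)"
proof -
  have f: "foldr br ys (x + y) = foldr br ys x + foldr br ys y"
    "foldr br ys (scl c x) = scl c (foldr br ys x)" for ys
    by (induction ys) (simp_all add: bracket_add_right bracket_scale_right)
  have "left_term scl br (x + y) ys = left_term scl br x ys + left_term scl br y ys"
    "left_term scl br (scl c x) ys = tscale c (left_term scl br x ys)" for ys
    by (simp_all add: left_term_def f sprod_add sprod_scale sum.distrib tensor_space.scale_right_distrib
        tensor_space.scale_sum_right mult.commute)
  with assms show "M (x + y) t = M x t + M y t" "M (scl c x) t = tscale c (M x t)"
    by (induction t rule: tensors_induct)
      (simp_all add: M_zero M_add M_scale M_tens tensor_space.scale_right_distrib mult.commute)
qed

text \<open>
  With \<open>s\<close> and \<open>t\<close> standing for \<open>ad \<xi>\<close> acting on \<open>x\<close> and on \<open>y\<close>, the derivation \<open>ad \<xi>\<close> acts on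
  brackets of \<open>x\<close> and \<open>y\<close> as multiplication by \<open>s + t\<close>. In a fixed degree \<open>n\<close> one may put \<open>t = 1\<close>.
\<close>

definition bracket_eval :: "'a \<Rightarrow> 'a \<Rightarrow> 'a \<Rightarrow> nat \<Rightarrow> 'k poly \<Rightarrow> 'a" where
  "bracket_eval \<xi> x y n P =
    (\<Sum>i\<le>n. scl (coeff P i) (br ((br \<xi> ^^ i) x) ((br \<xi> ^^ (n - i)) y)))"

lemma
  shows bracket_eval_add: "bracket_eval \<xi> x y n (P + Q) = bracket_eval \<xi> x y n P + bracket_eval \<xi> x y n Q"
    and bracket_eval_smult: "bracket_eval \<xi> x y n (smult c P) = scl c (bracket_eval \<xi> x y n P)"
    and bracket_eval_0: "bracket_eval \<xi> x y n 0 = 0"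
  by (simp_all add: bracket_eval_def scale_left_distrib sum.distrib scale_sum_right)

lemma bracket_eval_sum: "bracket_eval \<xi> x y n (sum P I) = (\<Sum>i\<in>I. bracket_eval \<xi> x y n (P i))"
  by (induction I rule: infinite_finite_induct) (simp_all add: bracket_eval_add bracket_eval_0)

lemma bracket_eval_monom:
  "bracket_eval \<xi> x y (i + j) (monom c i) = scl c (br ((br \<xi> ^^ i) x) ((br \<xi> ^^ j) y))"
proof -
  have "bracket_eval \<xi> x y (i + j) (monom c i) =
      (\<Sum>k\<le>i + j. if k = i then scl c (br ((br \<xi> ^^ i) x) ((br \<xi> ^^ j) y)) else 0)"
    unfolding bracket_eval_def by (rule sum.cong) (simp_all add: coeff_monom)
  then show ?thesis by simp
qed

text \<open>Since ad \<xi> is a derivation, it multiplies by s + t, here by s + 1. The degree bound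
  matters: \<open>bracket_eval\<close> in degree \<open>Suc n\<close> also reads the coefficient
  number \<open>Suc n\<close>, which has to vanish.\<close>

lemma bracket_bracket_eval:
  assumes "degree P \<le> n"
  shows "br \<xi> (bracket_eval \<xi> x y n P) = bracket_eval \<xi> x y (Suc n) (P * [:1, 1:])"
proof -
  let ?T = "\<lambda>i j. br ((br \<xi> ^^ i) x) ((br \<xi> ^^ j) y)"
  have "br \<xi> (bracket_eval \<xi> x y n P) =
      (\<Sum>i\<le>n. scl (coeff P i) (?T i (Suc n - i))) + (\<Sum>i\<le>n. scl (coeff P i) (?T (Suc i) (n - i)))"
    by (simp add: bracket_eval_def bracket_sum_right bracket_scale_right bracket_derivation[of \<xi>] Suc_diff_le
        scale_right_distrib sum.distrib add.commute)
  also have "(\<Sum>i\<le>n. scl (coeff P i) (?T i (Suc n - i))) = bracket_eval \<xi> x y (Suc n) P"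
    using coeff_eq_0[of P "Suc n"] assms by (simp add: bracket_eval_def)
  also have "(\<Sum>i\<le>n. scl (coeff P i) (?T (Suc i) (n - i))) = bracket_eval \<xi> x y (Suc n) (pCons 0 P)"
    unfolding bracket_eval_def sum.atMost_Suc_shift by simp
  also have "bracket_eval \<xi> x y (Suc n) P + bracket_eval \<xi> x y (Suc n) (pCons 0 P) =
      bracket_eval \<xi> x y (Suc n) (P * [:1, 1:])"
    by (simp add: bracket_eval_add[symmetric])
  finally show ?thesis .
qed

lemma funpow_bracket_eval:
  assumes "degree P \<le> n"
  shows "(br \<xi> ^^ a) (bracket_eval \<xi> x y n P) = bracket_eval \<xi> x y (n + a) (P * [:1, 1:] ^ a)"
proof (induction a)
  case (Suc a)
  have "degree (P * [:1, 1:] ^ a) \<le> n + a"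
    using degree_mult_le[of P "[:1, 1:] ^ a"] degree_power_le[of "[:1, 1:] :: 'k poly" a] assms by simp
  from bracket_bracket_eval[OF this] show ?case
    by (simp only: funpow.simps o_apply Suc power_Suc2 mult.assoc add_Suc_right)
qed simp

text \<open>With u the \<open>i\<close>-th iterate of ad \<xi> on \<open>y\<close>, this is the
  derivative of the \<open>j\<close>-th iterate of ad \<xi> on \<open>x\<close> when \<xi> varies in
  the direction u.\<close>

definition ad_sum :: "'a \<Rightarrow> 'a \<Rightarrow> 'a \<Rightarrow> nat \<Rightarrow> nat \<Rightarrow> 'a" where
  "ad_sum \<xi> x y i j = (\<Sum>a<j. (br \<xi> ^^ a) (br ((br \<xi> ^^ i) y) ((br \<xi> ^^ (j - 1 - a)) x)))"

text \<open>Both sides are \<open>bracket_eval\<close> of polynomials. Summing over \<open>a\<close>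
  gives geometric sums with the ratio pair s + 1 and s for \<open>P\<close>, and s + 1 and 1 for
  \<open>Q\<close>; after multiplication by s the equality of the polynomials is
  \<open>bern_functional_equation\<close>.\<close>

lemma ad_sum_identity:
  "(\<Sum>i\<le>Suc n. scl (bern i * bern (Suc n - i)) (ad_sum \<xi> x y i (Suc n - i))) -
    (\<Sum>i\<le>Suc n. scl (bern i * bern (Suc n - i)) (ad_sum \<xi> y x i (Suc n - i))) =
    scl (bern n) ((br \<xi> ^^ n) (br x y))"
proof -
  let ?c = "\<lambda>i. bern i * bern (Suc n - i) :: 'k"
  define P :: "'k poly" where "P = (\<Sum>i\<le>Suc n. smult (?c i)
    (\<Sum>a<Suc n - i. monom (-1) (Suc n - i - Suc a) * [:1, 1:] ^ a))"
  define Q :: "'k poly" where "Q = (\<Sum>i\<le>Suc n. smult (?c i) (\<Sum>a<Suc n - i. monom 1 i * [:1, 1:] ^ a))"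
  \<comment> \<open>The sign comes from moving the part with \<open>x\<close> to the left slot,
    whose exponent \<open>bracket_eval\<close> records.\<close>
  have term1: "(br \<xi> ^^ a) (br ((br \<xi> ^^ i) y) ((br \<xi> ^^ b) x)) =
      bracket_eval \<xi> x y (b + i + a) (monom (-1) b * [:1, 1:] ^ a)" for a b i
    using bracket_eval_monom[of \<xi> x y b i "-1"] bracket_anticommute[of "(br \<xi> ^^ i) y" "(br \<xi> ^^ b) x"]
    by (simp add: degree_monom_eq flip: funpow_bracket_eval)
  have term2: "(br \<xi> ^^ a) (br ((br \<xi> ^^ i) x) ((br \<xi> ^^ b) y)) =
      bracket_eval \<xi> x y (i + b + a) (monom 1 i * [:1, 1:] ^ a)" for a b i
    using bracket_eval_monom[of \<xi> x y i b 1]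
    by (simp add: degree_monom_eq flip: funpow_bracket_eval)
  have P: "(\<Sum>i\<le>Suc n. scl (?c i) (ad_sum \<xi> x y i (Suc n - i))) = bracket_eval \<xi> x y n P"
    unfolding P_def bracket_eval_sum bracket_eval_smult ad_sum_def
    by (intro sum.cong refl arg_cong[where f = "scl _"]) (simp add: term1)
  have Q: "(\<Sum>i\<le>Suc n. scl (?c i) (ad_sum \<xi> y x i (Suc n - i))) = bracket_eval \<xi> x y n Q"
    unfolding Q_def bracket_eval_sum bracket_eval_smult ad_sum_def
    by (intro sum.cong refl arg_cong[where f = "scl _"]) (simp add: term2)
  have "P - Q = smult (bern n) ([:1, 1:] ^ n)"
  proof (rule ccontr)
    assume neq: "P - Q \<noteq> smult (bern n) ([:1, 1:] ^ n)"
    \<comment> \<open>A polynomial that vanishes at all but two points of an infinite field is zero,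
      so the two values excluded in the functional equation do no harm.\<close>
    have "poly (P - Q - smult (bern n) ([:1, 1:] ^ n)) s = 0" if s: "s \<noteq> 0" "s + 1 \<noteq> 0" for s
    proof -
      \<comment> \<open>In this geometric sum the denominator is (s + 1) - s = 1; in
        \<open>pQ\<close> it is (s + 1) - 1, which explains the factor \<open>s\<close>
        there.\<close>
      have pP: "poly P s = - (\<Sum>i\<le>Suc n. ?c i * ((s + 1) ^ (Suc n - i) - s ^ (Suc n - i)))"
        unfolding power_diff_sumr2
        by (simp add: P_def poly_sum poly_monom sum_negf add.commute)
      have pQ: "s * poly Q s = (\<Sum>i\<le>Suc n. bern i * s ^ i * bern (Suc n - i) * ((s + 1) ^ (Suc n - i) - 1))"
        using power_diff_sumr2[of "s + 1" _ 1]
        by (simp add: Q_def poly_sum poly_monom sum_distrib_left mult_ac add.commute)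
      have "s * (poly P s - poly Q s) = - ((\<Sum>i\<le>Suc n. ?c i * ((s + 1) ^ (Suc n - i) - s ^ (Suc n - i))) * s +
          (\<Sum>i\<le>Suc n. bern i * s ^ i * bern (Suc n - i) * ((s + 1) ^ (Suc n - i) - 1)))"
        unfolding right_diff_distrib[of s] pQ unfolding pP by (simp only: mult_minus_right mult.commute[of s] minus_add_distrib diff_conv_add_uminus)
      also have "\<dots> = s * (bern n * (s + 1) ^ n)"
        unfolding bern_functional_equation[OF s] by simp
      finally have "s * (poly P s - poly Q s) = s * (bern n * (s + 1) ^ n)" .
      then show ?thesis using s by (simp add: add.commute)
    qed
    then have "UNIV - {0, -1} \<subseteq> {s. poly (P - Q - smult (bern n) ([:1, 1:] ^ n)) s = 0}"
      by (auto simp: eq_neg_iff_add_eq_0)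
    moreover have "infinite (UNIV - {0, -1 :: 'k})"
      by (simp add: infinite_UNIV_char_0)
    moreover have "finite {s. poly (P - Q - smult (bern n) ([:1, 1:] ^ n)) s = 0}"
      using neq by (intro poly_roots_finite) simp
    ultimately show False by (meson finite_subset)
  qed
  then have "P = Q + smult (bern n) ([:1, 1:] ^ n)" by (simp add: algebra_simps)
  then show ?thesis
    unfolding P Q using term2[where a = n and i = 0 and b = 0]
    by (simp add: bracket_eval_add bracket_eval_smult monom_0)
qed

lemma M_power:
  "M y (tens scl (replicate l \<xi>)) = (\<Sum>j\<le>l. tscale (bern j * fact l / fact (l - j))
    (sprod ((br \<xi> ^^ j) y # replicate (l - j) \<xi>)))"
  unfolding M_tens left_term_def by (rule sum.cong) (simp_all add: min_def)

lemma sprod_sum: "sprod (sum f I # zs) = (\<Sum>i\<in>I. sprod (f i # zs))"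
proof -
  have "sprod (0 # zs) = 0" using sprod_scale[of 0 0 zs] by simp
  then show ?thesis
    by (induction I rule: infinite_finite_induct) (simp_all add: sprod_add)
qed

text \<open>Average over the position \<open>a\<close> of \<open>u\<close>. For \<open>a < j\<close>
  the nested bracket swallows \<open>u\<close>; for the other \<open>Suc m - j\<close> positions
  \<open>u\<close> stays a factor of its own. The average turns the factorial of
  \<open>Suc m\<close> into that of \<open>m\<close>. At \<open>j = Suc m\<close> the second term
  has coefficient 0, so the truncated \<open>m - j\<close> is harmless.\<close>

lemma M_insertion:
  "M x (sprod (u # replicate m \<xi>)) = (\<Sum>j\<le>Suc m. tscale (bern j * fact m / fact (Suc m - j))
    (sprod ((\<Sum>a<j. (br \<xi> ^^ a) (br u ((br \<xi> ^^ (j - 1 - a)) x))) # replicate (Suc m - j) \<xi>) +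
     tscale (of_nat (Suc m - j)) (sprod ((br \<xi> ^^ j) x # u # replicate (m - j) \<xi>))))"
proof -
  let ?ys = "\<lambda>a. replicate a \<xi> @ u # replicate (m - a) \<xi>"
  let ?g = "\<lambda>a j. sprod (foldr br (take j (?ys a)) x # drop j (?ys a))"
  have inner: "(\<Sum>a\<le>m. ?g a j) =
      sprod ((\<Sum>a<j. (br \<xi> ^^ a) (br u ((br \<xi> ^^ (j - 1 - a)) x))) # replicate (Suc m - j) \<xi>) +
      tscale (of_nat (Suc m - j)) (sprod ((br \<xi> ^^ j) x # u # replicate (m - j) \<xi>))" if "j \<le> Suc m" for j
  proof -
    have "{..m} = {..<j} \<union> {j..<Suc m}" "{..<j} \<inter> {j..<Suc m} = {}" using that by auto
    then have "(\<Sum>a\<le>m. ?g a j) = (\<Sum>a<j. ?g a j) + (\<Sum>a=j..<Suc m. ?g a j)"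
      by (simp add: sum.union_disjoint)
    also have "(\<Sum>a<j. ?g a j) =
        (\<Sum>a<j. sprod ((br \<xi> ^^ a) (br u ((br \<xi> ^^ (j - 1 - a)) x)) # replicate (Suc m - j) \<xi>))"
    proof (rule sum.cong[OF refl])
      fix a assume "a \<in> {..<j}"
      then obtain b where "j = a + Suc b" using less_imp_Suc_add by auto
      moreover from this that have "b \<le> m - a" by simp
      ultimately show "?g a j = sprod ((br \<xi> ^^ a) (br u ((br \<xi> ^^ (j - 1 - a)) x)) # replicate (Suc m - j) \<xi>)"
        by (simp add: min_def)
    qed
    also have "(\<Sum>a=j..<Suc m. ?g a j) = (\<Sum>a=j..<Suc m. sprod ((br \<xi> ^^ j) x # u # replicate (m - j) \<xi>))"
    proof (rule sum.cong[OF refl])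
      fix a assume a: "a \<in> {j..<Suc m}"
      then have "?g a j = sprod ((br \<xi> ^^ j) x # replicate (a - j) \<xi> @ u # replicate (m - a) \<xi>)"
        by (simp add: min_def)
      also have "\<dots> = sprod ((br \<xi> ^^ j) x # u # replicate (m - j) \<xi>)"
        using a mset_insert_replicate[of "a - j" "m - j" \<xi>] by (intro symprod_permute) auto
      finally show "?g a j = sprod ((br \<xi> ^^ j) x # u # replicate (m - j) \<xi>)" .
    qed
    also have "\<dots> = tscale (of_nat (Suc m - j)) (sprod ((br \<xi> ^^ j) x # u # replicate (m - j) \<xi>))"
      using tensor_space.sum_constant_scale[of "sprod ((br \<xi> ^^ j) x # u # replicate (m - j) \<xi>)" "{j..<Suc m}"]
      by (simp del: sum_constant)
    finally show ?thesis by (simp add: sprod_sum)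
  qed
  have "M x (sprod (u # replicate m \<xi>)) = tscale (1 / of_nat (Suc m)) (\<Sum>a\<le>m. left_term scl br x (?ys a))"
    by (simp only: insertion_average M_scale M_sum M_tens)
  also have "\<dots> = tscale (1 / of_nat (Suc m))
      (\<Sum>a\<le>m. \<Sum>j\<le>Suc m. tscale (bern j * fact (Suc m) / fact (Suc m - j)) (?g a j))"
    unfolding left_term_def
    by (intro arg_cong[where f = "tscale _"] sum.cong) (simp_all del: fact_Suc)
  also have "\<dots> = (\<Sum>j\<le>Suc m. tscale (1 / of_nat (Suc m) * (bern j * fact (Suc m) / fact (Suc m - j))) (\<Sum>a\<le>m. ?g a j))"
    by (subst sum.swap)
      (simp only: tensor_space.scale_sum_right tensor_space.scale_scale)
  also have "\<dots> = (\<Sum>j\<le>Suc m. tscale (bern j * fact m / fact (Suc m - j)) (\<Sum>a\<le>m. ?g a j))"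
    by (intro sum.cong refl arg_cong2[where f = tscale]) (simp add: field_simps del: of_nat_Suc)
  finally show ?thesis using inner by (simp del: sum.atMost_Suc)
qed

lemma M_M_power:
  "M x (M y (tens scl (replicate l \<xi>))) = (\<Sum>k\<le>Suc l. tscale (fact l / fact (Suc l - k))
    (sprod ((\<Sum>i\<le>k. scl (bern i * bern (k - i)) (ad_sum \<xi> x y i (k - i))) # replicate (Suc l - k) \<xi>) +
     tscale (of_nat (Suc l - k)) (\<Sum>i\<le>k. tscale (bern i * bern (k - i))
       (sprod ((br \<xi> ^^ (k - i)) x # (br \<xi> ^^ i) y # replicate (l - k) \<xi>)))))"
proof -
  let ?g = "\<lambda>i j. tscale (bern i * bern j * fact l / fact (Suc l - (i + j)))
    (sprod (ad_sum \<xi> x y i j # replicate (Suc l - (i + j)) \<xi>) +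
     tscale (of_nat (Suc l - (i + j))) (sprod ((br \<xi> ^^ j) x # (br \<xi> ^^ i) y # replicate (l - (i + j)) \<xi>)))"
  have "M x (M y (tens scl (replicate l \<xi>))) = (\<Sum>i\<le>l. tscale (bern i * fact l / fact (l - i))
      (M x (sprod ((br \<xi> ^^ i) y # replicate (l - i) \<xi>))))"
    by (simp add: M_power M_sum M_scale)
  also have "\<dots> = (\<Sum>i\<le>l. \<Sum>j\<le>Suc l - i. ?g i j)"
  proof (rule sum.cong[OF refl])
    fix i assume "i \<in> {..l}"
    then have i: "Suc (l - i) = Suc l - i" by auto
    show "tscale (bern i * fact l / fact (l - i)) (M x (sprod ((br \<xi> ^^ i) y # replicate (l - i) \<xi>))) =
        (\<Sum>j\<le>Suc l - i. ?g i j)"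
      unfolding M_insertion i tensor_space.scale_sum_right tensor_space.scale_scale ad_sum_def[symmetric]
      by (intro sum.cong refl arg_cong2[where f = tscale]) (simp_all add: mult_ac)
  qed
  \<comment> \<open>The added row \<open>i = Suc l\<close>, \<open>j = 0\<close> is zero:
    \<open>ad_sum\<close> is then an empty sum and the other term has coefficient 0. It completes
    the index set to a triangle, which is resummed by the total number \<open>k = i + j\<close> of
    brackets.\<close>
  also have "\<dots> = (\<Sum>i\<le>Suc l. \<Sum>j\<le>Suc l - i. ?g i j)"
    using sprod_scale[of 0 0] by (simp add: ad_sum_def)
  also have "\<dots> = (\<Sum>(i, j)\<in>{(i, j). i + j \<le> Suc l}. ?g i j)"
    by (subst sum.Sigma) (auto intro!: sum.cong)
  also have "\<dots> = (\<Sum>k\<le>Suc l. \<Sum>i\<le>k. ?g i (k - i))"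
    by (rule sum.triangle_reindex_eq)
  also have "\<dots> = (\<Sum>k\<le>Suc l. tscale (fact l / fact (Suc l - k))
    (sprod ((\<Sum>i\<le>k. scl (bern i * bern (k - i)) (ad_sum \<xi> x y i (k - i))) # replicate (Suc l - k) \<xi>) +
     tscale (of_nat (Suc l - k)) (\<Sum>i\<le>k. tscale (bern i * bern (k - i))
       (sprod ((br \<xi> ^^ (k - i)) x # (br \<xi> ^^ i) y # replicate (l - k) \<xi>)))))"
    by (intro sum.cong refl)
      (simp add: sprod_sum sprod_scale tensor_space.scale_sum_right tensor_space.scale_right_distrib
        sum.distrib mult_ac del: of_nat_diff)
  finally show ?thesis .
qed

text \<open>The terms in which x and y end up in different factors are symmetric under exchanging x
  and y and cancel. What remains are the terms with one bracket containing both, and these are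
  matched degree by degree with \<open>M (br x y)\<close> by \<open>ad_sum_identity\<close>.\<close>

lemma M_commutator_power:
  "M x (M y (tens scl (replicate l \<xi>))) - M y (M x (tens scl (replicate l \<xi>))) =
    M (br x y) (tens scl (replicate l \<xi>))"
proof -
  let ?Q = "\<lambda>x y k. \<Sum>i\<le>k. scl (bern i * bern (k - i)) (ad_sum \<xi> x y i (k - i))"
  let ?Z = "\<lambda>x y k. \<Sum>i\<le>k. tscale (bern i * bern (k - i))
       (sprod ((br \<xi> ^^ (k - i)) x # (br \<xi> ^^ i) y # replicate (l - k) \<xi>))"
  have Z: "?Z x y k = ?Z y x k" for k
  proof -
    have "?Z x y k = (\<Sum>i\<le>k. tscale (bern (k - i) * bern (k - (k - i)))
       (sprod ((br \<xi> ^^ (k - (k - i))) x # (br \<xi> ^^ (k - i)) y # replicate (l - k) \<xi>)))"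
      by (rule sum.reindex_bij_witness[of _ "\<lambda>i. k - i" "\<lambda>i. k - i"]) auto
    also have "\<dots> = ?Z y x k"
      by (intro sum.cong refl arg_cong2[where f = tscale] symprod_permute) (simp_all add: mult.commute)
    finally show ?thesis .
  qed
  have sprod_diff: "sprod ((u - v) # zs) = sprod (u # zs) - sprod (v # zs)" for u v zs
    using sprod_add[of "u - v" v zs] by (simp add: algebra_simps)
  have "M x (M y (tens scl (replicate l \<xi>))) - M y (M x (tens scl (replicate l \<xi>))) =
      (\<Sum>k\<le>Suc l. tscale (fact l / fact (Suc l - k)) (sprod ((?Q x y k - ?Q y x k) # replicate (Suc l - k) \<xi>)))"
    unfolding M_M_power Z
    by (rule trans[OF sum_subtractf[symmetric] sum.cong[OF refl]])
      (simp add: sprod_diff tensor_space.scale_right_diff_distrib[symmetric] del: of_nat_diff)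
  also have "\<dots> = (\<Sum>n\<le>l. tscale (fact l / fact (l - n))
      (sprod ((?Q x y (Suc n) - ?Q y x (Suc n)) # replicate (l - n) \<xi>)))"
    unfolding sum.atMost_Suc_shift using sprod_scale[of 0 0] by (simp add: ad_sum_def del: sum.atMost_Suc)
  also have "\<dots> = M (br x y) (tens scl (replicate l \<xi>))"
    unfolding ad_sum_identity M_power by (simp add: sprod_scale mult_ac)
  finally show ?thesis .
qed

lemma M_commutator:
  assumes "f \<in> symtensors scl"
  shows "M x (M y f) - M y (M x f) = M (br x y) f"
proof -
  let ?W = "{f. M x (M y f) - M y (M x f) = M (br x y) f}"
  have "tensor_space.subspace ?W"
    by (rule tensor_space.subspaceI)
      (auto simp: M_zero M_add M_scale tensor_space.scale_right_diff_distrib algebra_simps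
        simp flip: tensor_space.scale_right_diff_distrib)
  then have "symtensors scl \<subseteq> ?W"
    by (rule symtensors_subset_if_powers) (simp add: M_commutator_power)
  with assms show ?thesis by blast
qed

end

section \<open>Normal ordering and the Poincare-Birkhoff-Witt theorem\<close>

definition normal_order ::
  "('k::field_char_0 \<Rightarrow> 'a::ab_group_add \<Rightarrow> 'a) \<Rightarrow> ('a \<Rightarrow> 'a \<Rightarrow> 'a) \<Rightarrow> ('a, 'k) tensor \<Rightarrow> ('a, 'k) tensor"
where
  "normal_order scl br t = left_action scl br t (tens scl [])"

lemma ideal_env_ideal: "ideal (env_ideal scl br) (tensor_ring scl)"
  unfolding env_ideal_def
  by (rule ring.genideal_ideal[OF ring_tensor_ring])
    (auto simp: tensor_ring_def intro!: tensors_diff)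

lemma env_ideal_subset: "env_ideal scl br \<subseteq> tensors scl"
  using additive_subgroup.a_subset[OF ideal.axioms(1)[OF ideal_env_ideal]]
  by (simp add: tensor_ring_def)

lemma env_ideal_generator: "tens scl [x, y] - tens scl [y, x] - tens scl [br x y] \<in> env_ideal scl br"
  unfolding env_ideal_def
  by (rule subsetD[OF ring.genideal_self[OF ring_tensor_ring]])
    (auto simp: tensor_ring_def intro!: tensors_diff)

lemma env_ideal_tmult:
  assumes "i \<in> env_ideal scl br" "t \<in> tensors scl"
  shows "tmult scl i t \<in> env_ideal scl br" "tmult scl t i \<in> env_ideal scl br"
  using ideal.I_r_closed[OF ideal_env_ideal assms(1), of t] ideal.I_l_closed[OF ideal_env_ideal assms(1), of t] assms(2)
  by (simp_all add: tensor_ring_def)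

text \<open>A ring ideal is closed under scalars here because scaling by \<open>c\<close> is
  multiplication by \<open>tscale c (tens scl [])\<close>.\<close>

lemma env_ideal_subspace: "tensor_space.subspace (env_ideal scl br)"
proof (rule tensor_space.subspaceI)
  interpret additive_subgroup "env_ideal scl br" "tensor_ring scl"
    by (rule ideal.axioms(1)[OF ideal_env_ideal])
  show "0 \<in> env_ideal scl br" using zero_closed by (simp add: tensor_ring_def)
  show "s + t \<in> env_ideal scl br" if "s \<in> env_ideal scl br" "t \<in> env_ideal scl br" for s t
    using a_closed[OF that] by (simp add: tensor_ring_def)
  show "tscale c t \<in> env_ideal scl br" if "t \<in> env_ideal scl br" for c t
    using env_ideal_tmult(2)[OF that, of "tscale c (tens scl [])"] subsetD[OF env_ideal_subset that]
    by (simp add: tmult_scale_left tmult_unit tensors_scale)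
qed

lemma env_class_eq: "env_class scl br t = {i + t | i. i \<in> env_ideal scl br}"
  by (auto simp: env_class_def a_r_coset_def' tensor_ring_def)

lemma env_class_eq_iff: "env_class scl br s = env_class scl br t \<longleftrightarrow> s - t \<in> env_ideal scl br"
proof
  assume eq: "env_class scl br s = env_class scl br t"
  have "s \<in> env_class scl br s"
    using tensor_space.subspace_0[OF env_ideal_subspace[of scl br]] unfolding env_class_eq by force
  then show "s - t \<in> env_ideal scl br" unfolding eq by (auto simp: env_class_eq)
next
  assume i: "s - t \<in> env_ideal scl br"
  have "i + s = (i + (s - t)) + t" "i + t = (i - (s - t)) + s" for i by (simp_all add: algebra_simps)
  then show "env_class scl br s = env_class scl br t"
    using tensor_space.subspace_add[OF env_ideal_subspace _ i] tensor_space.subspace_diff[OF env_ideal_subspace _ i]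
    unfolding env_class_eq by blast
qed

lemma env_class_mult:
  assumes "s \<in> tensors scl" "t \<in> tensors scl"
  shows "env_class scl br s \<otimes>\<^bsub>env_algebra scl br\<^esub> env_class scl br t = env_class scl br (tmult scl s t)"
  using ring_hom_mult[OF ideal.rcos_ring_hom[OF ideal_env_ideal[of scl br]], of s t] assms
  by (simp add: env_class_def env_algebra_def tensor_ring_def)

context char_0_lie_algebra
begin

abbreviation "act_M \<equiv> left_action scl br"
abbreviation "N \<equiv> normal_order scl br"
abbreviation "T \<equiv> tensors scl"
abbreviation "S \<equiv> symtensors scl"
abbreviation "I \<equiv> env_ideal scl br"

lemma foldr_M_in_tensors: "f \<in> T \<Longrightarrow> foldr M xs f \<in> T"
  by (induction xs) (simp_all add: M_in_symtensors symtensors_in_tensors)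

lemma foldr_M_in_symtensors: "f \<in> S \<Longrightarrow> foldr M xs f \<in> S"
  by (induction xs) (simp_all add: M_in_symtensors symtensors_in_tensors)

lemma foldr_M_linear:
  "foldr M xs (f + g) = foldr M xs f + foldr M xs g"
  "foldr M xs (tscale c f) = tscale c (foldr M xs f)"
  "foldr M xs 0 = 0"
  by (induction xs) (simp_all add: M_add M_scale M_zero)

lemma multilinear_foldr_M:
  assumes "f \<in> T" shows "multilinear scl tscale (\<lambda>xs. foldr M xs f)"
proof (rule multilinearI)
  show "foldr M (xs[i := x + y]) f = foldr M (xs[i := x]) f + foldr M (xs[i := y]) f"
    if "i < length xs" for xs i x y
    using that
    by (induction xs arbitrary: i) (auto simp: M_add M_add_left assms foldr_M_in_tensors split: nat.split)
  show "foldr M (xs[i := scl c x]) f = tscale c (foldr M (xs[i := x]) f)"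
    if "i < length xs" for xs i c x
    using that
    by (induction xs arbitrary: i) (auto simp: M_scale M_scale_left assms foldr_M_in_tensors split: nat.split)
qed

context
  fixes f :: "('a, 'k) tensor"
  assumes f: "f \<in> T"
begin

lemma act_tens: "act_M (tens scl xs) f = foldr M xs f"
  unfolding left_action_def by (rule tensor_lift_tens[OF multilinear_foldr_M[OF f]])

lemma act_add_left: "act_M (s + t) f = act_M s f + act_M t f"
  and act_scale_left: "act_M (tscale c t) f = tscale c (act_M t f)"
  and act_zero_left: "act_M 0 f = 0"
  and act_diff_left: "act_M (s - t) f = act_M s f - act_M t f"
proof -
  interpret Vector_Spaces.linear tscale tscale "\<lambda>t. act_M t f"
    unfolding left_action_def by (rule linear_tensor_lift[OF multilinear_foldr_M[OF f]])
  show "act_M (s + t) f = act_M s f + act_M t f" "act_M (tscale c t) f = tscale c (act_M t f)"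
    "act_M 0 f = 0" "act_M (s - t) f = act_M s f - act_M t f"
    by (rule add scale zero diff)+
qed

end

lemma act_in_symtensors:
  assumes "t \<in> T" "f \<in> S" shows "act_M t f \<in> S"
  using assms(1)
  by (induction t rule: tensors_induct)
    (simp_all add: assms(2) symtensors_in_tensors act_zero_left act_add_left act_scale_left act_tens
      foldr_M_in_symtensors symtensors_closed)

lemma act_zero_right: "t \<in> T \<Longrightarrow> act_M t 0 = 0"
  by (induction t rule: tensors_induct)
    (simp_all add: act_zero_left act_add_left act_scale_left act_tens foldr_M_linear)

lemma act_tmult:
  assumes t: "t \<in> T" and s: "s \<in> T" and f: "f \<in> S"
  shows "act_M (tmult scl t s) f = act_M t (act_M s f)"
proof -
  have fT: "f \<in> T" using f by (rule symtensors_in_tensors)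
  have aT: "act_M s f \<in> T" if "s \<in> T" for s
    by (rule symtensors_in_tensors[OF act_in_symtensors[OF that f]])
  have "act_M (tmult scl (tens scl xs) s) f = foldr M xs (act_M s f)" for xs
    using s
  proof (induction s rule: tensors_induct)
    case zero
    then show ?case by (simp add: tmult_zero_right act_zero_left[OF fT] foldr_M_linear)
  next
    case (add u v)
    then show ?case by (simp add: tmult_add_right act_add_left[OF fT] foldr_M_linear)
  next
    case (scale_tens c ys)
    then show ?case
      by (simp add: tmult_scale_right tmult_tens act_scale_left[OF fT] act_tens[OF fT] foldr_M_linear)
  qed
  with t show ?thesis
    by (induction t rule: tensors_induct)
      (simp_all add: tmult_add_left tmult_scale_left act_zero_left act_add_left act_scale_left act_tens fT aT s)
qed

text \<open>The annihilator of the whole of \<open>S\<close> is a two-sided ideal, since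
  \<open>S\<close> is stable under the action and products act by composition. It contains the
  defining relations by \<open>M_commutator\<close>, hence the ideal that they generate.\<close>

lemma env_ideal_acts_zero:
  assumes "i \<in> I" "f \<in> S" shows "act_M i f = 0"
proof -
  let ?K = "{t \<in> T. \<forall>f\<in>S. act_M t f = 0}"
  have "ideal ?K (tensor_ring scl)"
  proof (rule idealI)
    show "subgroup ?K (add_monoid (tensor_ring scl))"
    proof (rule group.subgroupI)
      show "group (add_monoid (tensor_ring scl))"
        using ring_tensor_ring abelian_group.a_group[OF ring.is_abelian_group] by blast
      show "inv\<^bsub>add_monoid (tensor_ring scl)\<^esub> a \<in> ?K" if "a \<in> ?K" for a
      proof -
        interpret R: ring "tensor_ring scl" by (rule ring_tensor_ring)
        have "tscale (-1) a \<in> T" using that by (intro tensors_scale) simp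
        then have "a_inv (tensor_ring scl) a = - a"
          using that by (intro R.minus_equality) (auto simp: tensor_ring_def)
        then have "inv\<^bsub>add_monoid (tensor_ring scl)\<^esub> a = tscale (-1) a"
          by (simp add: a_inv_def)
        then show ?thesis
          using that \<open>tscale (-1) a \<in> T\<close> act_scale_left[OF symtensors_in_tensors, of _ "-1" a] by simp
      qed
    qed (auto simp: tensor_ring_def tensors_add act_add_left symtensors_in_tensors act_zero_left intro!: exI[of _ 0])
  next
    show "x \<otimes>\<^bsub>tensor_ring scl\<^esub> a \<in> ?K" "a \<otimes>\<^bsub>tensor_ring scl\<^esub> x \<in> ?K"
      if "a \<in> ?K" "x \<in> carrier (tensor_ring scl)" for a x
      using that act_zero_right[of x]
      by (auto simp: tensor_ring_def tmult_in_tensors act_tmult act_in_symtensors)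
  qed (rule ring_tensor_ring)
  moreover have "{tens scl [x, y] - tens scl [y, x] - tens scl [br x y] | x y. True} \<subseteq> ?K"
    using M_commutator
    by (auto simp: act_diff_left act_tens symtensors_in_tensors intro!: tensors_diff)
  ultimately have "I \<subseteq> ?K"
    unfolding env_ideal_def by (rule ring.genideal_minimal[OF ring_tensor_ring])
  with assms show ?thesis by blast
qed

lemma one_in_symtensors: "tens scl [] \<in> S"
  using power_in_symtensors[of scl 0] by simp

lemma N_in_symtensors: "t \<in> T \<Longrightarrow> N t \<in> S"
  unfolding normal_order_def by (rule act_in_symtensors[OF _ one_in_symtensors])

lemma N_tens: "N (tens scl xs) = foldr M xs (tens scl [])"
  and N_add: "N (s + t) = N s + N t"
  and N_scale: "N (tscale c t) = tscale c (N t)"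
  and N_zero: "N 0 = 0"
  and N_diff: "N (s - t) = N s - N t"
  by (simp_all add: normal_order_def act_tens act_add_left act_scale_left act_zero_left act_diff_left)

lemma N_ideal: "i \<in> I \<Longrightarrow> N i = 0"
  unfolding normal_order_def by (rule env_ideal_acts_zero[OF _ one_in_symtensors])

text \<open>On a power of \<xi> all terms of the Bernoulli formula with j > 0 contain the bracket of
  \<xi> with itself, and \<open>bern 0 = 1\<close>; so multiplication by \<xi> just raises the
  power. Polarization does the rest.\<close>

lemma N_symtensor:
  assumes "f \<in> S" shows "N f = f"
proof -
  have sprod0: "sprod (0 # zs) = 0" for zs using sprod_scale[of 0 0 zs] by simp
  have ad: "(br \<xi> ^^ Suc j) \<xi> = 0" for \<xi> j
    by (induction j) (simp_all add: bracket_alternating)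
  have "N (tens scl (replicate n \<xi>)) = tens scl (replicate n \<xi>)" for n \<xi>
  proof (induction n)
    case (Suc n)
    have "N (tens scl (replicate (Suc n) \<xi>)) = M \<xi> (tens scl (replicate n \<xi>))"
      using Suc by (simp add: N_tens)
    also have "\<dots> = (\<Sum>j\<in>{0}. tscale (bern j * fact n / fact (n - j))
        (sprod ((br \<xi> ^^ j) \<xi> # replicate (n - j) \<xi>)))"
      unfolding M_power
    proof (rule sum.mono_neutral_right)
      show "\<forall>i\<in>{..n} - {0}. tscale (bern i * fact n / fact (n - i))
          (sprod ((br \<xi> ^^ i) \<xi> # replicate (n - i) \<xi>)) = 0"
      proof
        fix i assume "i \<in> {..n} - {0}"
        then obtain j where "i = Suc j" by (cases i) auto
        then show "tscale (bern i * fact n / fact (n - i))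
          (sprod ((br \<xi> ^^ i) \<xi> # replicate (n - i) \<xi>)) = 0" by (simp only: ad sprod0 tensor_space.scale_zero_right)
      qed
    qed auto
    also have "\<dots> = sprod (replicate (Suc n) \<xi>)" by (simp add: bern_0)
    also have "\<dots> = tens scl (replicate (Suc n) \<xi>)"
      using symmetrize_symtensor[OF power_in_symtensors[of scl "Suc n" \<xi>]] by (simp only: symmetrize_tens)
    finally show ?case .
  qed (simp add: N_tens)
  then have "S \<subseteq> {f. N f = f}"
    by (intro symtensors_subset_if_powers tensor_space.subspaceI) (auto simp: N_zero N_add N_scale)
  with assms show ?thesis by blast
qed

text \<open>The spanning half of Poincare-Birkhoff-Witt, with \<open>A\<close> = \<open>S\<close> +
  \<open>I\<close>. By induction on the length every reordering of a word changes it only by an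
  element of \<open>A\<close>; averaging over all reorderings compares the word with its
  symmetrization, which lies in \<open>S\<close>.\<close>

lemma tensors_mod_ideal:
  assumes "t \<in> T" obtains f where "f \<in> S" "t - f \<in> I"
proof -
  define A where "A = {t. \<exists>f\<in>S. t - f \<in> I}"
  have A: "tensor_space.subspace A"
  proof (rule tensor_space.subspaceI)
    show "0 \<in> A"
      using tensor_space.subspace_0[OF symtensors_subspace] tensor_space.subspace_0[OF env_ideal_subspace]
      by (auto simp: A_def intro!: bexI[of _ 0])
  next
    fix s t assume "s \<in> A" "t \<in> A"
    then obtain f g where fg: "f \<in> S" "g \<in> S" "s - f \<in> I" "t - g \<in> I" by (auto simp: A_def)
    have "s + t - (f + g) = (s - f) + (t - g)" by simp
    also have "\<dots> \<in> I" by (intro tensor_space.subspace_add[OF env_ideal_subspace] fg)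
    finally show "s + t \<in> A"
      unfolding A_def using tensor_space.subspace_add[OF symtensors_subspace fg(1,2)] by blast
  next
    fix c t assume "t \<in> A"
    then obtain f where f: "f \<in> S" "t - f \<in> I" by (auto simp: A_def)
    have "tscale c t - tscale c f = tscale c (t - f)" by (simp add: tensor_space.scale_right_diff_distrib)
    also have "\<dots> \<in> I" by (intro tensor_space.subspace_scale[OF env_ideal_subspace] f)
    finally show "tscale c t \<in> A"
      unfolding A_def using tensor_space.subspace_scale[OF symtensors_subspace f(1)] by blast
  qed
  have IA: "I \<subseteq> A"
    using tensor_space.subspace_0[OF symtensors_subspace] by (auto simp: A_def intro!: bexI[of _ 0])
  have SA: "S \<subseteq> A"
  proof
    fix f assume "f \<in> S"
    then show "f \<in> A"
      using tensor_space.subspace_0[OF env_ideal_subspace[of scl br]] by (auto simp: A_def intro: bexI[of _ f])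
  qed
  have trans: "r - t \<in> A" if "r - s \<in> A" "s - t \<in> A" for r s t
    using tensor_space.subspace_add[OF A that] by simp
  have tens: "tens scl xs \<in> A" for xs
  proof (induction "length xs" arbitrary: xs rule: less_induct)
    case less
    \<comment> \<open>Modulo \<open>I\<close>, exchanging two neighbours costs a tensor with one
      letter less, which is in \<open>A\<close> by the induction hypothesis.\<close>
    have swap: "tens scl (as @ x # y # bs) - tens scl (as @ y # x # bs) \<in> A"
      if "length (as @ x # y # bs) = length xs" for as x y bs
    proof -
      have "tmult scl (tens scl as)
          (tmult scl (tens scl [x, y] - tens scl [y, x] - tens scl [br x y]) (tens scl bs)) \<in> I"
        by (intro env_ideal_tmult env_ideal_generator tens_in_tensors)
      also have "tmult scl (tens scl [x, y] - tens scl [y, x] - tens scl [br x y]) (tens scl bs) =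
          tens scl (x # y # bs) + (tscale (-1) (tens scl (y # x # bs)) + tscale (-1) (tens scl (br x y # bs)))"
        using tmult_add_left[of scl "tens scl [x, y]" "tscale (-1) (tens scl [y, x]) + tscale (-1) (tens scl [br x y])" "tens scl bs"]
          tmult_add_left[of scl "tscale (-1) (tens scl [y, x])" "tscale (-1) (tens scl [br x y])" "tens scl bs"]
          tmult_scale_left[of scl "-1" "tens scl [y, x]" "tens scl bs"] tmult_scale_left[of scl "-1" "tens scl [br x y]" "tens scl bs"]
        by (simp add: tmult_tens algebra_simps)
      also have "tmult scl (tens scl as) \<dots> = tens scl (as @ x # y # bs) +
          (tscale (-1) (tens scl (as @ y # x # bs)) + tscale (-1) (tens scl (as @ br x y # bs)))"
        by (simp only: tmult_add_right tmult_scale_right tmult_tens tens_in_tensors tensors_scale tensors_add)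
      finally have "(tens scl (as @ x # y # bs) - tens scl (as @ y # x # bs)) - tens scl (as @ br x y # bs) \<in> I"
        by (simp only: tensor_space.scale_minus_left tensor_space.scale_one diff_conv_add_uminus add.assoc)
      moreover have "tens scl (as @ br x y # bs) \<in> A" using that by (intro less) simp
      ultimately have "(tens scl (as @ x # y # bs) - tens scl (as @ y # x # bs)) - tens scl (as @ br x y # bs)
          + tens scl (as @ br x y # bs) \<in> A"
        using IA by (intro tensor_space.subspace_add[OF A]) auto
      then show ?thesis by simp
    qed
    have move: "tens scl (ps @ as @ x # bs) - tens scl (ps @ x # as @ bs) \<in> A"
      if "length (ps @ as @ x # bs) = length xs" for ps as x bs
      using that
    proof (induction as arbitrary: ps)
      case Nil
      then show ?case using tensor_space.subspace_0[OF A] by simp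
    next
      case (Cons a as)
      have "tens scl ((ps @ [a]) @ as @ x # bs) - tens scl ((ps @ [a]) @ x # as @ bs) \<in> A"
        using Cons.prems by (intro Cons.IH) simp
      then have "tens scl (ps @ a # as @ x # bs) - tens scl (ps @ a # x # as @ bs) \<in> A"
        by (simp only: append_assoc append_Cons append_Nil)
      moreover have "tens scl (ps @ a # x # as @ bs) - tens scl (ps @ x # a # as @ bs) \<in> A"
        using Cons.prems by (intro swap) simp
      ultimately show ?case unfolding append_Cons by (rule trans)
    qed
    \<comment> \<open>The prefix \<open>ps\<close> is arbitrary so that a letter already in place
      can be moved into it before the induction continues with the rest.\<close>
    have perm: "tens scl (ps @ us) - tens scl (ps @ vs) \<in> A"
      if "length (ps @ us) = length xs" "mset us = mset vs" for ps us vs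
      using that
    proof (induction us arbitrary: ps vs)
      case Nil
      then show ?case using tensor_space.subspace_0[OF A] by simp
    next
      case (Cons u us)
      then have "u \<in> set vs" by (metis list.set_intros(1) set_mset_mset)
      then obtain as bs where vs: "vs = as @ u # bs" by (meson split_list)
      have us: "mset us = mset (as @ bs)" using Cons.prems(2) by (simp add: vs)
      have "tens scl ((ps @ [u]) @ us) - tens scl ((ps @ [u]) @ (as @ bs)) \<in> A"
        using Cons.prems us by (intro Cons.IH) simp_all
      then have "tens scl (ps @ u # us) - tens scl (ps @ u # as @ bs) \<in> A"
        by (simp only: append_assoc append_Cons append_Nil)
      moreover have "tens scl (ps @ as @ u # bs) - tens scl (ps @ u # as @ bs) \<in> A"
        using Cons.prems(1) mset_eq_length[OF us] by (intro move) simp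
      then have "tscale (-1) (tens scl (ps @ as @ u # bs) - tens scl (ps @ u # as @ bs)) \<in> A"
        by (rule tensor_space.subspace_scale[OF A])
      then have "tens scl (ps @ u # as @ bs) - tens scl (ps @ as @ u # bs) \<in> A" by simp
      ultimately show ?case unfolding vs by (rule trans)
    qed
    have "tscale (1 / fact (length xs)) (\<Sum>\<sigma> | \<sigma> permutes {..<length xs}. tens scl xs - tens scl (permute_list \<sigma> xs)) \<in> A"
    proof (intro tensor_space.subspace_scale[OF A] tensor_space.subspace_sum[OF A])
      fix \<sigma> assume "\<sigma> \<in> {\<sigma>. \<sigma> permutes {..<length xs}}"
      then show "tens scl xs - tens scl (permute_list \<sigma> xs) \<in> A"
        using perm[of "[]" xs "permute_list \<sigma> xs"] by simp
    qed
    also have "tscale (1 / fact (length xs)) (\<Sum>\<sigma> | \<sigma> permutes {..<length xs}. tens scl xs - tens scl (permute_list \<sigma> xs)) =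
        tens scl xs - sprod xs"
      using tensor_space.sum_constant_scale[of "tens scl xs" "{\<sigma>. \<sigma> permutes {..<length xs}}"]
      by (simp add: symprod_def sum_subtractf tensor_space.scale_right_diff_distrib
          card_permutations[OF refl] del: sum_constant)
    finally have d: "tens scl xs - sprod xs \<in> A" .
    from tensor_space.subspace_add[OF A d subsetD[OF SA symprod_in_symtensors[of scl xs]]] show ?case
      by (simp only: diff_add_cancel)
  qed
  have "t \<in> A"
    using assms
    by (induction t rule: tensors_induct)
      (simp_all add: tens tensor_space.subspace_0[OF A] tensor_space.subspace_add[OF A] tensor_space.subspace_scale[OF A])
  then show ?thesis using that by (auto simp: A_def)
qed

text \<open>Let f be a symmetric representative of the class of t. As \<open>N\<close> kills t - f
  and fixes f, this f is \<open>N t\<close>.\<close>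

lemma N_congruent:
  assumes "t \<in> T" shows "t - N t \<in> I"
proof -
  obtain f where f: "f \<in> S" "t - f \<in> I" using assms by (rule tensors_mod_ideal)
  then have "N (t - f) = 0" by (intro N_ideal)
  then have "N t = f" using N_symtensor[OF f(1)] by (simp add: N_diff)
  with f show ?thesis by simp
qed

text \<open>Injectivity is the independence half of Poincare-Birkhoff-Witt: a symmetric tensor in
  the ideal is fixed by \<open>N\<close> and killed by \<open>N\<close>.\<close>

lemma inv_quantization:
  assumes "t \<in> T" shows "inv_into S (quantization scl br) (env_class scl br t) = N t"
proof (rule inv_into_f_eq)
  show "inj_on (quantization scl br) S"
  proof (rule inj_onI)
    fix f g assume fg: "f \<in> S" "g \<in> S" "quantization scl br f = quantization scl br g"
    then have "N (f - g) = 0" by (intro N_ideal) (simp add: quantization_def env_class_eq_iff)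
    with fg show "f = g" by (simp add: N_diff N_symtensor)
  qed
  show "N t \<in> S" using assms by (rule N_in_symtensors)
  have "tscale (-1) (t - N t) \<in> I"
    by (intro tensor_space.subspace_scale[OF env_ideal_subspace] N_congruent assms)
  then show "quantization scl br (N t) = env_class scl br t"
    by (simp add: quantization_def env_class_eq_iff)
qed

lemma gutt_C_hom_eq:
  assumes "f \<in> S" "g \<in> S"
  shows "gutt_C_hom scl br n k l f g = (if n \<le> k + l then tproj scl (k + l - n) (N (tmult scl f g)) else 0)"
  using assms
  by (simp add: gutt_C_hom_def quantization_def[of scl br f] quantization_def[of scl br g] env_class_mult
      symtensors_in_tensors tmult_in_tensors inv_quantization)

text \<open>Normal ordering one factor changes the product by an element of the two-sided ideal,
  which the outer \<open>N\<close> kills. Associativity of the star product thus comes from that of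
  the tensor product.\<close>

lemma N_tmult_N:
  assumes "s \<in> T" "t \<in> T"
  shows "N (tmult scl (N s) t) = N (tmult scl s t)" "N (tmult scl s (N t)) = N (tmult scl s t)"
proof -
  have neg: "tmult scl (- u) t = - tmult scl u t" for u
    using tmult_scale_left[of scl "-1" u t] by simp
  have "tmult scl (s - N s) t = tmult scl s t - tmult scl (N s) t"
    using tmult_add_left[of scl s "- N s" t] by (simp add: neg)
  moreover have "tmult scl (s - N s) t \<in> I"
    by (intro env_ideal_tmult N_congruent assms)
  ultimately show "N (tmult scl (N s) t) = N (tmult scl s t)"
    using N_ideal by (fastforce simp: N_diff)
  have Nt: "N t \<in> T" by (rule symtensors_in_tensors[OF N_in_symtensors[OF assms(2)]])
  have "tmult scl s (t - N t) = tmult scl s t - tmult scl s (N t)"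
    using tmult_add_right[OF assms(1) tensors_diff[OF assms(2) Nt] Nt] by (simp add: algebra_simps)
  moreover have "tmult scl s (t - N t) \<in> I"
    by (intro env_ideal_tmult N_congruent assms)
  ultimately show "N (tmult scl s (N t)) = N (tmult scl s t)"
    using N_ideal by (fastforce simp: N_diff)
qed

lemma N_assoc:
  assumes "f \<in> T" "g \<in> T" "h \<in> T"
  shows "N (tmult scl (N (tmult scl f g)) h) = N (tmult scl f (N (tmult scl g h)))"
  using assms by (simp add: N_tmult_N tmult_in_tensors tmult_assoc)

end

section \<open>Homogeneous components of the star product\<close>

lemma tproj_symprod: "tproj scl n (symprod scl xs) = (if n = length xs then symprod scl xs else 0)"
  by (simp add: symprod_def tproj_scale tproj_sum tproj_tens)

lemma tproj_in_tensors: "t \<in> tensors scl \<Longrightarrow> tproj scl n t \<in> tensors scl"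
  by (induction t rule: tensors_induct) (simp_all add: tproj_add tproj_scale tproj_tens tensors_add tensors_scale)

lemma tproj_in_symtensors:
  fixes scl :: "'k::field_char_0 \<Rightarrow> 'a::ab_group_add \<Rightarrow> 'a"
  assumes "f \<in> symtensors scl" shows "tproj scl n f \<in> symtensors scl"
proof -
  have "symtensors scl \<subseteq> {f. tproj scl n f \<in> symtensors scl}"
    by (intro symtensors_subset_if_powers tensor_space.subspaceI)
      (auto simp: tproj_add tproj_scale tproj_tens power_in_symtensors symtensors_closed)
  with assms show ?thesis by blast
qed

lemma tproj_tmult:
  assumes "s \<in> tensors scl" "t \<in> tensors scl"
  shows "tproj scl (k + l) (tmult scl (tproj scl k s) (tproj scl l t)) = tmult scl (tproj scl k s) (tproj scl l t)"
proof -
  have *: "tproj scl (k + l) (tmult scl (tens scl xs) (tproj scl l t)) = tmult scl (tens scl xs) (tproj scl l t)"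
    if "length xs = k" for xs
    using assms(2)
  proof (induction t rule: tensors_induct)
    case zero
    then show ?case by (simp add: tmult_zero_right)
  next
    case (add s t)
    then show ?case by (simp add: tproj_add tmult_add_right tproj_in_tensors)
  next
    case (scale_tens c ys)
    then show ?case
      using that by (simp add: tproj_scale tmult_scale_right tproj_tens tmult_tens tmult_zero_right)
  qed
  show ?thesis
    using assms(1)
    by (induction s rule: tensors_induct)
      (simp_all add: tproj_add tmult_add_left tmult_scale_left tproj_scale tproj_tens *)
qed

lemma tmult_sum_left: "tmult scl (sum s A) t = (\<Sum>i\<in>A. tmult scl (s i) t)"
  by (induction A rule: infinite_finite_induct) (simp_all add: tmult_add_left)

lemma tmult_sum_right:
  assumes "s \<in> tensors scl" "\<And>i. i \<in> A \<Longrightarrow> t i \<in> tensors scl"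
  shows "tmult scl s (sum t A) = (\<Sum>i\<in>A. tmult scl s (t i))"
  using assms(2)
  by (induction A rule: infinite_finite_induct)
    (simp_all add: assms(1) tmult_add_right tmult_zero_right tensors_sum)

text \<open>The component of degree \<open>r\<close> receives the factor \<open>z ^ (m - r)\<close>,
  one \<open>z\<close> for each degree lost with respect to the reference degree \<open>m\<close>.
  Components above \<open>m\<close> would be dropped; hence the use together with the filtration
  \<open>tensors_le\<close>.\<close>

definition homogenize :: "('k::field \<Rightarrow> 'a::ab_group_add \<Rightarrow> 'a) \<Rightarrow> 'k \<Rightarrow> nat \<Rightarrow> ('a, 'k) tensor \<Rightarrow> ('a, 'k) tensor"
where
  "homogenize scl z m t = (\<Sum>n\<le>m. tscale (z ^ n) (tproj scl (m - n) t))"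

lemma homogenize_add: "homogenize scl z m (s + t) = homogenize scl z m s + homogenize scl z m t"
  and homogenize_scale: "homogenize scl z m (tscale c t) = tscale c (homogenize scl z m t)"
  and homogenize_zero: "homogenize scl z m 0 = 0"
  by (simp_all add: homogenize_def tproj_add tproj_scale tensor_space.scale_right_distrib sum.distrib
      tensor_space.scale_sum_right mult.commute)

lemma homogenize_sum: "homogenize scl z m (sum t A) = (\<Sum>i\<in>A. homogenize scl z m (t i))"
  by (induction A rule: infinite_finite_induct) (simp_all add: homogenize_add homogenize_zero)

lemma homogenize_homogeneous:
  assumes "\<And>k. tproj scl k t = (if k = r then t else 0)" "r \<le> m"
  shows "homogenize scl z m t = tscale (z ^ (m - r)) t"
proof -
  have "homogenize scl z m t = (\<Sum>n\<in>{m - r}. tscale (z ^ n) (tproj scl (m - n) t))"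
    unfolding homogenize_def using assms by (intro sum.mono_neutral_right) auto
  then show ?thesis using assms by simp
qed

definition tensors_le :: "('k::field \<Rightarrow> 'a::ab_group_add \<Rightarrow> 'a) \<Rightarrow> nat \<Rightarrow> ('a, 'k) tensor set" where
  "tensors_le scl m = tensor_space.span (tens scl ` {xs. length xs \<le> m})"

lemma tensors_le_subspace: "tensor_space.subspace (tensors_le scl m)"
  unfolding tensors_le_def by (rule tensor_space.subspace_span)

lemma tens_in_tensors_le: "length xs \<le> m \<Longrightarrow> tens scl xs \<in> tensors_le scl m"
  unfolding tensors_le_def by (intro tensor_space.span_base) simp

lemma tensors_le_subset_if_tens:
  assumes "tensor_space.subspace W" "\<And>xs. length xs \<le> m \<Longrightarrow> tens scl xs \<in> W"
  shows "tensors_le scl m \<subseteq> W"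
  unfolding tensors_le_def using assms by (intro tensor_space.span_minimal) auto

text \<open>
  For \<open>a n = z ^ n\<close> this yields the star product \<open>\<star>\<^sub>z\<close>, for \<open>a\<close> the indicator of \<open>n\<close> it yields \<open>C\<^sub>n\<close>, and
  for \<open>a n = (n choose m) * z\<^sub>0 ^ (n - m)\<close> the \<open>m\<close>-th Taylor coefficient of \<open>z \<mapsto> \<star>\<^sub>z\<close> at \<open>z\<^sub>0\<close>.
\<close>

definition graded_normal_order ::
  "('k::field_char_0 \<Rightarrow> 'a::ab_group_add \<Rightarrow> 'a) \<Rightarrow> ('a \<Rightarrow> 'a \<Rightarrow> 'a) \<Rightarrow> (nat \<Rightarrow> 'k) \<Rightarrow> ('a, 'k) tensor \<Rightarrow> ('a, 'k) tensor"
where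
  "graded_normal_order scl br a = tensor_lift scl (\<lambda>xs. \<Sum>n\<le>length xs.
    tscale (a n) (tproj scl (length xs - n) (normal_order scl br (tens scl xs))))"

context char_0_lie_algebra
begin

lemma scaled_lie_algebra: "char_0_lie_algebra scl (\<lambda>x y. scl z (br x y))"
proof
  show "scl z (br x (scl z (br y w))) + scl z (br y (scl z (br w x))) + scl z (br w (scl z (br x y))) = 0" for x y w
    using jacobi[of x y w] by (simp add: bracket_scale_right scale_right_distrib[symmetric])
qed (simp_all add: bracket_add_left bracket_add_right bracket_scale_left bracket_scale_right
    bracket_alternating scale_right_distrib mult.commute)

lemma M_tensors_le:
  assumes "t \<in> tensors_le scl m" shows "M x t \<in> tensors_le scl (Suc m)"
proof -
  note sub = tensors_le_subspace[of scl "Suc m"]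
  have sprod: "sprod ys \<in> tensors_le scl (Suc m)" if "length ys \<le> Suc m" for ys
    unfolding symprod_def using that
    by (intro tensor_space.subspace_scale[OF sub] tensor_space.subspace_sum[OF sub] tens_in_tensors_le) simp
  have "tensors_le scl m \<subseteq> {t. M x t \<in> tensors_le scl (Suc m)}"
  proof (rule tensors_le_subset_if_tens)
    fix xs :: "'a list" assume "length xs \<le> m"
    then have "left_term scl br x xs \<in> tensors_le scl (Suc m)"
      unfolding left_term_def
      by (intro tensor_space.subspace_scale[OF sub] tensor_space.subspace_sum[OF sub] sprod) auto
    then show "tens scl xs \<in> {t. M x t \<in> tensors_le scl (Suc m)}" by (simp add: M_tens)
  qed (rule tensor_space.subspaceI, auto simp: M_zero M_add M_scale tensor_space.subspace_0[OF sub]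
      tensor_space.subspace_add[OF sub] tensor_space.subspace_scale[OF sub])
  with assms show ?thesis by blast
qed

lemma N_tens_le: "N (tens scl xs) \<in> tensors_le scl (length xs)"
  unfolding N_tens by (induction xs) (simp_all add: M_tensors_le tens_in_tensors_le)

text \<open>A term with \<open>j\<close> brackets falls \<open>j\<close> degrees short of the full
  degree, and its scaled version carries exactly \<open>z ^ j\<close>; both sides count the same
  powers of \<open>z\<close>.\<close>

lemma left_mult_homogenize:
  assumes "t \<in> tensors_le scl m"
  shows "left_mult scl (\<lambda>x y. scl z (br x y)) x (homogenize scl z m t) = homogenize scl z (Suc m) (M x t)"
proof -
  interpret Z: char_0_lie_algebra scl "\<lambda>x y. scl z (br x y)" by (rule scaled_lie_algebra)
  have foldr_scaled: "foldr (\<lambda>x y. scl z (br x y)) ys x = scl (z ^ length ys) (foldr br ys x)" for ys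
    by (induction ys) (simp_all add: bracket_scale_right mult.commute)
  have "tensors_le scl m \<subseteq> {t. Z.M x (homogenize scl z m t) = homogenize scl z (Suc m) (M x t)}"
  proof (rule tensors_le_subset_if_tens)
    fix ys :: "'a list" assume l: "length ys \<le> m"
    let ?l = "length ys"
    have "Z.M x (homogenize scl z m (tens scl ys)) = tscale (z ^ (m - ?l)) (left_term scl (\<lambda>x y. scl z (br x y)) x ys)"
      using l by (subst homogenize_homogeneous[where r = ?l]) (auto simp: tproj_tens Z.M_scale Z.M_tens)
    also have "\<dots> = (\<Sum>j\<le>?l. tscale (bern j * fact ?l / fact (?l - j))
        (homogenize scl z (Suc m) (sprod (foldr br (take j ys) x # drop j ys))))"
      unfolding left_term_def tensor_space.scale_sum_right
    proof (rule sum.cong[OF refl])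
      fix j assume j: "j \<in> {..?l}"
      have "homogenize scl z (Suc m) (sprod (foldr br (take j ys) x # drop j ys)) =
          tscale (z ^ (Suc m - Suc (?l - j))) (sprod (foldr br (take j ys) x # drop j ys))"
        using l by (intro homogenize_homogeneous) (auto simp: tproj_symprod)
      also have "Suc m - Suc (?l - j) = (m - ?l) + j" using l j by auto
      finally show "tscale (z ^ (m - ?l)) (tscale (bern j * fact ?l / fact (?l - j))
          (sprod (foldr (\<lambda>x y. scl z (br x y)) (take j ys) x # drop j ys))) =
        tscale (bern j * fact ?l / fact (?l - j))
          (homogenize scl z (Suc m) (sprod (foldr br (take j ys) x # drop j ys)))"
        using j by (simp add: foldr_scaled sprod_scale min_def power_add mult_ac)
    qed
    also have "\<dots> = homogenize scl z (Suc m) (M x (tens scl ys))"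
      by (simp add: M_tens left_term_def homogenize_sum homogenize_scale)
    finally show "tens scl ys \<in> {t. Z.M x (homogenize scl z m t) = homogenize scl z (Suc m) (M x t)}"
      by simp
  qed (rule tensor_space.subspaceI, auto simp: M_zero M_add M_scale Z.M_zero Z.M_add Z.M_scale
      homogenize_zero homogenize_add homogenize_scale)
  with assms show ?thesis by blast
qed

text \<open>
  The star product with parameter \<open>z\<close> belongs to the bracket scaled by \<open>z\<close>; this gives associativity
  for all \<open>z\<close>, including \<open>z = 0\<close>, at once.
\<close>

lemma normal_order_scaled_tens:
  "normal_order scl (\<lambda>x y. scl z (br x y)) (tens scl xs) = homogenize scl z (length xs) (N (tens scl xs))"
proof -
  interpret Z: char_0_lie_algebra scl "\<lambda>x y. scl z (br x y)" by (rule scaled_lie_algebra)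
  show ?thesis
  proof (induction xs)
    case Nil
    show ?case
      by (simp add: Z.N_tens N_tens) (simp add: homogenize_def tproj_tens)
  next
    case (Cons x xs)
    have "Z.N (tens scl (x # xs)) = Z.M x (homogenize scl z (length xs) (N (tens scl xs)))"
      using Cons by (simp add: Z.N_tens)
    also have "\<dots> = homogenize scl z (Suc (length xs)) (M x (N (tens scl xs)))"
      by (rule left_mult_homogenize[OF N_tens_le])
    finally show ?case by (simp add: N_tens)
  qed
qed

abbreviation "G \<equiv> graded_normal_order scl br"

lemma multilinear_graded:
  "multilinear scl tscale (\<lambda>xs. \<Sum>n\<le>length xs. tscale (a n) (tproj scl (length xs - n) (N (tens scl xs))))"
  by (rule multilinearI)
    (simp_all add: multilinear_add[OF multilinear_tens] multilinear_scale[OF multilinear_tens] N_add N_scale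
      tproj_add tproj_scale tensor_space.scale_right_distrib sum.distrib tensor_space.scale_sum_right mult.commute)

lemma G_tens: "G a (tens scl xs) = (\<Sum>n\<le>length xs. tscale (a n) (tproj scl (length xs - n) (N (tens scl xs))))"
  unfolding graded_normal_order_def by (rule tensor_lift_tens[OF multilinear_graded])

lemma G_add: "G a (s + t) = G a s + G a t"
  and G_scale: "G a (tscale c t) = tscale c (G a t)"
  and G_zero: "G a 0 = 0"
  and G_sum: "G a (sum u A) = (\<Sum>i\<in>A. G a (u i))"
proof -
  interpret Vector_Spaces.linear tscale tscale "G a"
    unfolding graded_normal_order_def by (rule linear_tensor_lift[OF multilinear_graded])
  show "G a (s + t) = G a s + G a t" "G a (tscale c t) = tscale c (G a t)" "G a 0 = 0"
    "G a (sum u A) = (\<Sum>i\<in>A. G a (u i))"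
    by (rule add scale zero sum)+
qed

lemma G_in_symtensors:
  assumes "t \<in> T" shows "G a t \<in> S"
proof -
  have "G a (tens scl xs) \<in> S" for xs
    unfolding G_tens
    by (intro tensor_space.subspace_sum tensor_space.subspace_scale symtensors_subspace
        tproj_in_symtensors N_in_symtensors) simp
  with assms show ?thesis
    by (induction t rule: tensors_induct)
      (simp_all add: G_zero G_add G_scale symtensors_closed)
qed

lemma G_homogeneous:
  assumes "t \<in> T"
  shows "G a (tproj scl m t) = (\<Sum>n\<le>m. tscale (a n) (tproj scl (m - n) (N (tproj scl m t))))"
  using assms
proof (induction t rule: tensors_induct)
  case (scale_tens c xs)
  then show ?case
    by (simp add: tproj_scale tproj_tens G_scale G_tens G_zero N_scale N_zero tensor_space.scale_sum_right mult.commute)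
qed (simp_all add: G_zero G_add N_zero N_add tproj_add tensor_space.scale_right_distrib sum.distrib)

lemma G_sum_left:
  assumes "t \<in> T"
  shows "G (\<lambda>n. \<Sum>i\<in>A. c i * a i n) t = (\<Sum>i\<in>A. tscale (c i) (G (a i) t))"
  using assms
proof (induction t rule: tensors_induct)
  case (scale_tens d xs)
  have "G (\<lambda>n. \<Sum>i\<in>A. c i * a i n) (tens scl xs) = (\<Sum>i\<in>A. tscale (c i) (G (a i) (tens scl xs)))"
    unfolding G_tens tensor_space.scale_sum_left tensor_space.scale_sum_right tensor_space.scale_scale
    by (rule sum.swap)
  then show ?case by (simp add: G_scale tensor_space.scale_sum_right mult.commute)
qed (simp_all add: G_zero G_add tensor_space.scale_right_distrib sum.distrib)

text \<open>A tensor involves only words of bounded length, so only finitely many entries of the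
  coefficient sequence enter. This turns the sum defining \<open>gutt_star\<close> into a sum up to
  a fixed bound.\<close>

lemma G_local:
  assumes "t \<in> T"
  shows "\<exists>K. \<forall>a b. (\<forall>n\<le>K. a n = b n) \<longrightarrow> G a t = G b t"
  using assms
proof (induction t rule: tensors_induct)
  case (add s t)
  from add.IH(1) obtain K where K: "\<forall>a b. (\<forall>n\<le>K. a n = b n) \<longrightarrow> G a s = G b s" ..
  from add.IH(2) obtain L where L: "\<forall>a b. (\<forall>n\<le>L. a n = b n) \<longrightarrow> G a t = G b t" ..
  have "G a (s + t) = G b (s + t)" if "\<forall>n\<le>max K L. a n = b n" for a b
  proof -
    have "G a s = G b s" using K that by simp
    moreover have "G a t = G b t" using L that by simp
    ultimately show ?thesis by (simp only: G_add)
  qed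
  then have "\<forall>a b. (\<forall>n\<le>max K L. a n = b n) \<longrightarrow> G a (s + t) = G b (s + t)" by simp
  then show ?case by (rule exI[of _ "max K L"])
next
  case (scale_tens c xs)
  have "G a (tens scl xs) = G b (tens scl xs)" if "\<forall>n\<le>length xs. a n = b n" for a b
    unfolding G_tens using that by (intro sum.cong) auto
  then have "\<forall>a b. (\<forall>n\<le>length xs. a n = b n) \<longrightarrow> G a (tscale c (tens scl xs)) = G b (tscale c (tens scl xs))"
    by (simp add: G_scale)
  then show ?case by (rule exI[of _ "length xs"])
qed (simp add: G_zero)

text \<open>On components of degrees \<open>k\<close> and \<open>l\<close> the indicator of
  \<open>n\<close> selects the degree \<open>k + l - n\<close>, and nothing at all for
  \<open>n > k + l\<close>, in agreement with the case distinction in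
  \<open>gutt_C_hom\<close>.\<close>

lemma gutt_C_eq:
  assumes f: "f \<in> S" and g: "g \<in> S"
  shows "gutt_C scl br n f g = G (\<lambda>i. if i = n then 1 else 0) (tmult scl f g)"
proof -
  let ?\<delta> = "\<lambda>i. if i = n then 1 else 0 :: 'k"
  note fT = symtensors_in_tensors[OF f] and gT = symtensors_in_tensors[OF g]
  note df = finite_degrees[OF fT] and dg = finite_degrees[OF gT]
  have hom: "gutt_C_hom scl br n k l (tproj scl k f) (tproj scl l g) =
      G ?\<delta> (tmult scl (tproj scl k f) (tproj scl l g))" for k l
  proof -
    let ?t = "tmult scl (tproj scl k f) (tproj scl l g)"
    have "?t \<in> T" using fT gT by (intro tmult_in_tensors tproj_in_tensors)
    moreover have "tproj scl (k + l) ?t = ?t" using fT gT by (rule tproj_tmult)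
    ultimately have "G ?\<delta> ?t = (\<Sum>i\<le>k + l. tscale (?\<delta> i) (tproj scl (k + l - i) (N ?t)))"
      using G_homogeneous[of ?t ?\<delta> "k + l"] by simp
    also have "\<dots> = (if n \<le> k + l then tproj scl (k + l - n) (N ?t) else 0)"
      by (simp add: if_distrib[of "\<lambda>c. tscale c _"] cong: if_cong)
    finally show ?thesis
      using f g by (simp add: gutt_C_hom_eq tproj_in_symtensors)
  qed
  have "tmult scl f g = (\<Sum>k | tproj scl k f \<noteq> 0. \<Sum>l | tproj scl l g \<noteq> 0.
      tmult scl (tproj scl k f) (tproj scl l g))"
  proof -
    have "tmult scl f g = tmult scl (\<Sum>k | tproj scl k f \<noteq> 0. tproj scl k f) (\<Sum>l | tproj scl l g \<noteq> 0. tproj scl l g)"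
      using tensors_decompose[OF fT df] tensors_decompose[OF gT dg] by simp
    then show ?thesis
      by (simp add: tmult_sum_left tmult_sum_right tproj_in_tensors fT gT)
  qed
  then show ?thesis
    unfolding gutt_C_def hom by (simp add: G_sum)
qed

lemma gutt_star_eq:
  assumes f: "f \<in> S" and g: "g \<in> S"
  shows "gutt_star scl br z f g = G (\<lambda>n. z ^ n) (tmult scl f g)"
proof -
  let ?\<delta> = "\<lambda>n i. if i = n then 1 else 0 :: 'k"
  have t: "tmult scl f g \<in> T" using f g by (intro tmult_in_tensors symtensors_in_tensors)
  obtain K where K: "\<And>a b. (\<forall>n\<le>K. a n = b n) \<Longrightarrow> G a (tmult scl f g) = G b (tmult scl f g)"
    using G_local[OF t] by blast
  \<comment> \<open>Up to \<open>K\<close> the indicator of \<open>n\<close> agrees with the zero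
    sequence. The latter is written as an empty sum so that \<open>G_sum_left\<close> evaluates it
    to 0.\<close>
  have large: "gutt_C scl br n f g = 0" if "n > K" for n
    using K[of "?\<delta> n" "\<lambda>i. \<Sum>j\<in>{}. 0 * 0"] G_sum_left[OF t, of "\<lambda>_. 0" "\<lambda>_ _. 0" "{}"] that
    by (simp add: gutt_C_eq[OF f g])
  have "gutt_star scl br z f g = (\<Sum>n\<le>K. tscale (z ^ n) (gutt_C scl br n f g))"
    unfolding gutt_star_def using large by (intro sum.mono_neutral_left) (auto simp: not_less[symmetric])
  also have "\<dots> = G (\<lambda>i. \<Sum>n\<le>K. z ^ n * ?\<delta> n i) (tmult scl f g)"
    by (simp only: gutt_C_eq[OF f g] G_sum_left[OF t])
  also have "\<dots> = G (\<lambda>n. z ^ n) (tmult scl f g)"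
    by (intro K) (simp add: mult_delta_right)
  finally show ?thesis .
qed

lemma gutt_star_normal_order:
  assumes f: "f \<in> S" and g: "g \<in> S"
  shows "gutt_star scl br z f g = normal_order scl (\<lambda>x y. scl z (br x y)) (tmult scl f g)"
proof -
  interpret Z: char_0_lie_algebra scl "\<lambda>x y. scl z (br x y)" by (rule scaled_lie_algebra)
  have "G (\<lambda>n. z ^ n) t = Z.N t" if "t \<in> T" for t
    using that
    by (induction t rule: tensors_induct)
      (simp_all add: G_zero G_add G_scale Z.N_zero Z.N_add Z.N_scale G_tens normal_order_scaled_tens homogenize_def)
  then show ?thesis
    using f g by (simp add: gutt_star_eq tmult_in_tensors symtensors_in_tensors)
qed

lemma gutt_star_assoc:
  assumes f: "f \<in> S" and g: "g \<in> S" and h: "h \<in> S"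
  shows "gutt_star scl br z (gutt_star scl br z f g) h = gutt_star scl br z f (gutt_star scl br z g h)"
proof -
  interpret Z: char_0_lie_algebra scl "\<lambda>x y. scl z (br x y)" by (rule scaled_lie_algebra)
  show ?thesis
    using assms
    by (simp add: gutt_star_normal_order Z.N_in_symtensors tmult_in_tensors symtensors_in_tensors Z.N_assoc)
qed

text \<open>For the zero bracket only the term \<open>j = 0\<close> of the Bernoulli formula
  survives. Left multiplication is then the symmetric product with a letter, and normal ordering is
  symmetrization.\<close>

lemma gutt_star_0:
  assumes f: "f \<in> S" and g: "g \<in> S"
  shows "gutt_star scl br 0 f g = symmult scl f g"
proof -
  define br0 where "br0 = (\<lambda>x y. scl 0 (br x y))"
  interpret Z: char_0_lie_algebra scl br0 unfolding br0_def by (rule scaled_lie_algebra)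
  have br0: "br0 x y = 0" for x y by (simp add: br0_def)
  have sprod0: "sprod (0 # zs) = 0" for zs using sprod_scale[of 0 0 zs] by simp
  have M0: "Z.M x (tens scl ys) = sprod (x # ys)" for x ys
  proof -
    have "foldr br0 (take j ys) x = 0" if "j \<le> length ys" "j \<noteq> 0" for j
      using that by (cases ys; cases j) (simp_all add: br0)
    then have "left_term scl br0 x ys = (\<Sum>j\<in>{0}.
        tscale (bern j * fact (length ys) / fact (length ys - j))
          (sprod (foldr br0 (take j ys) x # drop j ys)))"
      unfolding left_term_def by (intro sum.mono_neutral_right) (auto simp: sprod0)
    then show ?thesis by (simp add: Z.M_tens bern_0)
  qed
  have "Z.M x (sprod ys) = sprod (x # ys)" for x ys
  proof -
    have "Z.M x (sprod ys) = tscale (1 / fact (length ys)) (\<Sum>\<sigma> | \<sigma> permutes {..<length ys}. sprod (x # permute_list \<sigma> ys))"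
      unfolding symprod_def[of _ ys] by (simp add: Z.M_scale Z.M_sum M0)
    also have "\<dots> = tscale (1 / fact (length ys)) (\<Sum>\<sigma> | \<sigma> permutes {..<length ys}. sprod (x # ys))"
      by (intro arg_cong[where f = "tscale _"] sum.cong refl symprod_permute) simp
    also have "\<dots> = sprod (x # ys)"
      using tensor_space.sum_constant_scale[of "sprod (x # ys)" "{\<sigma>. \<sigma> permutes {..<length ys}}"]
      by (simp add: card_permutations[OF refl] del: sum_constant)
    finally show ?thesis .
  qed
  moreover have "sprod [] = tens scl []"
    using symmetrize_symtensor[OF one_in_symtensors] by (simp add: symmetrize_tens)
  ultimately have N0: "Z.N (tens scl xs) = sprod xs" for xs
    unfolding Z.N_tens by (induction xs) simp_all
  have "Z.N t = symmetrize scl t" if "t \<in> T" for t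
    using that
    by (induction t rule: tensors_induct)
      (simp_all add: N0 Z.N_zero Z.N_add Z.N_scale symmetrize_add symmetrize_scale symmetrize_tens symmetrize_def[of scl 0])
  then show ?thesis
    using f g gutt_star_normal_order[OF f g, of 0, folded br0_def]
    by (simp add: symmult_def tmult_in_tensors symtensors_in_tensors)
qed

end

section \<open>Estimates\<close>

text \<open>
  \<open>tensor_bound scl W \<omega> t b\<close>: some representation of \<open>t\<close> by elementary tensors from \<open>W\<close> has total
  \<open>\<omega>\<close>-weight at most \<open>b\<close>. With \<open>\<omega> = tensor_weight R p\<close> the infimum of these \<open>b\<close> is \<open>p\<^sub>R t\<close>.
\<close>

inductive tensor_bound ::
  "('k::real_normed_field \<Rightarrow> 'a::ab_group_add \<Rightarrow> 'a) \<Rightarrow> 'a list set \<Rightarrow> ('a list \<Rightarrow> real)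
    \<Rightarrow> ('a, 'k) tensor \<Rightarrow> real \<Rightarrow> bool"
  for scl W \<omega>
where
  tensor_bound_zero: "0 \<le> b \<Longrightarrow> tensor_bound scl W \<omega> 0 b"
| tensor_bound_step: "\<lbrakk>ws \<in> W; tensor_bound scl W \<omega> t b\<rbrakk> \<Longrightarrow>
    tensor_bound scl W \<omega> (tscale c (tens scl ws) + t) (norm c * \<omega> ws + b)"

text \<open>The slack is handed down to the base case, the only rule that leaves freedom in the
  bound.\<close>

lemma tensor_bound_mono:
  assumes "tensor_bound scl W \<omega> t b" "b \<le> b'" shows "tensor_bound scl W \<omega> t b'"
  using assms
proof (induction arbitrary: b' rule: tensor_bound.induct)
  case (tensor_bound_zero b)
  then show ?case by (intro tensor_bound.intros) simp
next
  case (tensor_bound_step ws t b c)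
  then have "tensor_bound scl W \<omega> (tscale c (tens scl ws) + t) (norm c * \<omega> ws + (b' - norm c * \<omega> ws))"
    by (intro tensor_bound.tensor_bound_step) auto
  then show ?case by simp
qed

lemma tensor_bound_add:
  assumes "tensor_bound scl W \<omega> s a" "tensor_bound scl W \<omega> t b"
  shows "tensor_bound scl W \<omega> (s + t) (a + b)"
  using assms
proof (induction rule: tensor_bound.induct)
  case (tensor_bound_zero a)
  then show ?case by (auto elim: tensor_bound_mono)
next
  case (tensor_bound_step ws u a c)
  then show ?case by (simp only: add.assoc tensor_bound.tensor_bound_step)
qed

lemma tensor_bound_scale:
  "tensor_bound scl W \<omega> t b \<Longrightarrow> tensor_bound scl W \<omega> (tscale c t) (norm c * b)"
proof (induction rule: tensor_bound.induct)
  case (tensor_bound_zero b)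
  then show ?case by (simp add: tensor_bound.tensor_bound_zero)
next
  case (tensor_bound_step ws t b d)
  then have "tensor_bound scl W \<omega> (tscale (c * d) (tens scl ws) + tscale c t) (norm (c * d) * \<omega> ws + norm c * b)"
    by (intro tensor_bound.tensor_bound_step)
  then show ?case by (simp add: tensor_space.scale_right_distrib norm_mult distrib_left mult.assoc)
qed

lemma tensor_bound_tens: "ws \<in> W \<Longrightarrow> tensor_bound scl W \<omega> (tens scl ws) (\<omega> ws)"
  using tensor_bound_step[of ws W scl \<omega> 0 0 1] by (simp add: tensor_bound_zero)

lemma tensor_bound_sum:
  "(\<And>i. i \<in> A \<Longrightarrow> tensor_bound scl W \<omega> (t i) (b i)) \<Longrightarrow> tensor_bound scl W \<omega> (sum t A) (sum b A)"
  by (induction A rule: infinite_finite_induct) (simp_all add: tensor_bound_zero tensor_bound_add)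

text \<open>A linear map is bounded as soon as it is bounded on elementary tensors; every estimate
  below is reduced to words in this way.\<close>

lemma tensor_bound_map:
  assumes "tensor_bound scl W \<omega> t b" and C: "0 \<le> C"
    and add: "\<And>s t. F (s + t) = F s + F t" and scale: "\<And>c t. F (tscale c t) = tscale c (F t)"
    and tens: "\<And>ws. ws \<in> W \<Longrightarrow> tensor_bound scl W' \<omega>' (F (tens scl ws)) (C * \<omega> ws)"
  shows "tensor_bound scl W' \<omega>' (F t) (C * b)"
  using assms(1)
proof (induction rule: tensor_bound.induct)
  case (tensor_bound_zero b)
  then show ?case
    using scale[of 0 0] C by (simp add: tensor_bound.tensor_bound_zero)
next
  case (tensor_bound_step ws t b c)
  then have "tensor_bound scl W' \<omega>' (tscale c (F (tens scl ws)) + F t) (norm c * (C * \<omega> ws) + C * b)"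
    by (intro tensor_bound_add tensor_bound_scale tens)
  then show ?case by (simp add: add scale algebra_simps)
qed

lemma tensor_bound_weight:
  assumes "tensor_bound scl W \<omega> t b" "0 \<le> C" "W \<subseteq> W'" "\<And>ws. ws \<in> W \<Longrightarrow> \<omega>' ws \<le> C * \<omega> ws"
  shows "tensor_bound scl W' \<omega>' t (C * b)"
  using assms(1,2)
  by (rule tensor_bound_map[where F = "\<lambda>t. t"])
    (use assms(3,4) in \<open>auto intro: tensor_bound_mono[OF tensor_bound_tens]\<close>)

lemma tensor_bound_in_tensors: "tensor_bound scl W \<omega> t b \<Longrightarrow> t \<in> tensors scl"
  by (induction rule: tensor_bound.induct) (simp_all add: tensors_add tensors_scale)

lemma tensor_bound_exists:
  assumes "t \<in> tensors scl" shows "\<exists>b. tensor_bound scl UNIV \<omega> t b"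
  using assms
proof (induction t rule: tensors_induct)
  case zero
  then show ?case using tensor_bound_zero[of 0] by blast
next
  case (add s t)
  then show ?case using tensor_bound_add by blast
next
  case (scale_tens c xs)
  then show ?case using tensor_bound_scale[OF tensor_bound_tens] by blast
qed

lemma tensor_bound_tproj:
  assumes "tensor_bound scl W \<omega> t b" and \<omega>: "\<And>ws. ws \<in> W \<Longrightarrow> 0 \<le> \<omega> ws"
  shows "tensor_bound scl {ws \<in> W. length ws = n} \<omega> (tproj scl n t) b"
proof -
  have "tensor_bound scl {ws \<in> W. length ws = n} \<omega> (tproj scl n (tens scl ws)) (1 * \<omega> ws)" if "ws \<in> W" for ws
    using that \<omega>[OF that] tensor_bound_tens[of ws "{ws \<in> W. length ws = n}" scl \<omega>]
    by (simp add: tproj_tens tensor_bound_zero)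
  then have "tensor_bound scl {ws \<in> W. length ws = n} \<omega> (tproj scl n t) (1 * b)"
    by (intro tensor_bound_map[OF assms(1)]) (simp_all add: tproj_add tproj_scale)
  then show ?thesis by simp
qed

lemma tensor_bound_list:
  assumes "tensor_bound scl W \<omega> t b"
  shows "\<exists>L. (\<forall>(c, xs)\<in>set L. xs \<in> W) \<and> t = (\<Sum>(c, xs)\<leftarrow>L. tscale c (tens scl xs)) \<and>
    (\<Sum>(c, xs)\<leftarrow>L. norm c * \<omega> xs) \<le> b"
  using assms
proof (induction rule: tensor_bound.induct)
  case (tensor_bound_zero b)
  then show ?case by (intro exI[of _ "[]"]) simp
next
  case (tensor_bound_step ws t b c)
  then obtain L where "\<forall>(c, xs)\<in>set L. xs \<in> W" "t = (\<Sum>(c, xs)\<leftarrow>L. tscale c (tens scl xs))"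
    "(\<Sum>(c, xs)\<leftarrow>L. norm c * \<omega> xs) \<le> b" by blast
  with tensor_bound_step.hyps show ?case by (intro exI[of _ "(c, ws) # L"]) simp
qed

lemma list_tensor_bound:
  assumes "\<forall>(c, xs)\<in>set L. xs \<in> W"
  shows "tensor_bound scl W \<omega> (\<Sum>(c, xs)\<leftarrow>L. tscale c (tens scl xs)) (\<Sum>(c, xs)\<leftarrow>L. norm c * \<omega> xs)"
  using assms
  by (induction L) (auto intro: tensor_bound.intros)

section \<open>The seminorms of the symmetric algebra in terms of explicit representations\<close>

definition tensor_weight :: "real \<Rightarrow> ('a \<Rightarrow> real) \<Rightarrow> 'a list \<Rightarrow> real" where
  "tensor_weight R p xs = fact (length xs) powr R * prod_list (map p xs)"

lemma prod_list_nonneg: "(\<And>x. 0 \<le> p x) \<Longrightarrow> (0::real) \<le> prod_list (map p xs)"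
  by (induction xs) simp_all

lemma prod_list_map_mono:
  "(\<And>x. 0 \<le> p x) \<Longrightarrow> (\<And>x. p x \<le> (q x :: real)) \<Longrightarrow> prod_list (map p xs) \<le> prod_list (map q xs)"
  by (induction xs) (auto intro!: mult_mono prod_list_nonneg intro: order_trans)

lemma prod_list_map_scaled: "prod_list (map (\<lambda>x. c * p x) xs) = c ^ length xs * prod_list (map p xs :: real list)"
  by (induction xs) simp_all

lemma tensor_weight_nonneg: "(\<And>x. 0 \<le> p x) \<Longrightarrow> 0 \<le> tensor_weight R p xs"
  by (simp add: tensor_weight_def prod_list_nonneg)

lemma tensor_weight_scaled: "tensor_weight R (\<lambda>x. c * p x) xs = c ^ length xs * tensor_weight R p xs"
  by (simp add: tensor_weight_def prod_list_map_scaled)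

text \<open>The binomial coefficient of \<open>k + l\<close> over \<open>k\<close> is at most
  \<open>2 ^ (k + l)\<close>. Its \<open>R\<close>-th power amounts to a factor
  \<open>2 powr R\<close> for each letter, which is moved into the seminorm.\<close>

lemma tensor_weight_append_le:
  assumes p: "\<And>x. 0 \<le> p x" and R: "0 \<le> R"
  shows "tensor_weight R p (xs @ ys) \<le>
    tensor_weight R (\<lambda>x. 2 powr R * p x) xs * tensor_weight R (\<lambda>x. 2 powr R * p x) ys"
proof -
  let ?k = "length xs" and ?l = "length ys"
  have "(?k + ?l) choose ?k \<le> 2 ^ (?k + ?l)" by (rule binomial_le_pow2)
  then have "real (((?k + ?l) choose ?k) * (fact ?k * fact ?l)) \<le> real (2 ^ (?k + ?l) * (fact ?k * fact ?l))"
    by (simp only: of_nat_le_iff) (rule mult_right_mono, simp_all)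
  moreover have "((?k + ?l) choose ?k) * (fact ?k * fact ?l) = (fact (?k + ?l) :: nat)"
    using binomial_fact_lemma[of ?k "?k + ?l"] by (simp add: mult_ac)
  ultimately have "(fact (?k + ?l) :: real) \<le> 2 ^ (?k + ?l) * (fact ?k * fact ?l)"
    by (simp only: of_nat_fact of_nat_mult of_nat_power of_nat_numeral)
  then have "fact (?k + ?l) powr R \<le> (2 ^ (?k + ?l) * (fact ?k * fact ?l)) powr R"
    using R by (intro powr_mono2) simp_all
  also have "\<dots> = (2 powr R) ^ ?k * (2 powr R) ^ ?l * (fact ?k powr R * fact ?l powr R)"
  proof -
    have "((2::real) ^ n) powr R = (2 powr R) ^ n" for n
      by (simp add: powr_powr mult.commute flip: powr_realpow)
    then show ?thesis by (simp add: powr_mult power_add)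
  qed
  finally have "fact (?k + ?l) powr R * (prod_list (map p xs) * prod_list (map p ys)) \<le>
      (2 powr R) ^ ?k * (2 powr R) ^ ?l * (fact ?k powr R * fact ?l powr R) * (prod_list (map p xs) * prod_list (map p ys))"
    by (intro mult_right_mono mult_nonneg_nonneg prod_list_nonneg p)
  then show ?thesis
    unfolding tensor_weight_def prod_list_map_scaled by (simp add: mult_ac)
qed

context
  fixes p :: "'a::ab_group_add \<Rightarrow> real" and scl :: "'k::real_normed_field \<Rightarrow> 'a \<Rightarrow> 'a" and R :: real
  assumes p: "\<And>x. 0 \<le> p x"
begin

abbreviation "prod_weight \<equiv> (\<lambda>xs. prod_list (map p xs))"

lemma bdd_below_representations:
  "bdd_below {(\<Sum>(c, xs)\<leftarrow>L. norm c * prod_list (map p xs)) | L.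
    (\<forall>(c, xs)\<in>set L. length xs = n) \<and> t = (\<Sum>(c, xs)\<leftarrow>L. tscale c (tens scl xs))}"
  by (rule bdd_belowI[of _ 0]) (auto intro!: sum_list_nonneg mult_nonneg_nonneg prod_list_nonneg p)

lemma proj_seminorm_le:
  assumes "tensor_bound scl {ws. length ws = n} prod_weight t b"
  shows "proj_seminorm scl p n t \<le> b"
proof -
  obtain L where L: "\<forall>(c, xs)\<in>set L. xs \<in> {ws. length ws = n}" "t = (\<Sum>(c, xs)\<leftarrow>L. tscale c (tens scl xs))"
    "(\<Sum>(c, xs)\<leftarrow>L. norm c * prod_weight xs) \<le> b"
    using tensor_bound_list[OF assms] by blast
  show ?thesis
    unfolding proj_seminorm_def
    by (rule cInf_lower2[OF _ L(3) bdd_below_representations]) (use L(1,2) in auto)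
qed

text \<open>The infimum of an empty set of reals says nothing, so lower bounds for
  \<open>proj_seminorm\<close> require a representation by words of length \<open>n\<close>;
  projecting any representation of \<open>t\<close> yields one.\<close>

lemma representations_nonempty:
  assumes "t \<in> tensors scl"
  shows "{(\<Sum>(c, xs)\<leftarrow>L. norm c * prod_list (map p xs)) | L.
    (\<forall>(c, xs)\<in>set L. length xs = n) \<and> tproj scl n t = (\<Sum>(c, xs)\<leftarrow>L. tscale c (tens scl xs))} \<noteq> {}"
proof -
  obtain b where "tensor_bound scl UNIV prod_weight t b" using tensor_bound_exists[OF assms] by blast
  then have "tensor_bound scl {ws \<in> UNIV. length ws = n} prod_weight (tproj scl n t) b"
    by (rule tensor_bound_tproj) (simp add: prod_list_nonneg p)
  from tensor_bound_list[OF this] show ?thesis by auto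
qed

lemma proj_seminorm_less:
  assumes "t \<in> tensors scl" "proj_seminorm scl p n (tproj scl n t) < b"
  shows "tensor_bound scl {ws. length ws = n} prod_weight (tproj scl n t) b"
proof -
  obtain L where L: "\<forall>(c, xs)\<in>set L. length xs = n" "tproj scl n t = (\<Sum>(c, xs)\<leftarrow>L. tscale c (tens scl xs))"
    "(\<Sum>(c, xs)\<leftarrow>L. norm c * prod_list (map p xs)) < b"
    using cInf_lessD[OF representations_nonempty[OF assms(1)] assms(2)[unfolded proj_seminorm_def]] by blast
  then show ?thesis
    using list_tensor_bound[of L "{ws. length ws = n}" scl prod_weight]
    by (auto intro: tensor_bound_mono)
qed

lemma proj_seminorm_nonneg:
  assumes "t \<in> tensors scl" shows "0 \<le> proj_seminorm scl p n (tproj scl n t)"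
  unfolding proj_seminorm_def
  by (rule cInf_greatest[OF representations_nonempty[OF assms]])
    (auto intro!: sum_list_nonneg mult_nonneg_nonneg prod_list_nonneg p)

lemma proj_seminorm_zero: "proj_seminorm scl p n 0 = 0"
  using proj_seminorm_le[OF tensor_bound_zero, of 0 n] proj_seminorm_nonneg[OF tensors_zero, of n] by simp

lemma proj_seminorm_add:
  assumes "s \<in> tensors scl" "t \<in> tensors scl"
  shows "proj_seminorm scl p n (tproj scl n (s + t)) \<le>
    proj_seminorm scl p n (tproj scl n s) + proj_seminorm scl p n (tproj scl n t)"
proof (rule field_le_epsilon)
  fix e :: real assume "0 < e"
  then have "tensor_bound scl {ws. length ws = n} prod_weight (tproj scl n s + tproj scl n t)
      (proj_seminorm scl p n (tproj scl n s) + e / 2 + (proj_seminorm scl p n (tproj scl n t) + e / 2))"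
    by (intro tensor_bound_add proj_seminorm_less assms) simp_all
  then show "proj_seminorm scl p n (tproj scl n (s + t)) \<le>
      proj_seminorm scl p n (tproj scl n s) + proj_seminorm scl p n (tproj scl n t) + e"
    unfolding tproj_add[symmetric] by (auto dest: proj_seminorm_le)
qed

lemma tensor_seminorm_eq:
  assumes "finite A" "{n. tproj scl n t \<noteq> 0} \<subseteq> A"
  shows "tensor_seminorm scl R p t = (\<Sum>n\<in>A. fact n powr R * proj_seminorm scl p n (tproj scl n t))"
proof -
  have "tproj scl n t = 0" if "n \<notin> A" for n using assms(2) that by blast
  then show ?thesis
    unfolding tensor_seminorm_def by (intro suminf_finite assms(1)) (simp add: proj_seminorm_zero)
qed

lemma tensor_seminorm_le:
  assumes "tensor_bound scl UNIV (tensor_weight R p) t b"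
  shows "tensor_seminorm scl R p t \<le> b"
  using assms
proof (induction rule: tensor_bound.induct)
  case (tensor_bound_zero b)
  then show ?case by (subst tensor_seminorm_eq[of "{}"]) auto
next
  case (tensor_bound_step ws t b c)
  have t: "t \<in> tensors scl" using tensor_bound_step.hyps(2) by (rule tensor_bound_in_tensors)
  let ?s = "tscale c (tens scl ws)" and ?l = "length ws"
  let ?A = "insert ?l {n. tproj scl n t \<noteq> 0}"
  have s: "?s \<in> tensors scl" by (simp add: tensors_scale)
  have A: "finite ?A" using finite_degrees[OF t] by simp
  have "tensor_seminorm scl R p (?s + t) =
      (\<Sum>n\<in>?A. fact n powr R * proj_seminorm scl p n (tproj scl n (?s + t)))"
    by (rule tensor_seminorm_eq[OF A]) (auto simp: tproj_add tproj_scale tproj_tens)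
  also have "\<dots> \<le> (\<Sum>n\<in>?A. fact n powr R * proj_seminorm scl p n (tproj scl n ?s)) +
      (\<Sum>n\<in>?A. fact n powr R * proj_seminorm scl p n (tproj scl n t))"
    unfolding sum.distrib[symmetric] distrib_left[symmetric]
    by (intro sum_mono mult_left_mono proj_seminorm_add s t) simp
  also have "(\<Sum>n\<in>?A. fact n powr R * proj_seminorm scl p n (tproj scl n t)) = tensor_seminorm scl R p t"
    by (rule tensor_seminorm_eq[OF A, symmetric]) auto
  also have "(\<Sum>n\<in>?A. fact n powr R * proj_seminorm scl p n (tproj scl n ?s)) =
      (\<Sum>n\<in>{?l}. fact n powr R * proj_seminorm scl p n (tproj scl n ?s))"
    using A by (intro sum.mono_neutral_right) (auto simp: tproj_scale tproj_tens proj_seminorm_zero)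
  also have "\<dots> \<le> fact ?l powr R * (norm c * prod_weight ws)"
    by (auto simp: tproj_scale tproj_tens intro!: mult_left_mono proj_seminorm_le tensor_bound_scale tensor_bound_tens)
  also have "\<dots> = norm c * tensor_weight R p ws" by (simp add: tensor_weight_def)
  finally show ?case using tensor_bound_step.IH by simp
qed

lemma tensor_seminorm_less:
  assumes t: "t \<in> tensors scl" and less: "tensor_seminorm scl R p t < b"
  shows "tensor_bound scl UNIV (tensor_weight R p) t b"
proof -
  define A where "A = {n. tproj scl n t \<noteq> 0}"
  have A: "finite A" unfolding A_def using t by (rule finite_degrees)
  define e where "e = b - tensor_seminorm scl R p t"
  \<comment> \<open>The slack \<open>e\<close> is shared among the finitely many degrees so that
    each receives \<open>e / (card A + 1)\<close> after weighting; the added 1 covers an empty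
    \<open>A\<close>.\<close>
  define d where "d n = e / (fact n powr R * (card A + 1))" for n
  have e: "0 < e" using less by (simp add: e_def)
  have "tensor_bound scl UNIV (tensor_weight R p) (\<Sum>n\<in>A. tproj scl n t)
      (\<Sum>n\<in>A. fact n powr R * (proj_seminorm scl p n (tproj scl n t) + d n))"
  proof (rule tensor_bound_sum)
    fix n
    have "0 < d n" using e by (simp add: d_def)
    then have "tensor_bound scl {ws. length ws = n} prod_weight (tproj scl n t)
        (proj_seminorm scl p n (tproj scl n t) + d n)"
      by (intro proj_seminorm_less t) simp
    then show "tensor_bound scl UNIV (tensor_weight R p) (tproj scl n t)
        (fact n powr R * (proj_seminorm scl p n (tproj scl n t) + d n))"
      by (rule tensor_bound_weight) (simp_all add: tensor_weight_def)
  qed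
  moreover have "(\<Sum>n\<in>A. tproj scl n t) = t"
    using tensors_decompose[OF t A] by (simp add: A_def)
  moreover have "(\<Sum>n\<in>A. fact n powr R * (proj_seminorm scl p n (tproj scl n t) + d n)) =
      tensor_seminorm scl R p t + card A * (e / (card A + 1))"
  proof -
    have "fact n powr R * d n = e / (card A + 1)" for n by (simp add: d_def)
    then show ?thesis
      using tensor_seminorm_eq[OF A, of t] by (simp add: distrib_left sum.distrib A_def)
  qed
  moreover have "card A * (e / (card A + 1)) \<le> e"
    using e by (simp add: field_simps)
  ultimately show ?thesis by (auto simp: e_def elim: tensor_bound_mono)
qed

lemma tensor_seminorm_zero: "tensor_seminorm scl R p 0 = 0"
  by (subst tensor_seminorm_eq[of "{}"]) auto

lemma tensor_seminorm_nonneg: "t \<in> tensors scl \<Longrightarrow> 0 \<le> tensor_seminorm scl R p t"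
  by (subst tensor_seminorm_eq[OF finite_degrees]) (auto intro!: sum_nonneg mult_nonneg_nonneg proj_seminorm_nonneg)

lemma tensor_seminorm_add:
  assumes "s \<in> tensors scl" "t \<in> tensors scl"
  shows "tensor_seminorm scl R p (s + t) \<le> tensor_seminorm scl R p s + tensor_seminorm scl R p t"
proof (rule field_le_epsilon)
  fix e :: real assume "0 < e"
  then have "tensor_bound scl UNIV (tensor_weight R p) (s + t)
      (tensor_seminorm scl R p s + e / 2 + (tensor_seminorm scl R p t + e / 2))"
    by (intro tensor_bound_add tensor_seminorm_less assms) simp_all
  then show "tensor_seminorm scl R p (s + t) \<le> tensor_seminorm scl R p s + tensor_seminorm scl R p t + e"
    by (auto dest: tensor_seminorm_le)
qed

lemma tensor_seminorm_scale:
  assumes "t \<in> tensors scl"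
  shows "tensor_seminorm scl R p (tscale c t) \<le> norm c * tensor_seminorm scl R p t"
proof (rule field_le_epsilon)
  fix e :: real assume e: "0 < e"
  \<comment> \<open>The added 1 covers \<open>c = 0\<close>.\<close>
  define d where "d = e / (norm c + 1)"
  have n: "0 < norm c + 1" using norm_ge_zero[of c] by linarith
  then have d: "0 < d" "norm c * d \<le> e" using e by (simp_all add: d_def field_simps)
  have "tensor_bound scl UNIV (tensor_weight R p) (tscale c t) (norm c * (tensor_seminorm scl R p t + d))"
    using d by (intro tensor_bound_scale tensor_seminorm_less assms) simp
  from tensor_seminorm_le[OF this] d
  show "tensor_seminorm scl R p (tscale c t) \<le> norm c * tensor_seminorm scl R p t + e"
    by (simp add: distrib_left)
qed

lemma tensor_seminorm_diff:
  assumes "s \<in> tensors scl" "t \<in> tensors scl"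
  shows "tensor_seminorm scl R p (s - t) \<le> tensor_seminorm scl R p s + tensor_seminorm scl R p t"
  using tensor_seminorm_add[OF assms(1) tensors_scale[OF assms(2), of "-1"]] tensor_seminorm_scale[OF assms(2), of "-1"]
  by simp

end

lemma tensor_seminorm_mono:
  assumes p: "\<And>x. 0 \<le> p x" and le: "\<And>x. p x \<le> q x" and t: "t \<in> tensors scl"
  shows "tensor_seminorm scl R p t \<le> tensor_seminorm scl R q t"
proof (rule field_le_epsilon)
  fix e :: real assume e: "0 < e"
  have q: "0 \<le> q x" for x using p le by (rule order_trans)
  have "tensor_bound scl UNIV (tensor_weight R q) t (tensor_seminorm scl R q t + e)"
    using e by (intro tensor_seminorm_less q t) simp
  then have "tensor_bound scl UNIV (tensor_weight R p) t (1 * (tensor_seminorm scl R q t + e))"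
    by (rule tensor_bound_weight)
      (auto simp: tensor_weight_def intro!: mult_left_mono prod_list_map_mono p le)
  from tensor_seminorm_le[OF p this]
  show "tensor_seminorm scl R p t \<le> tensor_seminorm scl R q t + e" by simp
qed

lemma tensor_bound_tmult:
  assumes p: "\<And>x. 0 \<le> p x" and R: "0 \<le> R"
    and f: "tensor_bound scl UNIV (tensor_weight R (\<lambda>x. 2 powr R * p x)) f a"
    and g: "tensor_bound scl UNIV (tensor_weight R (\<lambda>x. 2 powr R * p x)) g b" and b: "0 \<le> b"
  shows "tensor_bound scl UNIV (tensor_weight R p) (tmult scl f g) (a * b)"
proof -
  let ?\<omega> = "tensor_weight R (\<lambda>x. 2 powr R * p x)"
  have nonneg: "0 \<le> ?\<omega> xs" for xs by (rule tensor_weight_nonneg) (simp add: p)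
  have tens: "tensor_bound scl UNIV (tensor_weight R p) (tmult scl (tens scl xs) g) (?\<omega> xs * b)" for xs
    using g
  proof (induction rule: tensor_bound.induct)
    case (tensor_bound_zero b)
    then show ?case by (simp add: tmult_zero_right tensor_bound.tensor_bound_zero nonneg)
  next
    case (tensor_bound_step ys t b c)
    have "tensor_bound scl UNIV (tensor_weight R p) (tens scl (xs @ ys)) (?\<omega> xs * ?\<omega> ys)"
      by (rule tensor_bound_mono[OF tensor_bound_tens]) (simp_all add: tensor_weight_append_le p R)
    then have "tensor_bound scl UNIV (tensor_weight R p) (tscale c (tens scl (xs @ ys)) + tmult scl (tens scl xs) t)
        (norm c * (?\<omega> xs * ?\<omega> ys) + ?\<omega> xs * b)"
      by (intro tensor_bound_add tensor_bound_scale tensor_bound_step.IH)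
    then show ?case
      using tensor_bound_in_tensors[OF tensor_bound_step.hyps(2)]
      by (simp add: tmult_add_right tmult_scale_right tmult_tens tensors_scale algebra_simps)
  qed
  show ?thesis
    using tensor_bound_map[OF f b, of "\<lambda>f. tmult scl f g" UNIV "tensor_weight R p"] tens
    by (simp add: tmult_add_left tmult_scale_left mult.commute)
qed

lemma tensor_seminorm_bilinear:
  assumes p: "\<And>x. 0 \<le> p x" and q: "\<And>x. 0 \<le> q x" and R: "0 \<le> R" and \<kappa>: "0 \<le> \<kappa>"
    and add: "\<And>s t. F (s + t) = F s + F t" and scale: "\<And>c t. F (tscale c t) = tscale c (F t)"
    and tens: "\<And>xs. tensor_bound scl UNIV (tensor_weight R p) (F (tens scl xs)) (\<kappa> * tensor_weight R q xs)"
    and f: "f \<in> tensors scl" and g: "g \<in> tensors scl"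
  shows "tensor_seminorm scl R p (F (tmult scl f g)) \<le>
    \<kappa> * (tensor_seminorm scl R (\<lambda>x. 2 powr R * q x) f * tensor_seminorm scl R (\<lambda>x. 2 powr R * q x) g)"
proof -
  let ?q = "tensor_seminorm scl R (\<lambda>x. 2 powr R * q x)"
  have q': "0 \<le> 2 powr R * q x" for x by (simp add: q)
  have bound: "tensor_seminorm scl R p (F (tmult scl f g)) \<le> \<kappa> * ((?q f + e) * (?q g + e))" if e: "0 < e" for e
  proof -
    have "tensor_bound scl UNIV (tensor_weight R q) (tmult scl f g) ((?q f + e) * (?q g + e))"
      using e tensor_seminorm_nonneg[OF q' g, of R]
      by (intro tensor_bound_tmult tensor_seminorm_less q q' R f g) simp_all
    then have "tensor_bound scl UNIV (tensor_weight R p) (F (tmult scl f g)) (\<kappa> * ((?q f + e) * (?q g + e)))"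
      by (rule tensor_bound_map[OF _ \<kappa> add scale tens])
    then show ?thesis by (rule tensor_seminorm_le[OF p])
  qed
  \<comment> \<open>Infima need not be attained, so both factors carry an error \<open>e\<close>,
    which now tends to 0 from the right.\<close>
  have "((\<lambda>e. \<kappa> * ((?q f + e) * (?q g + e))) \<longlongrightarrow> \<kappa> * ((?q f + 0) * (?q g + 0))) (at_right 0)"
    by (intro tendsto_intros)
  moreover have "\<forall>\<^sub>F e in at_right 0. tensor_seminorm scl R p (F (tmult scl f g)) \<le> \<kappa> * ((?q f + e) * (?q g + e))"
    by (simp add: eventually_at_filter bound)
  ultimately have "tensor_seminorm scl R p (F (tmult scl f g)) \<le> \<kappa> * ((?q f + 0) * (?q g + 0))"
    by (rule tendsto_lowerbound) simp
  then show ?thesis by simp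
qed

section \<open>Lists of Lie words\<close>

text \<open>The entries of \<open>ws\<close> are values of Lie words which together use each letter
  of \<open>xs\<close> exactly as often as it occurs. Only multisets are compared, because
  symmetrization shuffles the factors.\<close>

definition lie_words :: "('a \<Rightarrow> 'a \<Rightarrow> 'a) \<Rightarrow> 'a list \<Rightarrow> 'a list set" where
  "lie_words br xs = {ws. \<exists>zss. list_all2 (lie_word br) zss ws \<and> mset (concat zss) = mset xs}"

lemma lie_words_permute:
  assumes "ws \<in> lie_words br xs" "\<sigma> permutes {..<length ws}"
  shows "permute_list \<sigma> ws \<in> lie_words br xs"
proof -
  obtain zss where zss: "list_all2 (lie_word br) zss ws" "mset (concat zss) = mset xs"
    using assms(1) by (auto simp: lie_words_def)
  have len: "length zss = length ws" using zss(1) by (rule list_all2_lengthD)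
  have "list_all2 (lie_word br) (permute_list \<sigma> zss) (permute_list \<sigma> ws)"
    using zss(1) assms(2) len permutes_in_image[OF assms(2)]
    by (auto simp: list_all2_conv_all_nth permute_list_nth)
  moreover have "mset (concat (permute_list \<sigma> zss)) = mset xs"
    using assms(2) len by (simp add: mset_concat sum_mset_sum_list[symmetric] zss(2)[symmetric])
  ultimately show ?thesis by (auto simp: lie_words_def)
qed

lemma lie_words_length:
  assumes "ws \<in> lie_words br xs" shows "length ws \<le> length xs"
proof -
  have ne: "lie_word br zs w \<Longrightarrow> 1 \<le> length zs" for zs w
    by (induction rule: lie_word.induct) auto
  obtain zss where zss: "list_all2 (lie_word br) zss ws" "mset (concat zss) = mset xs"
    using assms by (auto simp: lie_words_def)
  from zss(1) have "length ws \<le> length (concat zss)"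
  proof (induction rule: list_all2_induct)
    case (Cons zs zss w ws)
    then show ?case using ne[OF Cons.hyps(1)] by simp
  qed simp
  with mset_eq_length[OF zss(2)] show ?thesis by simp
qed

text \<open>The asymptotic estimate is applied to each entry separately. It has no constant, so
  neither the number of words nor their bracketing enters.\<close>

lemma lie_words_prod_le:
  assumes "asymptotic_estimate br p q" and p: "\<And>x. 0 \<le> p x" and q: "\<And>x. 0 \<le> q x" and "ws \<in> lie_words br xs"
  shows "prod_list (map p ws) \<le> prod_list (map q xs)"
proof -
  obtain zss where zss: "list_all2 (lie_word br) zss ws" "mset (concat zss) = mset xs"
    using assms(4) by (auto simp: lie_words_def)
  have "prod_list (map p ws) \<le> prod_list (map q (concat zss))"
    using zss(1)
  proof (induction rule: list_all2_induct)
    case (Cons zs zss w ws)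
    then show ?case
      using assms(1) by (auto simp: asymptotic_estimate_def intro!: mult_mono prod_list_nonneg p q)
  qed simp
  also have "\<dots> = prod_list (map q xs)"
    using zss(2) by (metis mset_map prod_mset_prod_list)
  finally show ?thesis .
qed

text \<open>The nested bracket is a Lie word whose letters are those of the first \<open>j\<close>
  words followed by \<open>x\<close>, and the other words are untouched. This is exactly what a term
  of \<open>left_term\<close> does.\<close>

lemma lie_words_bracket:
  assumes "ws \<in> lie_words br xs"
  shows "foldr br (take j ws) x # drop j ws \<in> lie_words br (x # xs)"
proof -
  obtain zss where zss: "list_all2 (lie_word br) zss ws" "mset (concat zss) = mset xs"
    using assms by (auto simp: lie_words_def)
  have "list_all2 (lie_word br) zss vs \<Longrightarrow> lie_word br (concat zss @ [x]) (foldr br vs x)" for zss vs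
    by (induction rule: list_all2_induct) (auto intro: lie_word.intros)
  then have "lie_word br (concat (take j zss) @ [x]) (foldr br (take j ws) x)"
    using zss(1) by (simp add: list_all2_takeI)
  then have "list_all2 (lie_word br) ((concat (take j zss) @ [x]) # drop j zss) (foldr br (take j ws) x # drop j ws)"
    using zss(1) by (simp add: list_all2_dropI)
  moreover have "mset (concat ((concat (take j zss) @ [x]) # drop j zss)) = mset (x # xs)"
  proof -
    have "concat zss = concat (take j zss) @ concat (drop j zss)"
      by (metis append_take_drop_id concat_append)
    then show ?thesis using zss(2) by simp
  qed
  ultimately show ?thesis unfolding lie_words_def by blast
qed

section \<open>The bound for normal ordering\<close>

locale normed_field_lie_algebra = char_0_lie_algebra scl br
  for scl :: "'k::real_normed_field \<Rightarrow> 'a::ab_group_add \<Rightarrow> 'a" and br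
begin

text \<open>Left multiplication turns a list of length \<open>l\<close> into lists of length
  \<open>l - j + 1\<close> with coefficients at most \<open>l! / (l - j)!\<close>. The factorial in
  the weight absorbs this up to a factor \<open>l - j + 1\<close>; the power of 2 makes the sum over
  \<open>j\<close> geometric, so that one letter costs a multiple of \<open>l + 1\<close>. With the
  factorial alone the sum would be of order \<open>l^2\<close>, and \<open>n\<close> letters would
  only give a bound of the order of the square of \<open>n!\<close>, too much for
  \<open>R = 1\<close>.\<close>

abbreviation "word_weight \<equiv> (\<lambda>ws. fact (length ws) * 2 ^ length ws :: real)"

lemma tensor_bound_sprod:
  assumes "ws \<in> lie_words br xs"
  shows "tensor_bound scl (lie_words br xs) word_weight (sprod ws) (word_weight ws)"
proof -
  have "tensor_bound scl (lie_words br xs) word_weight (sprod ws)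
      (norm (1 / fact (length ws) :: 'k) * (\<Sum>\<sigma> | \<sigma> permutes {..<length ws}. word_weight ws))"
    unfolding symprod_def
  proof (intro tensor_bound_scale tensor_bound_sum)
    fix \<sigma> assume "\<sigma> \<in> {\<sigma>. \<sigma> permutes {..<length ws}}"
    then show "tensor_bound scl (lie_words br xs) word_weight (tens scl (permute_list \<sigma> ws)) (word_weight ws)"
      using tensor_bound_tens[of "permute_list \<sigma> ws" "lie_words br xs" scl word_weight] assms
      by (simp add: lie_words_permute)
  qed
  then show ?thesis
    by (simp add: card_permutations[OF refl] norm_divide norm_fact)
qed

lemma sum_power2_le: "(\<Sum>j\<le>l. real (Suc l - j) * 2 ^ (Suc l - j)) \<le> 4 * real (Suc l) * 2 ^ l"
proof -
  have "(\<Sum>j\<le>l. (2::real) ^ (Suc l - j)) = 2 ^ Suc (Suc l) - 2"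
  proof (induction l)
    case (Suc l)
    then show ?case unfolding sum.atMost_Suc_shift by simp
  qed simp
  then have s: "(\<Sum>j\<le>l. (2::real) ^ (Suc l - j)) \<le> 4 * 2 ^ l" by simp
  have "(\<Sum>j\<le>l. real (Suc l - j) * 2 ^ (Suc l - j)) \<le> (\<Sum>j\<le>l. real (Suc l) * 2 ^ (Suc l - j))"
    by (intro sum_mono mult_right_mono) simp_all
  also have "\<dots> = real (Suc l) * (\<Sum>j\<le>l. 2 ^ (Suc l - j))"
    by (simp add: sum_distrib_left)
  also have "\<dots> \<le> real (Suc l) * (4 * 2 ^ l)" by (intro mult_left_mono s) simp
  finally show ?thesis by (simp only: mult_ac)
qed

lemma tensor_bound_left_term:
  assumes "ws \<in> lie_words br xs"
  shows "tensor_bound scl (lie_words br (x # xs)) word_weight (left_term scl br x ws)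
    (4 * real (Suc (length xs)) * word_weight ws)"
proof -
  let ?l = "length ws"
  have 1: "tensor_bound scl (lie_words br (x # xs)) word_weight (left_term scl br x ws)
      (\<Sum>j\<le>?l. norm (bern j * fact ?l / fact (?l - j) :: 'k) * word_weight (foldr br (take j ws) x # drop j ws))"
    unfolding left_term_def
    by (intro tensor_bound_scale tensor_bound_sum tensor_bound_sprod lie_words_bracket assms)
  have 2: "(\<Sum>j\<le>?l. norm (bern j * fact ?l / fact (?l - j) :: 'k) * word_weight (foldr br (take j ws) x # drop j ws))
      \<le> (\<Sum>j\<le>?l. fact ?l * (real (Suc ?l - j) * 2 ^ (Suc ?l - j)))"
  proof (rule sum_mono)
    fix j assume j: "j \<in> {..?l}"
    have "norm (bern j * fact ?l / fact (?l - j) :: 'k) \<le> 1 * fact ?l / fact (?l - j)"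
      unfolding norm_divide norm_mult norm_fact
      by (intro divide_right_mono mult_right_mono norm_bern_le) simp_all
    then have "norm (bern j * fact ?l / fact (?l - j) :: 'k) * (fact (Suc (?l - j)) * 2 ^ Suc (?l - j)) \<le>
        fact ?l / fact (?l - j) * (fact (Suc (?l - j)) * 2 ^ Suc (?l - j))"
      by (intro mult_right_mono) simp_all
    also have "\<dots> = fact ?l * (real (Suc (?l - j)) * 2 ^ Suc (?l - j))"
      by simp
    finally show "norm (bern j * fact ?l / fact (?l - j) :: 'k) * word_weight (foldr br (take j ws) x # drop j ws)
        \<le> fact ?l * (real (Suc ?l - j) * 2 ^ (Suc ?l - j))"
      using j by (simp add: Suc_diff_le del: fact_Suc power_Suc)
  qed
  have 3: "(\<Sum>j\<le>?l. fact ?l * (real (Suc ?l - j) * 2 ^ (Suc ?l - j))) \<le> 4 * real (Suc (length xs)) * word_weight ws"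
  proof -
    have "(\<Sum>j\<le>?l. fact ?l * (real (Suc ?l - j) * 2 ^ (Suc ?l - j))) \<le> fact ?l * (4 * real (Suc ?l) * 2 ^ ?l)"
      unfolding sum_distrib_left[symmetric] by (intro mult_left_mono sum_power2_le) simp
    also have "\<dots> \<le> fact ?l * (4 * real (Suc (length xs)) * 2 ^ ?l)"
      using lie_words_length[OF assms] by (intro mult_left_mono mult_right_mono) simp_all
    finally show ?thesis by (simp add: mult_ac)
  qed
  show ?thesis by (rule tensor_bound_mono[OF 1 order_trans[OF 2 3]])
qed

text \<open>Each letter costs four times the length reached with it; the product over the letters is
  the stated bound.\<close>

lemma tensor_bound_N_tens:
  "tensor_bound scl (lie_words br xs) word_weight (N (tens scl xs)) (4 ^ length xs * fact (length xs))"
proof (induction xs)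
  case Nil
  have "[] \<in> lie_words br []" by (simp add: lie_words_def)
  from tensor_bound_tens[OF this, of scl word_weight] show ?case by (simp add: N_tens)
next
  case (Cons x xs)
  have "tensor_bound scl (lie_words br (x # xs)) word_weight (M x (N (tens scl xs)))
      (4 * real (Suc (length xs)) * (4 ^ length xs * fact (length xs)))"
  proof (rule tensor_bound_map[OF Cons])
    show "tensor_bound scl (lie_words br (x # xs)) word_weight (M x (tens scl ws))
        (4 * real (Suc (length xs)) * word_weight ws)" if "ws \<in> lie_words br xs" for ws
      unfolding M_tens by (rule tensor_bound_left_term[OF that])
  qed (simp_all add: M_add M_scale)
  moreover have "4 * real (Suc (length xs)) * (4 ^ length xs * fact (length xs)) =
      (4 ^ length (x # xs) * fact (length (x # xs)) :: real)" by simp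
  ultimately show ?case by (simp only: N_tens foldr.simps o_apply)
qed

text \<open>The factor 8 for each letter is 4 from normal ordering times 2, since a word of length
  \<open>n\<close> has \<open>n + 1\<close> relevant components and
  \<open>n + 1 \<le> 2 ^ n\<close>. The factor \<open>c\<close> absorbs the growth of
  \<open>a\<close>, whereas \<open>A\<close> stays in front.\<close>

lemma tensor_bound_G_tens:
  assumes ae: "asymptotic_estimate br p q" and p: "\<And>x. 0 \<le> p x" and q: "\<And>x. 0 \<le> q x" and R: "1 \<le> R"
    and A: "0 \<le> A" and c: "1 \<le> c" and a: "\<And>n. norm (a n) \<le> A * c ^ n"
  shows "tensor_bound scl UNIV (tensor_weight R p) (G a (tens scl xs))
    (A * tensor_weight R (\<lambda>x. 8 * c * q x) xs)"
proof -
  let ?l = "length xs"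
  define b where "b = 4 ^ ?l * tensor_weight R q xs"
  have b: "0 \<le> b" by (simp add: b_def tensor_weight_nonneg q)
  have proj: "tensor_bound scl UNIV (tensor_weight R p) (tproj scl k (N (tens scl xs))) b" for k
  proof -
    define C where "C = fact ?l powr (R - 1) * prod_list (map q xs)"
    have C: "0 \<le> C" by (simp add: C_def prod_list_nonneg q)
    have weight: "tensor_weight R p ws \<le> C * word_weight ws" if "ws \<in> lie_words br xs" for ws
    proof -
      \<comment> \<open>One power of the factorial is paid by \<open>word_weight\<close>. The
        remaining exponent \<open>R - 1\<close> is nonnegative, so that part is monotone in the
        length, and a list of Lie words is no longer than \<open>xs\<close>.\<close>
      have "(fact (length ws) :: real) powr R = fact (length ws) powr (R - 1) * fact (length ws)"
        by (simp add: powr_diff)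
      also have "\<dots> \<le> fact ?l powr (R - 1) * (fact (length ws) * 2 ^ length ws)"
      proof (rule mult_mono)
        show "(fact (length ws) :: real) powr (R - 1) \<le> fact ?l powr (R - 1)"
          using R fact_mono[OF lie_words_length[OF that]] by (intro powr_mono2) simp_all
        show "(fact (length ws) :: real) \<le> fact (length ws) * 2 ^ length ws"
          using mult_left_mono[of 1 "2 ^ length ws :: real" "fact (length ws)"] by simp
      qed simp_all
      finally have "fact (length ws) powr R * prod_list (map p ws) \<le>
          fact ?l powr (R - 1) * (fact (length ws) * 2 ^ length ws) * prod_list (map q xs)"
        by (rule mult_mono[OF _ lie_words_prod_le[OF ae p q that]]) (simp_all add: prod_list_nonneg p)
      then show ?thesis by (simp add: tensor_weight_def C_def mult_ac)
    qed
    have "tensor_bound scl UNIV (tensor_weight R p) (N (tens scl xs)) (C * (4 ^ ?l * fact ?l))"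
      by (rule tensor_bound_weight[OF tensor_bound_N_tens C subset_UNIV weight])
    also have "C * (4 ^ ?l * fact ?l) = b"
      by (simp add: C_def b_def tensor_weight_def powr_diff)
    finally have "tensor_bound scl {ws \<in> UNIV. length ws = k} (tensor_weight R p) (tproj scl k (N (tens scl xs))) b"
      by (rule tensor_bound_tproj) (rule tensor_weight_nonneg[OF p])
    from tensor_bound_weight[OF this, of 1 UNIV "tensor_weight R p"] show ?thesis by simp
  qed
  have 1: "tensor_bound scl UNIV (tensor_weight R p) (G a (tens scl xs)) (\<Sum>n\<le>?l. norm (a n) * b)"
    unfolding G_tens by (intro tensor_bound_sum tensor_bound_scale proj)
  have 2: "(\<Sum>n\<le>?l. norm (a n) * b) \<le> (\<Sum>n\<le>?l. A * c ^ ?l * b)"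
  proof (intro sum_mono mult_right_mono b)
    fix n assume "n \<in> {..?l}"
    then have "A * c ^ n \<le> A * c ^ ?l" using c A by (intro mult_left_mono power_increasing) simp_all
    with a[of n] show "norm (a n) \<le> A * c ^ ?l" by linarith
  qed
  have 3: "(\<Sum>n\<le>?l. A * c ^ ?l * b) \<le> 2 ^ ?l * (A * c ^ ?l * b)"
  proof -
    have "Suc ?l \<le> 2 ^ ?l" by (rule Suc_leI) (rule less_exp)
    then have "real (Suc ?l) \<le> real (2 ^ ?l)" by (simp only: of_nat_le_iff)
    then have "real (Suc ?l) * (A * c ^ ?l * b) \<le> 2 ^ ?l * (A * c ^ ?l * b)"
      using A b c by (intro mult_right_mono) simp_all
    then show ?thesis by simp
  qed
  have 4: "2 ^ ?l * (A * c ^ ?l * b) = A * tensor_weight R (\<lambda>x. 8 * c * q x) xs"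
  proof -
    have "A * tensor_weight R (\<lambda>x. 8 * c * q x) xs = A * ((8 * c) ^ ?l * tensor_weight R q xs)"
      by (simp only: tensor_weight_scaled)
    also have "(8 * c) ^ ?l = 2 ^ ?l * (c ^ ?l * 4 ^ ?l)"
    proof -
      have "(8::real) ^ ?l = 2 ^ ?l * 4 ^ ?l"
        unfolding power_mult_distrib[symmetric] by simp
      then show ?thesis by (simp only: power_mult_distrib mult_ac)
    qed
    finally show ?thesis by (simp only: b_def mult_ac)
  qed
  show ?thesis by (rule tensor_bound_mono[OF 1 order_trans[OF 2 3, unfolded 4]])
qed

lemma tensor_seminorm_G:
  assumes ae: "asymptotic_estimate br p q" and p: "\<And>x. 0 \<le> p x" and q: "\<And>x. 0 \<le> q x" and R: "1 \<le> R"
    and A: "0 \<le> A" and c: "1 \<le> c" and a: "\<And>n. norm (a n) \<le> A * c ^ n"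
    and f: "f \<in> T" and g: "g \<in> T"
  shows "tensor_seminorm scl R p (G a (tmult scl f g)) \<le>
    A * (tensor_seminorm scl R (\<lambda>x. 2 powr R * (8 * c * q x)) f *
      tensor_seminorm scl R (\<lambda>x. 2 powr R * (8 * c * q x)) g)"
proof (rule tensor_seminorm_bilinear[where F = "G a", OF p _ _ A G_add G_scale _ f g])
  show "0 \<le> 8 * c * q x" for x using c q by simp
  show "0 \<le> R" using R by simp
  show "tensor_bound scl UNIV (tensor_weight R p) (G a (tens scl xs)) (A * tensor_weight R (\<lambda>x. 8 * c * q x) xs)" for xs
    by (rule tensor_bound_G_tens[OF ae p q R A c a])
qed

end

section \<open>Extension to the completion\<close>

text \<open>Continuity of subtraction at (x, x), the substitute for halving a radius in a
  topological group.\<close>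

lemma diff_neighbourhood:
  fixes x :: "'a::topological_ab_group_add"
  assumes "open W" "0 \<in> W"
  obtains V where "open V" "x \<in> V" "\<And>a b. a \<in> V \<Longrightarrow> b \<in> V \<Longrightarrow> a - b \<in> W"
proof -
  have "((\<lambda>p. fst p - snd p) \<longlongrightarrow> x - x) (nhds (x, x))"
    using tendsto_diff[of fst x "nhds (x, x)" snd x] by (simp add: nhds_prod filterlim_fst filterlim_snd)
  then have "\<forall>\<^sub>F p in nhds (x, x). fst p - snd p \<in> W"
    using assms by (simp add: topological_tendstoD)
  then obtain S where S: "open S" "(x, x) \<in> S" "\<And>p. p \<in> S \<Longrightarrow> fst p - snd p \<in> W"
    unfolding eventually_nhds by blast
  obtain A B where AB: "open A" "open B" "(x, x) \<in> A \<times> B" "A \<times> B \<subseteq> S"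
    using open_prod_elim[OF S(1,2)] by metis
  show ?thesis
  proof (rule that[of "A \<inter> B"])
    show "a - b \<in> W" if "a \<in> A \<inter> B" "b \<in> A \<inter> B" for a b
      using S(3)[of "(a, b)"] AB(4) that by auto
  qed (use AB in auto)
qed

text \<open>The image under \<open>h\<close> of the trace on \<open>D\<close> of the neighbourhoods
  of \<open>x\<close> is a Cauchy filter, and its limit is the value at \<open>x\<close>. The Cauchy
  condition is imposed at each point of a bare topological space and completeness is a premise on
  the target, so the lemma serves seminorms (target the reals) as well as products (domain a product
  space).\<close>

lemma dense_extension:
  fixes h :: "'x::topological_space \<Rightarrow> 'y::{topological_ab_group_add, t2_space}"
  assumes complete: "\<And>F :: 'y filter. F \<noteq> bot \<Longrightarrow> cauchy_filter_add F \<Longrightarrow> \<exists>y. F \<le> nhds y"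
    and dense: "closure D = UNIV"
    and cauchy: "\<And>x U. open U \<Longrightarrow> 0 \<in> U \<Longrightarrow>
      \<exists>V. open V \<and> x \<in> V \<and> (\<forall>a\<in>V \<inter> D. \<forall>b\<in>V \<inter> D. h a - h b \<in> U)"
  obtains g where "continuous_on UNIV g" "\<And>a. a \<in> D \<Longrightarrow> g a = h a"
proof -
  define F where "F x = filtermap h (inf (nhds x) (principal D))" for x
  have ev: "eventually P (F x) \<longleftrightarrow> (\<exists>V. open V \<and> x \<in> V \<and> (\<forall>a\<in>V \<inter> D. P (h a)))" for P x
    unfolding F_def eventually_filtermap eventually_inf_principal eventually_nhds by auto
  have meets: "V \<inter> D \<noteq> {}" if "open V" "x \<in> V" for V x
    using open_Int_closure_eq_empty[OF that(1), of D] that(2) dense by auto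
  have "\<exists>y. F x \<le> nhds y" for x
  proof (rule complete)
    show "F x \<noteq> bot"
    proof
      assume "F x = bot"
      then have "eventually (\<lambda>_. False) (F x)" by simp
      then obtain V where V: "open V" "x \<in> V" "\<forall>a\<in>V \<inter> D. False" unfolding ev by blast
      from meets[OF V(1,2)] V(3) show False by blast
    qed
    show "cauchy_filter_add (F x)"
      unfolding cauchy_filter_add_def
    proof (intro allI impI)
      fix U :: "'y set" assume "open U \<and> 0 \<in> U"
      then have U: "open U" "0 \<in> U" by simp_all
      from cauchy[OF U, of x] obtain V where V: "open V" "x \<in> V"
        "\<forall>a\<in>V \<inter> D. \<forall>b\<in>V \<inter> D. h a - h b \<in> U" by (elim exE conjE)
      show "\<exists>A. (\<forall>\<^sub>F y in F x. y \<in> A) \<and> (\<forall>y\<in>A. \<forall>z\<in>A. y - z \<in> U)"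
      proof (intro exI conjI)
        show "\<forall>\<^sub>F y in F x. y \<in> h ` (V \<inter> D)" unfolding ev using V(1,2) by blast
        show "\<forall>y\<in>h ` (V \<inter> D). \<forall>z\<in>h ` (V \<inter> D). y - z \<in> U" using V(3) by blast
      qed
    qed
  qed
  then obtain g where g: "F x \<le> nhds (g x)" for x by metis
  have near: "\<exists>V. open V \<and> x \<in> V \<and> (\<forall>a\<in>V \<inter> D. h a \<in> W)" if "open W" "g x \<in> W" for x W
  proof -
    have "eventually (\<lambda>y. y \<in> W) (F x)"
      by (rule filter_leD[OF g eventually_nhds_in_open[OF that]])
    then show ?thesis unfolding ev .
  qed
  show ?thesis
  proof
    show "g a = h a" if a: "a \<in> D" for a
    proof (rule ccontr)
      assume "g a \<noteq> h a"
      then have "g a - h a \<noteq> 0" by simp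
      then obtain U O' where U: "open U" "open O'" "0 \<in> U" "g a - h a \<in> O'" "U \<inter> O' = {}"
        using hausdorff[of 0 "g a - h a"] by metis
      obtain V where V: "open V" "a \<in> V" "\<forall>b\<in>V \<inter> D. \<forall>c\<in>V \<inter> D. h b - h c \<in> U"
        using cauchy[OF U(1,3), of a] by (elim exE conjE)
      have "open ((\<lambda>y. y - h a) -` O')"
        by (rule open_vimage[OF U(2)]) (intro continuous_intros)
      from near[OF this, of a] obtain V' where V': "open V'" "a \<in> V'" "\<forall>b\<in>V' \<inter> D. h b - h a \<in> O'"
        using U(4) by auto
      have "(V \<inter> V') \<inter> D \<noteq> {}" using V V' by (intro meets) auto
      then show False using V V' U(5) a by blast
    qed
    show "continuous_on UNIV g"
      unfolding continuous_on_def
    proof (intro ballI topological_tendstoI)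
      fix x W assume "open W" "g x \<in> W"
      have "open ((\<lambda>u. g x - u) -` W)"
        by (rule open_vimage[OF \<open>open W\<close>]) (intro continuous_intros)
      moreover have "0 \<in> (\<lambda>u. g x - u) -` W" using \<open>g x \<in> W\<close> by simp
      ultimately obtain U1 where U1: "open U1" "0 \<in> U1"
        "\<And>a b. a \<in> U1 \<Longrightarrow> b \<in> U1 \<Longrightarrow> a - b \<in> (\<lambda>u. g x - u) -` W"
        by (rule diff_neighbourhood[where x = 0]) (rule that)
      obtain U where U: "open U" "0 \<in> U" "\<And>a b. a \<in> U \<Longrightarrow> b \<in> U \<Longrightarrow> a - b \<in> U1"
        by (rule diff_neighbourhood[OF U1(1,2), of 0]) (rule that)
      obtain V where V: "open V" "x \<in> V" "\<forall>a\<in>V \<inter> D. \<forall>b\<in>V \<inter> D. h a - h b \<in> U"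
        using cauchy[OF U(1,2), of x] by (elim exE conjE)
      have "g x' \<in> W" if x': "x' \<in> V" for x'
      proof -
        have lim: "\<exists>a\<in>V \<inter> D. g y - h a \<in> U" if "y \<in> V" for y
        proof -
          have "open ((\<lambda>z. g y - z) -` U)"
            by (rule open_vimage[OF U(1)]) (intro continuous_intros)
          from near[OF this, of y] obtain V' where V': "open V'" "y \<in> V'" "\<forall>a\<in>V' \<inter> D. g y - h a \<in> U"
            using U(2) by auto
          have "(V \<inter> V') \<inter> D \<noteq> {}" using V V' that by (intro meets[of _ y]) auto
          then show ?thesis using V' by blast
        qed
        obtain a where a: "a \<in> V \<inter> D" "g x - h a \<in> U" using lim[OF V(2)] by blast
        obtain b where b: "b \<in> V \<inter> D" "g x' - h b \<in> U" using lim[OF x'] by blast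
        have "h b - h a \<in> U" using V(3) a(1) b(1) by blast
        then have "(g x - h a) - (h b - h a) \<in> U1" using U(3) a(2) by blast
        moreover have "(g x' - h b) - 0 \<in> U1" using U(2,3) b(2) by blast
        \<comment> \<open>The expression telescopes to \<open>g x - g x'\<close>, so membership in
          the preimage says that \<open>g x'\<close> lies in \<open>W\<close>.\<close>
        ultimately have "((g x - h a) - (h b - h a)) - ((g x' - h b) - 0) \<in> (\<lambda>u. g x - u) -` W" by (rule U1(3))
        then show ?thesis by simp
      qed
      then show "\<forall>\<^sub>F x' in at x within UNIV. g x' \<in> W"
        unfolding eventually_at_topological using V by blast
    qed
  qed
qed

lemma real_cauchy_filter_converges:
  fixes F :: "real filter"
  assumes "F \<noteq> bot" "cauchy_filter_add F"
  shows "\<exists>y. F \<le> nhds y"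
proof -
  have "cauchy_filter F"
    unfolding cauchy_filter_metric
  proof (intro allI impI)
    fix e :: real assume e: "e > 0"
    then have "open (ball 0 e)" "0 \<in> ball 0 e" by simp_all
    then obtain A where "\<forall>\<^sub>F x in F. x \<in> A" "\<forall>x\<in>A. \<forall>y\<in>A. x - y \<in> ball 0 e"
      using assms(2) unfolding cauchy_filter_add_def by meson
    then show "\<exists>P. eventually P F \<and> (\<forall>x y. P x \<and> P y \<longrightarrow> dist x y < e)"
      by (intro exI[of _ "\<lambda>x. x \<in> A"]) (simp add: dist_norm)
  qed
  then show ?thesis
    using complete_UNIV[where 'a = real] assms(1) unfolding complete_uniform by auto
qed

section \<open>Continuous seminorms\<close>

lemma continuous_seminorm_zero: "continuous_seminorm scl (\<lambda>x. 0)"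
  by (simp add: continuous_seminorm_def)

lemma continuous_seminorm_plus:
  "continuous_seminorm scl p \<Longrightarrow> continuous_seminorm scl q \<Longrightarrow> continuous_seminorm scl (\<lambda>x. p x + q x)"
proof -
  assume "continuous_seminorm scl p" "continuous_seminorm scl q"
  then have *: "p (x + y) \<le> p x + p y" "q (x + y) \<le> q x + q y" "p (scl c x) = norm c * p x"
    "q (scl c x) = norm c * q x" "continuous_on UNIV p" "continuous_on UNIV q" for c x y
    unfolding continuous_seminorm_def by simp_all
  have "p (x + y) + q (x + y) \<le> p x + q x + (p y + q y)" for x y using *(1,2)[of x y] by linarith
  then show ?thesis
    unfolding continuous_seminorm_def using * by (simp add: distrib_left continuous_on_add)
qed

lemma continuous_seminorm_scaled:
  assumes "continuous_seminorm scl p" "0 \<le> c" shows "continuous_seminorm scl (\<lambda>x. c * p x)"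
proof -
  have *: "p (x + y) \<le> p x + p y" "p (scl d x) = norm d * p x" "continuous_on UNIV p" for d x y
    using assms(1) unfolding continuous_seminorm_def by simp_all
  have "c * p (x + y) \<le> c * p x + c * p y" for x y
    using mult_left_mono[OF *(1) assms(2)] by (simp add: distrib_left)
  then show ?thesis
    unfolding continuous_seminorm_def using * by (simp add: mult.left_commute continuous_on_mult_left)
qed

lemma continuous_seminorm_nonneg:
  fixes scl :: "'k::real_normed_field \<Rightarrow> 'a::{topological_space, ab_group_add} \<Rightarrow> 'a"
  assumes "vector_space scl" "continuous_seminorm scl p" shows "0 \<le> p x"
proof -
  interpret vector_space scl by fact
  have "p (x + scl (-1) x) \<le> p x + p (scl (-1) x)" "p (scl 0 x) = norm (0::'k) * p x"
    "p (scl (-1) x) = norm (-1::'k) * p x"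
    using assms(2) unfolding continuous_seminorm_def by blast+
  then show ?thesis by simp
qed

text \<open>The part of the extension argument that does not involve a bracket.
  \<open>sym_completion\<close> alone imposes no vector space axioms on \<open>scl\<close>.\<close>

locale vector_completion = sym_completion scl R cscale \<iota> + V: vector_space scl
  for scl :: "'k::real_normed_field \<Rightarrow> 'a::{topological_ab_group_add, t2_space} \<Rightarrow> 'a"
    and R :: real
    and cscale :: "'k \<Rightarrow> 'c::{topological_ab_group_add, t2_space} \<Rightarrow> 'c"
    and \<iota> :: "('a, 'k) tensor \<Rightarrow> 'c"
begin

abbreviation "ST \<equiv> symtensors scl"
abbreviation "csn \<equiv> continuous_seminorm scl"
abbreviation "pR \<equiv> tensor_seminorm scl R"
abbreviation "hat \<equiv> tensor_seminorm_hat scl R \<iota>"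

lemma csn_nonneg: "csn p \<Longrightarrow> 0 \<le> p x"
  by (rule continuous_seminorm_nonneg[OF V.vector_space_axioms])

lemma
  assumes "f \<in> ST" "g \<in> ST"
  shows ST_add: "f + g \<in> ST" and ST_diff: "f - g \<in> ST"
  using assms tensor_space.subspace_add[OF symtensors_subspace] tensor_space.subspace_diff[OF symtensors_subspace]
  by blast+

lemma ST_scale: "f \<in> ST \<Longrightarrow> tscale c f \<in> ST"
  by (rule tensor_space.subspace_scale[OF symtensors_subspace])

lemma ST_zero: "0 \<in> ST"
  by (rule tensor_space.subspace_0[OF symtensors_subspace])

lemma ST_sum: "(\<And>i. i \<in> A \<Longrightarrow> f i \<in> ST) \<Longrightarrow> sum f A \<in> ST"
  by (rule tensor_space.subspace_sum[OF symtensors_subspace])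

lemma pR_nonneg: "csn p \<Longrightarrow> f \<in> ST \<Longrightarrow> 0 \<le> pR p f"
  by (simp add: tensor_seminorm_nonneg csn_nonneg symtensors_in_tensors)

lemma pR_add: "csn p \<Longrightarrow> f \<in> ST \<Longrightarrow> g \<in> ST \<Longrightarrow> pR p (f + g) \<le> pR p f + pR p g"
  by (simp add: tensor_seminorm_add csn_nonneg symtensors_in_tensors)

lemma pR_diff: "csn p \<Longrightarrow> f \<in> ST \<Longrightarrow> g \<in> ST \<Longrightarrow> pR p (f - g) \<le> pR p f + pR p g"
  by (simp add: tensor_seminorm_diff csn_nonneg symtensors_in_tensors)

lemma pR_triangle: "csn p \<Longrightarrow> f \<in> ST \<Longrightarrow> g \<in> ST \<Longrightarrow> pR p f \<le> pR p (f - g) + pR p g"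
  using pR_add[of p "f - g" g] by (simp add: ST_diff)

lemma pR_minus_commute:
  assumes p: "csn p" and f: "f \<in> ST" and g: "g \<in> ST" shows "pR p (f - g) = pR p (g - f)"
proof -
  have "pR p (u - v) \<le> pR p (v - u)" if "u \<in> ST" "v \<in> ST" for u v
    using pR_diff[OF p ST_zero ST_diff[OF that(2,1)]] by (simp add: tensor_seminorm_zero csn_nonneg[OF p])
  from this[OF f g] this[OF g f] show ?thesis by simp
qed

lemma iota_zero: "\<iota> 0 = 0"
  using iota_scale[OF ST_zero, of 0] by simp

lemma iota_diff: "f \<in> ST \<Longrightarrow> g \<in> ST \<Longrightarrow> \<iota> (f - g) = \<iota> f - \<iota> g"
  using iota_add[of "f - g" g] by (simp add: ST_diff algebra_simps)

lemma iota_sum: "(\<And>i. i \<in> A \<Longrightarrow> f i \<in> ST) \<Longrightarrow> \<iota> (sum f A) = (\<Sum>i\<in>A. \<iota> (f i))"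
  by (induction A rule: infinite_finite_induct) (simp_all add: iota_zero iota_add ST_sum)

section \<open>Neighbourhoods in the symmetric algebra and in its completion\<close>

lemma openin_ball:
  assumes "csn p" "0 < e"
  shows "openin (sym_topology scl R) {f \<in> ST. pR p f < e}"
proof -
  have "openin (sym_topology scl R) {f \<in> ST. pR p (f - 0) < e}"
    unfolding sym_topology_def seminorm_topology_def
    by (rule topology_generated_by_Basis) (use assms ST_zero in blast)
  then show ?thesis by simp
qed

text \<open>The topology is given by a subbasis of balls around varying centres. The triangle
  inequality recentres a ball at \<open>f\<close>, and sums of seminorms replace finite
  intersections.\<close>

lemma openin_imp_ball:
  assumes "openin (sym_topology scl R) U" "f \<in> U"
  obtains p e where "csn p" "0 < e" "{g \<in> ST. pR p (g - f) < e} \<subseteq> U"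
proof -
  let ?B = "{{y \<in> ST. P (y - x) < e} | x P e. x \<in> ST \<and> P \<in> tensor_seminorm scl R ` {p. csn p} \<and> 0 < e}"
  have "generate_topology_on ?B U"
    using assms(1) by (simp add: sym_topology_def seminorm_topology_def openin_topology_generated_by_iff)
  then have "U \<subseteq> ST \<and> (\<forall>f\<in>U. \<exists>p e. csn p \<and> 0 < e \<and> {g \<in> ST. pR p (g - f) < e} \<subseteq> U)"
  proof (induction rule: generate_topology_on.induct)
    case (Int U V)
    have "\<exists>p e. csn p \<and> 0 < e \<and> {g \<in> ST. pR p (g - f) < e} \<subseteq> U \<inter> V" if f: "f \<in> U \<inter> V" for f
    proof -
      obtain p d where p: "csn p" "0 < d" "{g \<in> ST. pR p (g - f) < d} \<subseteq> U"
        using Int f by (meson IntD1)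
      obtain q e where q: "csn q" "0 < e" "{g \<in> ST. pR q (g - f) < e} \<subseteq> V"
        using Int f by (meson IntD2)
      have "pR p (g - f) \<le> pR (\<lambda>x. p x + q x) (g - f)" "pR q (g - f) \<le> pR (\<lambda>x. p x + q x) (g - f)"
        if "g \<in> ST" for g
        using that f Int by (auto intro!: tensor_seminorm_mono simp: csn_nonneg p q symtensors_in_tensors ST_diff subset_eq)
      then have "{g \<in> ST. pR (\<lambda>x. p x + q x) (g - f) < min d e} \<subseteq> U \<inter> V"
        using p(3) q(3) by force
      then show ?thesis
        using p(1,2) q(1,2) by (intro exI[of _ "\<lambda>x. p x + q x"] exI[of _ "min d e"]) (simp add: continuous_seminorm_plus)
    qed
    then show ?case using Int by blast
  next
    case (UN K)
    then show ?case by (meson Sup_least UnionE Union_upper subset_trans)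
  next
    case (Basis U)
    then obtain f0 p e where U: "U = {y \<in> ST. pR p (y - f0) < e}" "f0 \<in> ST" "csn p" "0 < e" by blast
    have sub: "{g \<in> ST. pR p (g - f) < e - pR p (f - f0)} \<subseteq> U" if "f \<in> U" for f
    proof
      fix g assume g: "g \<in> {g \<in> ST. pR p (g - f) < e - pR p (f - f0)}"
      then have "pR p (g - f0) \<le> pR p (g - f) + pR p (f - f0)"
        using pR_add[OF U(3), of "g - f" "f - f0"] that U by (simp add: ST_diff)
      then show "g \<in> U" using g U by simp
    qed
    show ?case
    proof (intro conjI ballI)
      show "U \<subseteq> ST" unfolding U(1) by blast
      fix f assume f: "f \<in> U"
      then have "0 < e - pR p (f - f0)" unfolding U(1) by simp
      with sub[OF f] U(3) show "\<exists>p e. csn p \<and> 0 < e \<and> {g \<in> ST. pR p (g - f) < e} \<subseteq> U" by blast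
    qed
  qed simp
  then show ?thesis using that assms(2) by blast
qed

lemma topspace_sym_topology: "topspace (sym_topology scl R) = ST"
proof
  show "ST \<subseteq> topspace (sym_topology scl R)"
  proof
    fix f assume f: "f \<in> ST"
    let ?p = "\<lambda>x::'a. 0::real"
    \<comment> \<open>The zero seminorm still induces the absolute value on degree 0, so the radius
      has to depend on \<open>f\<close>.\<close>
    have "0 < pR ?p f + 1" using pR_nonneg[OF continuous_seminorm_zero f] by simp
    from openin_subset[OF openin_ball[OF continuous_seminorm_zero this]]
    show "f \<in> topspace (sym_topology scl R)" by (rule subsetD) (simp add: f)
  qed
  show "topspace (sym_topology scl R) \<subseteq> ST"
    unfolding sym_topology_def seminorm_topology_def topology_generated_by_topspace by blast
qed

lemma iota_homeomorphic: "homeomorphic_map (sym_topology scl R) (subtopology euclidean (\<iota> ` ST)) \<iota>"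
  using iota_embedding unfolding embedding_map_def topspace_sym_topology .

lemma inj_on_iota: "inj_on \<iota> ST"
  using homeomorphic_imp_injective_map[OF iota_homeomorphic] unfolding topspace_sym_topology .

lemma neighbourhood_if_ball:
  assumes "csn p" "0 < e"
  obtains W where "open W" "0 \<in> W" "\<And>f. f \<in> ST \<Longrightarrow> \<iota> f \<in> W \<Longrightarrow> pR p f < e"
proof -
  let ?U = "{f \<in> ST. pR p f < e}"
  have "openin (subtopology euclidean (\<iota> ` ST)) (\<iota> ` ?U)"
    using homeomorphic_imp_open_map[OF iota_homeomorphic] openin_ball[OF assms] unfolding open_map_def by blast
  then obtain W where "openin euclidean W" and W2: "\<iota> ` ?U = W \<inter> \<iota> ` ST"
    unfolding openin_subtopology by (elim exE conjE)
  from open_openin[THEN iffD2, OF this(1)] W2 have W: "open W" "\<iota> ` ?U = W \<inter> \<iota> ` ST" .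
  show ?thesis
  proof
    have "\<iota> 0 \<in> \<iota> ` ?U"
      by (rule imageI) (simp add: ST_zero tensor_seminorm_zero csn_nonneg assms)
    then show "0 \<in> W" unfolding W(2) by (simp add: iota_zero)
    show "pR p f < e" if f: "f \<in> ST" "\<iota> f \<in> W" for f
    proof -
      have "\<iota> f \<in> \<iota> ` ?U" unfolding W(2) using f by blast
      then obtain g where g: "g \<in> ST" "pR p g < e" "\<iota> f = \<iota> g" by blast
      then show ?thesis using inj_onD[OF inj_on_iota g(3) f(1) g(1)] by simp
    qed
  qed (rule W)
qed

lemma ball_if_neighbourhood:
  assumes "open W" "0 \<in> W"
  obtains p e where "csn p" "0 < e" "\<And>f. f \<in> ST \<Longrightarrow> pR p f < e \<Longrightarrow> \<iota> f \<in> W"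
proof -
  have "openin (subtopology euclidean (\<iota> ` ST)) (W \<inter> \<iota> ` ST)"
    by (rule openin_subtopology_Int[OF open_openin[THEN iffD1, OF assms(1)]])
  from openin_continuous_map_preimage[OF homeomorphic_imp_continuous_map[OF iota_homeomorphic] this]
  have "openin (sym_topology scl R) {f \<in> topspace (sym_topology scl R). \<iota> f \<in> W \<inter> \<iota> ` ST}" .
  moreover have "0 \<in> {f \<in> topspace (sym_topology scl R). \<iota> f \<in> W \<inter> \<iota> ` ST}"
    using assms(2) ST_zero iota_zero by (metis (mono_tags, lifting) IntI imageI mem_Collect_eq topspace_sym_topology)
  ultimately obtain p e where "csn p" "0 < e" "{g \<in> ST. pR p (g - 0) < e} \<subseteq> {f \<in> topspace (sym_topology scl R). \<iota> f \<in> W \<inter> \<iota> ` ST}"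
    by (rule openin_imp_ball)
  then show ?thesis by (intro that[of p e]) (auto simp only: diff_zero)
qed

lemma dense_open:
  assumes "open V" "x \<in> V" obtains f where "f \<in> ST" "\<iota> f \<in> V"
  using open_Int_closure_eq_empty[OF assms(1), of "\<iota> ` ST"] assms(2) iota_dense by auto

text \<open>The principle by which identities and estimates pass to the completion: each of them
  defines a closed set that contains the image of \<iota>.\<close>

lemma dense_induct:
  assumes "closed {x. P x}" "\<And>f. f \<in> ST \<Longrightarrow> P (\<iota> f)" shows "P x"
proof -
  have "closure (\<iota> ` ST) \<subseteq> {x. P x}" using assms by (intro closure_minimal) auto
  then show ?thesis using iota_dense by auto
qed

lemma dense_induct2:
  assumes "closed {z. P (fst z) (snd z)}" "\<And>f g. f \<in> ST \<Longrightarrow> g \<in> ST \<Longrightarrow> P (\<iota> f) (\<iota> g)" shows "P x y"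
proof -
  have "closure (\<iota> ` ST \<times> \<iota> ` ST) \<subseteq> {z. P (fst z) (snd z)}" using assms by (intro closure_minimal) auto
  moreover have "(x, y) \<in> closure (\<iota> ` ST \<times> \<iota> ` ST)" by (simp add: closure_Times iota_dense)
  ultimately show ?thesis by auto
qed

section \<open>Seminorms on the completion\<close>

lemma hat_exists: "csn p \<Longrightarrow> \<exists>P. continuous_on UNIV P \<and> (\<forall>f\<in>ST. P (\<iota> f) = pR p f)"
proof -
  assume p: "csn p"
  define h where "h a = pR p (inv_into ST \<iota> a)" for a
  have h: "h (\<iota> f) = pR p f" if "f \<in> ST" for f
    using inv_into_f_f[OF inj_on_iota that] by (simp add: h_def)
  obtain P where P: "continuous_on UNIV P" "\<And>a. a \<in> \<iota> ` ST \<Longrightarrow> P a = h a"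
  proof (rule dense_extension[of "\<iota> ` ST" h])
    show "\<exists>y. F \<le> nhds y" if "F \<noteq> bot" "cauchy_filter_add F" for F :: "real filter"
      using that by (rule real_cauchy_filter_converges)
    show "closure (\<iota> ` ST) = UNIV" by (rule iota_dense)
    fix x and U :: "real set" assume "open U" "0 \<in> U"
    then obtain e where e: "0 < e" "ball 0 e \<subseteq> U" by (meson open_contains_ball)
    obtain W where W: "open W" "0 \<in> W" "\<And>f. f \<in> ST \<Longrightarrow> \<iota> f \<in> W \<Longrightarrow> pR p f < e"
      using neighbourhood_if_ball[OF p e(1)] by blast
    obtain V where V: "open V" "x \<in> V" "\<And>a b. a \<in> V \<Longrightarrow> b \<in> V \<Longrightarrow> a - b \<in> W"
      by (rule diff_neighbourhood[OF W(1,2), of x]) (rule that)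
    have "h a - h b \<in> U" if ab: "a \<in> V \<inter> \<iota> ` ST" "b \<in> V \<inter> \<iota> ` ST" for a b
    proof -
      obtain f g where fg: "a = \<iota> f" "b = \<iota> g" "f \<in> ST" "g \<in> ST" using ab by blast
      have "pR p (f - g) < e"
        using V(3)[of a b] ab fg by (intro W(3)) (auto simp: ST_diff iota_diff)
      then have "\<bar>h a - h b\<bar> < e"
        using pR_triangle[OF p fg(3,4)] pR_triangle[OF p fg(4,3)] pR_minus_commute[OF p fg(3,4)] fg
        by (simp add: h)
      then show ?thesis using e(2) by (auto simp: dist_norm)
    qed
    then show "\<exists>V. open V \<and> x \<in> V \<and> (\<forall>a\<in>V \<inter> \<iota> ` ST. \<forall>b\<in>V \<inter> \<iota> ` ST. h a - h b \<in> U)"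
      using V(1,2) by blast
  qed blast
  then show ?thesis using h by auto
qed

lemma
  assumes "csn p"
  shows continuous_on_hat: "continuous_on UNIV (hat p)" and hat_iota: "f \<in> ST \<Longrightarrow> hat p (\<iota> f) = pR p f"
proof -
  let ?A = "\<lambda>P. continuous_on UNIV P \<and> (\<forall>f\<in>ST. P (\<iota> f) = pR p f)"
  have "\<exists>!P. ?A P"
  proof (rule ex_ex1I)
    show "\<exists>P. ?A P" by (rule hat_exists[OF assms])
    fix P Q assume PQ: "?A P" "?A Q"
    have "P x = Q x" for x
      by (rule dense_induct[where P = "\<lambda>x. P x = Q x"]) (use PQ in \<open>auto intro!: closed_Collect_eq\<close>)
    then show "P = Q" by blast
  qed
  from theI'[OF this] show "continuous_on UNIV (hat p)" "f \<in> ST \<Longrightarrow> hat p (\<iota> f) = pR p f"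
    unfolding tensor_seminorm_hat_def ext_seminorm_def by blast+
qed

lemma continuous_on_hat_compose:
  "csn p \<Longrightarrow> continuous_on A f \<Longrightarrow> continuous_on A (\<lambda>x. hat p (f x))"
  using continuous_on_compose2[OF continuous_on_hat] by blast

lemma continuous_on_cscale: "continuous_on A f \<Longrightarrow> continuous_on A (\<lambda>x. cscale c (f x))"
  using continuous_on_compose2[OF continuous_scale, of A "\<lambda>x. (c, f x)"] by (simp add: continuous_intros)

lemmas hat_continuous_intros = continuous_intros continuous_on_hat_compose continuous_on_cscale

context
  fixes p assumes p: "csn p"
begin

lemma hat_zero: "hat p 0 = 0"
  using hat_iota[OF p ST_zero] by (simp add: iota_zero tensor_seminorm_zero csn_nonneg[OF p])

lemma hat_nonneg: "0 \<le> hat p x"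
proof (rule dense_induct[where P = "\<lambda>x. 0 \<le> hat p x"])
  show "closed {x. 0 \<le> hat p x}" by (intro closed_Collect_le hat_continuous_intros p)
  show "0 \<le> hat p (\<iota> f)" if "f \<in> ST" for f
    using pR_nonneg[OF p that] by (simp only: hat_iota[OF p that])
qed

lemma hat_add: "hat p (x + y) \<le> hat p x + hat p y"
proof (rule dense_induct2[where P = "\<lambda>x y. hat p (x + y) \<le> hat p x + hat p y"])
  show "closed {z. hat p (fst z + snd z) \<le> hat p (fst z) + hat p (snd z)}"
    by (intro closed_Collect_le hat_continuous_intros p)
  show "hat p (\<iota> f + \<iota> g) \<le> hat p (\<iota> f) + hat p (\<iota> g)" if "f \<in> ST" "g \<in> ST" for f g
    unfolding iota_add[OF that, symmetric] hat_iota[OF p that(1)] hat_iota[OF p that(2)]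
      hat_iota[OF p ST_add[OF that]] by (rule pR_add[OF p that])
qed

lemma hat_diff: "hat p (x - y) \<le> hat p x + hat p y"
proof (rule dense_induct2[where P = "\<lambda>x y. hat p (x - y) \<le> hat p x + hat p y"])
  show "closed {z. hat p (fst z - snd z) \<le> hat p (fst z) + hat p (snd z)}"
    by (intro closed_Collect_le hat_continuous_intros p)
  show "hat p (\<iota> f - \<iota> g) \<le> hat p (\<iota> f) + hat p (\<iota> g)" if "f \<in> ST" "g \<in> ST" for f g
    unfolding iota_diff[OF that, symmetric] hat_iota[OF p that(1)] hat_iota[OF p that(2)]
      hat_iota[OF p ST_diff[OF that]] by (rule pR_diff[OF p that])
qed

lemma hat_scale: "hat p (cscale c x) \<le> norm c * hat p x"
proof (rule dense_induct[where P = "\<lambda>x. hat p (cscale c x) \<le> norm c * hat p x"])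
  show "closed {x. hat p (cscale c x) \<le> norm c * hat p x}"
    by (intro closed_Collect_le hat_continuous_intros p)
  show "hat p (cscale c (\<iota> f)) \<le> norm c * hat p (\<iota> f)" if "f \<in> ST" for f
    unfolding iota_scale[OF that, symmetric] hat_iota[OF p that] hat_iota[OF p ST_scale[OF that]]
    by (rule tensor_seminorm_scale[OF csn_nonneg[OF p] symtensors_in_tensors[OF that]])
qed

end

text \<open>The extended seminorms describe the topology of the whole completion: a small
  \<open>x\<close> is approximated by some \<open>\<iota> f\<close> that is still small, and
  \<open>x\<close> is recovered as \<open>\<iota> f - (\<iota> f - x)\<close>.\<close>

lemma ball_if_neighbourhood_hat:
  assumes "open W" "0 \<in> W"
  obtains p e where "csn p" "0 < e" "\<And>x. hat p x < e \<Longrightarrow> x \<in> W"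
proof -
  obtain W1 where W1: "open W1" "0 \<in> W1" "\<And>a b. a \<in> W1 \<Longrightarrow> b \<in> W1 \<Longrightarrow> a - b \<in> W"
    using diff_neighbourhood[OF assms, of 0] by blast
  obtain p e where p: "csn p" "0 < e" "\<And>f. f \<in> ST \<Longrightarrow> pR p f < e \<Longrightarrow> \<iota> f \<in> W1"
    using ball_if_neighbourhood[OF W1(1,2)] by blast
  have "x \<in> W" if x: "hat p x < e" for x
  proof -
    have "open ({y. hat p y < e} \<inter> (\<lambda>y. y - x) -` W1)"
      by (intro open_Int open_Collect_less open_vimage W1 hat_continuous_intros p)
    moreover have "x \<in> {y. hat p y < e} \<inter> (\<lambda>y. y - x) -` W1" using x W1(2) by simp
    ultimately obtain f where f: "f \<in> ST" "\<iota> f \<in> {y. hat p y < e} \<inter> (\<lambda>y. y - x) -` W1"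
      by (rule dense_open)
    then have "\<iota> f - (\<iota> f - x) \<in> W" using p by (intro W1(3)) (auto simp: hat_iota)
    then show ?thesis by simp
  qed
  with p(1,2) show ?thesis by (rule that)
qed

lemma tendsto_if_hat:
  assumes "\<And>p. csn p \<Longrightarrow> ((\<lambda>i. hat p (X i - x)) \<longlongrightarrow> 0) F"
  shows "(X \<longlongrightarrow> x) F"
proof (rule topological_tendstoI)
  fix U assume "open U" "x \<in> U"
  have "open ((\<lambda>y. x + y) -` U)" by (rule open_vimage[OF \<open>open U\<close>]) (intro continuous_intros)
  moreover have "0 \<in> (\<lambda>y. x + y) -` U" using \<open>x \<in> U\<close> by simp
  ultimately obtain p e where p: "csn p" "0 < e" "\<And>y. hat p y < e \<Longrightarrow> y \<in> (\<lambda>y. x + y) -` U"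
    by (rule ball_if_neighbourhood_hat) (rule that)
  have "\<forall>\<^sub>F i in F. hat p (X i - x) < e"
    using order_tendstoD(2)[OF assms[OF p(1)] p(2)] .
  then show "\<forall>\<^sub>F i in F. X i \<in> U"
  proof (rule eventually_mono)
    show "X i \<in> U" if "hat p (X i - x) < e" for i using p(3)[OF that] by simp
  qed
qed

section \<open>Extension of products to the completion\<close>

definition continuous_biadditive :: "(('a, 'k) tensor \<Rightarrow> ('a, 'k) tensor \<Rightarrow> ('a, 'k) tensor) \<Rightarrow> bool" where
  "continuous_biadditive B \<longleftrightarrow>
    (\<forall>f\<in>ST. \<forall>g\<in>ST. B f g \<in> ST) \<and>
    (\<forall>f\<in>ST. \<forall>f'\<in>ST. \<forall>g\<in>ST. B (f + f') g = B f g + B f' g) \<and>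
    (\<forall>f\<in>ST. \<forall>g\<in>ST. \<forall>g'\<in>ST. B f (g + g') = B f g + B f g') \<and>
    (\<forall>p. csn p \<longrightarrow> (\<exists>q. csn q \<and> (\<forall>f\<in>ST. \<forall>g\<in>ST. pR p (B f g) \<le> pR q f * pR q g)))"

lemma ext_binary_exists:
  assumes B: "continuous_biadditive B"
  shows "\<exists>F. continuous_on UNIV (\<lambda>(x, y). F x y) \<and> (\<forall>f\<in>ST. \<forall>g\<in>ST. F (\<iota> f) (\<iota> g) = \<iota> (B f g))"
proof -
  have closed: "B f g \<in> ST" and left: "B (f + f') g = B f g + B f' g" and right: "B f (g + g') = B f g + B f g'"
    if "f \<in> ST" "f' \<in> ST" "g \<in> ST" "g' \<in> ST" for f f' g g'
    using B that unfolding continuous_biadditive_def by simp_all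
  define h where "h = (\<lambda>(a, b). \<iota> (B (inv_into ST \<iota> a) (inv_into ST \<iota> b)))"
  have h: "h (\<iota> f, \<iota> g) = \<iota> (B f g)" if "f \<in> ST" "g \<in> ST" for f g
    using inv_into_f_f[OF inj_on_iota] that by (simp add: h_def)
  let ?D = "\<iota> ` ST \<times> \<iota> ` ST"
  obtain F where F: "continuous_on UNIV F" "\<And>z. z \<in> ?D \<Longrightarrow> F z = h z"
  proof (rule dense_extension[of ?D h])
    show "\<exists>y. F \<le> nhds y" if "F \<noteq> bot" "cauchy_filter_add F" for F :: "'c filter"
      using that by (rule complete)
    show "closure ?D = UNIV" by (simp add: closure_Times iota_dense)
    fix z and U :: "'c set" assume U: "open U" "0 \<in> U"
    obtain p e where p: "csn p" "0 < e" "\<And>f. f \<in> ST \<Longrightarrow> pR p f < e \<Longrightarrow> \<iota> f \<in> U"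
      using ball_if_neighbourhood[OF U] by blast
    obtain q where q: "csn q" "\<And>f g. f \<in> ST \<Longrightarrow> g \<in> ST \<Longrightarrow> pR p (B f g) \<le> pR q f * pR q g"
      using B p(1) unfolding continuous_biadditive_def by blast
    define K where "K = hat q (fst z) + hat q (snd z) + 2"
    \<comment> \<open>In V both arguments of the product differ by at most \<open>2 * d\<close> in
      the seminorm of \<open>q\<close>, and the two fixed factors add up to at most
      \<open>K\<close>. The difference of the values is therefore at most \<open>2 * d * K\<close>,
      that is, at most e / 2.\<close>
    define d where "d = min 1 (e / (4 * K))"
    have K: "0 < K" using hat_nonneg[OF q(1), of "fst z"] hat_nonneg[OF q(1), of "snd z"] by (simp add: K_def)
    have d: "0 < d" "d \<le> 1" "4 * K * d \<le> e" using K p(2) by (auto simp: d_def field_simps min_def)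
    define V where "V = {w. hat q (fst w - fst z) < d} \<inter> {w. hat q (snd w - snd z) < d}"
    have V: "open V" "z \<in> V"
      unfolding V_def using d(1)
      by (auto intro!: open_Int open_Collect_less hat_continuous_intros q simp: hat_zero[OF q(1)])
    have "h w - h w' \<in> U" if w: "w \<in> V \<inter> ?D" "w' \<in> V \<inter> ?D" for w w'
    proof -
      obtain f g where fg: "w = (\<iota> f, \<iota> g)" "f \<in> ST" "g \<in> ST" using w(1) by auto
      obtain f' g' where fg': "w' = (\<iota> f', \<iota> g')" "f' \<in> ST" "g' \<in> ST" using w(2) by auto
      have near: "hat q (a - c) < d \<Longrightarrow> hat q (b - c) < d \<Longrightarrow> hat q (a - b) \<le> 2 * d" for a b c
        using hat_diff[OF q(1), of "a - c" "b - c"] by simp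
      have bound: "hat q (a - c) < d \<Longrightarrow> hat q a \<le> hat q c + 1" for a c
        using hat_add[OF q(1), of "a - c" c] d(2) by simp
      have 1: "pR q (f - f') \<le> 2 * d" "pR q (g - g') \<le> 2 * d"
        using w near[of "\<iota> f" "fst z" "\<iota> f'"] near[of "\<iota> g" "snd z" "\<iota> g'"] fg fg'
        by (simp_all add: V_def hat_iota[OF q(1)] ST_diff flip: iota_diff)
      have 2: "pR q g + pR q f' \<le> K"
        using w bound[of "\<iota> f'" "fst z"] bound[of "\<iota> g" "snd z"] fg fg'
        by (simp add: V_def hat_iota[OF q(1)] K_def)
      have "B f g - B f' g' = B (f - f') g + B f' (g - g')"
        using left[of "f - f'" f' g g] right[of f' f' "g - g'" g'] fg fg' by (simp add: ST_diff)
      then have "pR p (B f g - B f' g') \<le> pR p (B (f - f') g) + pR p (B f' (g - g'))"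
        using fg fg' closed by (simp add: pR_add[OF p(1)] ST_diff)
      also have "\<dots> \<le> pR q (f - f') * pR q g + pR q f' * pR q (g - g')"
        using fg fg' by (intro add_mono q ST_diff)
      also have "\<dots> \<le> 2 * d * pR q g + pR q f' * (2 * d)"
        using fg fg' 1 by (intro add_mono mult_left_mono mult_right_mono pR_nonneg q ST_diff)
      also have "\<dots> = 2 * d * (pR q g + pR q f')" by (simp add: algebra_simps)
      also have "\<dots> \<le> 2 * d * K" using 2 d(1) by (intro mult_left_mono) simp_all
      also have "\<dots> < e" using d K p(2) by (simp add: mult_ac)
      finally have "\<iota> (B f g - B f' g') \<in> U"
        using fg fg' closed by (intro p(3)) (simp_all add: ST_diff)
      then show ?thesis using fg fg' closed by (simp add: h iota_diff)
    qed
    then show "\<exists>V. open V \<and> z \<in> V \<and> (\<forall>a\<in>V \<inter> ?D. \<forall>b\<in>V \<inter> ?D. h a - h b \<in> U)"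
      using V by blast
  qed blast
  then show ?thesis
    using h by (intro exI[of _ "\<lambda>x y. F (x, y)"]) auto
qed

lemma
  assumes "continuous_biadditive B"
  shows continuous_on_ext_binary: "continuous_on UNIV (\<lambda>(x, y). ext_binary scl \<iota> B x y)"
    and ext_binary_iota: "f \<in> ST \<Longrightarrow> g \<in> ST \<Longrightarrow> ext_binary scl \<iota> B (\<iota> f) (\<iota> g) = \<iota> (B f g)"
proof -
  let ?A = "\<lambda>F. continuous_on UNIV (\<lambda>(x, y). F x y) \<and> (\<forall>f\<in>ST. \<forall>g\<in>ST. F (\<iota> f) (\<iota> g) = \<iota> (B f g))"
  have unique: "F = G" if F: "?A F" and G: "?A G" for F G
  proof (intro ext)
    fix x y
    show "F x y = G x y"
    proof (rule dense_induct2[where P = "\<lambda>x y. F x y = G x y"])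
      show "closed {z. F (fst z) (snd z) = G (fst z) (snd z)}"
        using conjunct1[OF F] conjunct1[OF G] unfolding case_prod_unfold by (rule closed_Collect_eq)
      show "F (\<iota> f) (\<iota> g) = G (\<iota> f) (\<iota> g)" if "f \<in> ST" "g \<in> ST" for f g
        using conjunct2[OF F] conjunct2[OF G] that by simp
    qed
  qed
  have "\<exists>!F. ?A F"
    using ext_binary_exists[OF assms] unique by (rule ex_ex1I)
  from theI'[OF this] show "continuous_on UNIV (\<lambda>(x, y). ext_binary scl \<iota> B x y)"
    "f \<in> ST \<Longrightarrow> g \<in> ST \<Longrightarrow> ext_binary scl \<iota> B (\<iota> f) (\<iota> g) = \<iota> (B f g)"
    unfolding ext_binary_def by blast+
qed

lemma continuous_on_ext_binary_compose:
  assumes "continuous_biadditive B" "continuous_on A u" "continuous_on A v"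
  shows "continuous_on A (\<lambda>x. ext_binary scl \<iota> B (u x) (v x))"
  using continuous_on_compose2[OF continuous_on_ext_binary[OF assms(1)] continuous_on_Pair[OF assms(2,3)]]
  by simp

end

lemma ext_binary_cong:
  assumes "\<And>f g. f \<in> symtensors scl \<Longrightarrow> g \<in> symtensors scl \<Longrightarrow> B f g = B' f g"
  shows "ext_binary scl \<iota> B = ext_binary scl \<iota> B'"
proof -
  have "(\<forall>f\<in>symtensors scl. \<forall>g\<in>symtensors scl. F (\<iota> f) (\<iota> g) = \<iota> (B f g)) \<longleftrightarrow>
      (\<forall>f\<in>symtensors scl. \<forall>g\<in>symtensors scl. F (\<iota> f) (\<iota> g) = \<iota> (B' f g))" for F
    using assms by (intro ball_cong refl) simp
  then show ?thesis unfolding ext_binary_def by presburger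
qed

section \<open>The star product on the completion\<close>

locale gutt_completion = vector_completion scl R cscale \<iota> + L: AE_lie_algebra scl br
  for scl :: "'k::real_normed_field \<Rightarrow> 'a::{topological_ab_group_add, t2_space} \<Rightarrow> 'a"
    and R :: real
    and cscale :: "'k \<Rightarrow> 'c::{topological_ab_group_add, t2_space} \<Rightarrow> 'c"
    and \<iota> :: "('a, 'k) tensor \<Rightarrow> 'c"
    and br :: "'a \<Rightarrow> 'a \<Rightarrow> 'a" +
  assumes R_ge_1: "1 \<le> R"
begin

sublocale A: normed_field_lie_algebra scl br ..

text \<open>\<open>GB a\<close> is the product \<open>\<Sum>\<^sub>n a n C\<^sub>n\<close> on
  symmetric tensors and \<open>GH a\<close> its extension; in this way all products in question form
  one family, linear in the sequence \<open>a\<close>.\<close>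

abbreviation "GB a \<equiv> (\<lambda>f g. graded_normal_order scl br a (tmult scl f g))"
abbreviation "GH a \<equiv> ext_binary scl \<iota> (GB a)"

text \<open>No constant in front: in degree 0 no rescaling of the seminorm could absorb it, and
  \<open>continuous_biadditive\<close> asks for an estimate without constants.\<close>

definition geometric :: "(nat \<Rightarrow> 'k) \<Rightarrow> bool" where
  "geometric a \<longleftrightarrow> (\<exists>c\<ge>1. \<forall>n. norm (a n) \<le> c ^ n)"

text \<open>One \<open>q\<close> serves all sequences \<open>a\<close> with the same growth rate
  \<open>c\<close>, and the estimate is proportional to \<open>A\<close>. This uniformity is what
  makes Taylor remainders tend to 0 as soon as their scalar coefficients do.\<close>

definition dominating :: "('a \<Rightarrow> real) \<Rightarrow> real \<Rightarrow> ('a \<Rightarrow> real) \<Rightarrow> bool" where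
  "dominating p c q \<longleftrightarrow> csn q \<and> (\<forall>a A f g. 0 \<le> A \<longrightarrow> (\<forall>n. norm (a n) \<le> A * c ^ n) \<longrightarrow>
    f \<in> ST \<longrightarrow> g \<in> ST \<longrightarrow> pR p (GB a f g) \<le> A * (pR q f * pR q g))"

lemma dominating_exists:
  assumes p: "csn p" and c: "1 \<le> c"
  shows "\<exists>q. dominating p c q"
proof -
  obtain q where q: "csn q" "asymptotic_estimate br p q"
    using L.asymptotic_estimates[OF p] by blast
  have "csn (\<lambda>x. 2 powr R * (8 * c * q x))"
    using c by (intro continuous_seminorm_scaled q) simp_all
  moreover have "pR p (GB a f g) \<le> A * (pR (\<lambda>x. 2 powr R * (8 * c * q x)) f * pR (\<lambda>x. 2 powr R * (8 * c * q x)) g)"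
    if "0 \<le> A" "\<forall>n. norm (a n) \<le> A * c ^ n" "f \<in> ST" "g \<in> ST" for a A f g
    by (rule A.tensor_seminorm_G[OF q(2) csn_nonneg[OF p] csn_nonneg[OF q(1)] R_ge_1 that(1) c that(2)[rule_format]
          symtensors_in_tensors[OF that(3)] symtensors_in_tensors[OF that(4)]])
  ultimately have "dominating p c (\<lambda>x. 2 powr R * (8 * c * q x))"
    unfolding dominating_def by simp
  then show ?thesis by (intro exI[where x = "\<lambda>x. 2 powr R * (8 * c * q x)"])
qed

lemma GB_closed: "f \<in> ST \<Longrightarrow> g \<in> ST \<Longrightarrow> GB a f g \<in> ST"
  by (simp add: A.G_in_symtensors tmult_in_tensors symtensors_in_tensors)

lemma
  assumes "f \<in> ST" "f' \<in> ST" "g \<in> ST"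
  shows GB_add_left: "GB a (f + f') g = GB a f g + GB a f' g"
    and GB_add_right: "GB a g (f + f') = GB a g f + GB a g f'"
    and GB_scale_left: "GB a (tscale c f) g = tscale c (GB a f g)"
    and GB_scale_right: "GB a g (tscale c f) = tscale c (GB a g f)"
  using assms
  by (simp_all add: tmult_add_left tmult_add_right tmult_scale_left tmult_scale_right
      symtensors_in_tensors A.G_add A.G_scale)

lemma continuous_biadditive_GB:
  assumes "geometric a" shows "continuous_biadditive (GB a)"
proof -
  obtain c where c: "1 \<le> c" "\<And>n. norm (a n) \<le> c ^ n"
    using assms unfolding geometric_def by blast
  have "\<exists>q. csn q \<and> (\<forall>f\<in>ST. \<forall>g\<in>ST. pR p (GB a f g) \<le> pR q f * pR q g)" if p: "csn p" for p
  proof -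
    obtain q where q: "dominating p c q" using dominating_exists[OF p c(1)] ..
    have "pR p (GB a f g) \<le> pR q f * pR q g" if "f \<in> ST" "g \<in> ST" for f g
      using q[unfolded dominating_def, THEN conjunct2, THEN spec, of a, THEN spec, of 1] c(2) that by simp
    moreover have "csn q" using q by (simp add: dominating_def)
    ultimately show ?thesis by blast
  qed
  then show ?thesis
    unfolding continuous_biadditive_def by (simp add: GB_closed GB_add_left GB_add_right)
qed

lemmas continuous_on_GH = continuous_on_ext_binary_compose[OF continuous_biadditive_GB]

lemma GH_iota: "geometric a \<Longrightarrow> f \<in> ST \<Longrightarrow> g \<in> ST \<Longrightarrow> GH a (\<iota> f) (\<iota> g) = \<iota> (GB a f g)"
  by (rule ext_binary_iota[OF continuous_biadditive_GB])

lemma GB_diff_sum: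
  assumes "f \<in> ST" "g \<in> ST"
  shows "GB (\<lambda>n. a n - (\<Sum>i\<in>I. d i * b i n)) f g = GB a f g - (\<Sum>i\<in>I. tscale (d i) (GB (b i) f g))"
proof -
  have t: "tmult scl f g \<in> tensors scl" using assms by (intro tmult_in_tensors symtensors_in_tensors)
  \<comment> \<open>A difference is read as a sum of two terms with coefficients 1 and -1, so that
    \<open>G_sum_left\<close> covers it.\<close>
  have "A.G (\<lambda>n. \<Sum>i\<in>{0::nat, 1}. (if i = 0 then 1 else -1) * (if i = 0 then a n else \<Sum>i\<in>I. d i * b i n)) (tmult scl f g)
      = (\<Sum>i\<in>{0::nat, 1}. tscale (if i = 0 then 1 else -1)
          (A.G (\<lambda>n. if i = 0 then a n else \<Sum>i\<in>I. d i * b i n) (tmult scl f g)))"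
    by (rule A.G_sum_left[OF t])
  then show ?thesis by (simp add: A.G_sum_left[OF t])
qed

text \<open>By linearity in the coefficient sequence the remainder of the products is the product
  for the scalar remainder. It is used for partial sums of Taylor series, for difference quotients
  and, with \<open>I\<close> empty, for a single product.\<close>

lemma hat_GH_remainder:
  fixes d :: "nat \<Rightarrow> 'k"
  assumes p: "csn p" and q: "dominating p c q" and a: "geometric a" and b: "\<And>i. geometric (b i)" and A: "0 \<le> A"
    and le: "\<And>n. norm (a n - (\<Sum>i\<in>I. d i * b i n)) \<le> A * c ^ n"
  shows "hat p (GH a x y - (\<Sum>i\<in>I. cscale (d i) (GH (b i) x y))) \<le> A * (hat q x * hat q y)"
proof -
  have csn_q: "csn q" using q by (simp add: dominating_def)
  let ?P = "\<lambda>x y. hat p (GH a x y - (\<Sum>i\<in>I. cscale (d i) (GH (b i) x y))) \<le> A * (hat q x * hat q y)"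
  show "?P x y"
  proof (rule dense_induct2[where P = ?P])
    show "closed {z. ?P (fst z) (snd z)}"
      by (intro closed_Collect_le hat_continuous_intros continuous_on_GH p csn_q a b)
    show "?P (\<iota> f) (\<iota> g)" if f: "f \<in> ST" and g: "g \<in> ST" for f g
    proof -
      let ?r = "\<lambda>n. a n - (\<Sum>i\<in>I. d i * b i n)"
      have "pR p (GB ?r f g) \<le> A * (pR q f * pR q g)"
        by (rule q[unfolded dominating_def, THEN conjunct2, rule_format, OF A le f g])
      moreover have "GH a (\<iota> f) (\<iota> g) - (\<Sum>i\<in>I. cscale (d i) (GH (b i) (\<iota> f) (\<iota> g))) = \<iota> (GB ?r f g)"
        using f g
        by (simp add: GH_iota a b GB_diff_sum iota_diff iota_sum iota_scale GB_closed ST_scale ST_sum)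
      ultimately show ?thesis
        using f g by (simp add: hat_iota p csn_q GB_closed)
    qed
  qed
qed

section \<open>Taylor expansion in the deformation parameter\<close>

definition taylor_coeff :: "'k \<Rightarrow> nat \<Rightarrow> nat \<Rightarrow> 'k" where
  "taylor_coeff z0 m n = of_nat (n choose m) * z0 ^ (n - m)"

text \<open>For \<open>n \<ge> N\<close> the factor \<open>t ^ N\<close> can be pulled out of
  \<open>(t * s) ^ n\<close>; the rest of the binomial tail is completed to the full expansion of
  \<open>(norm z0 + s) ^ i\<close>. The growth rate is thus independent of \<open>N\<close>, as
  \<open>dominating\<close> requires.\<close>

lemma taylor_remainder:
  assumes w: "norm w \<le> t * s" and t: "0 \<le> t" "t \<le> 1" and s: "0 \<le> s"
  shows "norm ((z0 + w) ^ i - (\<Sum>n<N. w ^ n * taylor_coeff z0 n i)) \<le> t ^ N * (norm z0 + s) ^ i"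
proof -
  \<comment> \<open>A common range for the partial sum and for the whole expansion; terms beyond
    \<open>i\<close> have binomial coefficient 0.\<close>
  define K where "K = max N (Suc i)"
  let ?u = "\<lambda>n. w ^ n * taylor_coeff z0 n i"
  \<comment> \<open>Stated for any commutative semiring because it is used both in the ground field
    and for the norms.\<close>
  have sum: "(v + u) ^ i = (\<Sum>n<K. u ^ n * (of_nat (i choose n) * v ^ (i - n)))" for u v :: "'b::comm_semiring_1"
  proof -
    have "(v + u) ^ i = (\<Sum>n\<le>i. of_nat (i choose n) * u ^ n * v ^ (i - n))"
      using binomial_ring[of u v i] by (simp add: add.commute)
    also have "\<dots> = (\<Sum>n<K. of_nat (i choose n) * u ^ n * v ^ (i - n))"
      by (rule sum.mono_neutral_left) (auto simp: K_def not_le binomial_eq_0)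
    finally show ?thesis by (simp add: mult_ac)
  qed
  have "{..<K} = {..<N} \<union> {N..<K}" "{..<N} \<inter> {N..<K} = {}" by (auto simp: K_def)
  then have "(\<Sum>n<K. ?u n) = (\<Sum>n<N. ?u n) + (\<Sum>n=N..<K. ?u n)"
    by (simp add: sum.union_disjoint)
  then have "(z0 + w) ^ i - (\<Sum>n<N. ?u n) = (\<Sum>n=N..<K. ?u n)"
    unfolding sum[of z0 w] taylor_coeff_def by simp
  also have "norm \<dots> \<le> (\<Sum>n=N..<K. t ^ N * (s ^ n * (real (i choose n) * norm z0 ^ (i - n))))"
  proof (rule sum_norm_le)
    fix n assume n: "n \<in> {N..<K}"
    have "norm w ^ n \<le> (t * s) ^ n" using w by (intro power_mono) simp_all
    also have "\<dots> \<le> t ^ N * s ^ n"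
      unfolding power_mult_distrib using n t s by (intro mult_right_mono power_decreasing) simp_all
    finally have "norm w ^ n * (real (i choose n) * norm z0 ^ (i - n)) \<le> t ^ N * s ^ n * (real (i choose n) * norm z0 ^ (i - n))"
      by (intro mult_right_mono) simp_all
    then show "norm (?u n) \<le> t ^ N * (s ^ n * (real (i choose n) * norm z0 ^ (i - n)))"
      by (simp add: taylor_coeff_def norm_mult norm_power mult.assoc)
  qed
  also have "\<dots> = t ^ N * (\<Sum>n=N..<K. s ^ n * (real (i choose n) * norm z0 ^ (i - n)))"
    by (simp add: sum_distrib_left)
  also have "\<dots> \<le> t ^ N * (\<Sum>n<K. s ^ n * (real (i choose n) * norm z0 ^ (i - n)))"
    using t s by (intro mult_left_mono sum_mono2) auto
  also have "\<dots> = t ^ N * (norm z0 + s) ^ i" by (simp add: sum[of "norm z0" s])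
  finally show ?thesis .
qed

text \<open>The Cauchy estimate at radius \<open>K\<close>, obtained by keeping one term of the
  expansion of \<open>(norm z0 + K) ^ n\<close>.\<close>

lemma norm_taylor_coeff_le:
  assumes K: "1 \<le> K" shows "norm (taylor_coeff z0 m n) \<le> (1 / K ^ m) * (norm z0 + K) ^ n"
proof (cases "m \<le> n")
  case True
  have "K ^ m * (real (n choose m) * norm z0 ^ (n - m)) \<le> (\<Sum>j\<le>n. real (n choose j) * K ^ j * norm z0 ^ (n - j))"
    using member_le_sum[of m "{..n}" "\<lambda>j. real (n choose j) * K ^ j * norm z0 ^ (n - j)"] True K
    by (simp add: mult_ac)
  also have "\<dots> = (norm z0 + K) ^ n"
    using binomial_ring[of K "norm z0" n] by (simp add: add.commute)
  finally have "real (n choose m) * norm z0 ^ (n - m) \<le> (norm z0 + K) ^ n / K ^ m"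
    using K by (simp add: pos_le_divide_eq mult.commute)
  then show ?thesis by (simp add: taylor_coeff_def norm_mult norm_power)
next
  case False
  then show ?thesis using K by (simp add: taylor_coeff_def binomial_eq_0)
qed

lemma geometric_taylor_coeff: "geometric (taylor_coeff z0 m)"
  unfolding geometric_def
  using norm_taylor_coeff_le[of 1 z0 m] by (intro exI[of _ "norm z0 + 1"]) simp

lemma geometric_power: "geometric (\<lambda>n. z ^ n)"
  unfolding geometric_def
  by (intro exI[of _ "norm z + 1"]) (simp add: norm_power power_mono)

abbreviation "star z \<equiv> GH (\<lambda>n. z ^ n)"

lemma gutt_star_hat_eq: "gutt_star_hat scl br \<iota> z = star z"
  unfolding gutt_star_hat_def by (rule ext_binary_cong) (rule A.gutt_star_eq)

text \<open>With 0^0 = 1 the Taylor coefficients at 0 are indicator sequences, so the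
  \<open>C\<^sub>n\<close> are the Taylor coefficients of the star product at 0.\<close>

lemma gutt_C_hat_eq: "gutt_C_hat scl br \<iota> n = GH (taylor_coeff 0 n)"
proof -
  have "taylor_coeff 0 n = (\<lambda>i. if i = n then 1 else 0)"
    by (rule ext) (auto simp: taylor_coeff_def power_0_left binomial_eq_0)
  then show ?thesis
    unfolding gutt_C_hat_def by (intro ext_binary_cong) (simp add: A.gutt_C_eq)
qed

lemma symmult_hat_eq: "symmult_hat scl \<iota> = star 0"
  unfolding symmult_hat_def
  by (rule ext_binary_cong) (simp only: A.gutt_star_0[symmetric] A.gutt_star_eq)

lemma star_sums: "(\<lambda>n. cscale (w ^ n) (GH (taylor_coeff z0 n) x y)) sums star (z0 + w) x y"
  unfolding sums_def
proof (rule tendsto_if_hat)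
  fix p assume p: "csn p"
  \<comment> \<open>In \<open>taylor_remainder\<close> take \<open>t = 1 / 2\<close> and
    \<open>s = 2 * norm w + 1\<close>: the remainder decays like 2^(-N) for every \<open>w\<close>,
    with one \<open>c\<close> and hence one \<open>q\<close> for all \<open>N\<close>. The summand 1
    ensures \<open>1 \<le> c\<close>.\<close>
  define c where "c = norm z0 + (2 * norm w + 1)"
  have c: "1 \<le> c" by (simp add: c_def)
  obtain q where q: "dominating p c q" using dominating_exists[OF p c] ..
  then have csn_q: "csn q" by (simp add: dominating_def)
  note remainder = hat_GH_remainder[OF p q]
  have le: "hat p ((\<Sum>n<N. cscale (w ^ n) (GH (taylor_coeff z0 n) x y)) - star (z0 + w) x y) \<le>
      (1 / 2) ^ N * (hat q x * hat q y)" for N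
  proof -
    let ?s = "\<Sum>n<N. cscale (w ^ n) (GH (taylor_coeff z0 n) x y)"
    have "norm ((z0 + w) ^ i - (\<Sum>n<N. w ^ n * taylor_coeff z0 n i)) \<le> (1 / 2) ^ N * c ^ i" for i
      unfolding c_def by (rule taylor_remainder) simp_all
    then have "hat p (star (z0 + w) x y - ?s) \<le> (1 / 2) ^ N * (hat q x * hat q y)"
      by (intro remainder geometric_power geometric_taylor_coeff) simp_all
    moreover have "hat p (?s - star (z0 + w) x y) \<le> hat p (star (z0 + w) x y - ?s)"
      using hat_diff[OF p, of 0 "star (z0 + w) x y - ?s"] by (simp add: hat_zero[OF p])
    ultimately show ?thesis by (rule order_trans[rotated])
  qed
  have "(\<lambda>N. (1 / 2) ^ N * (hat q x * hat q y)) \<longlonglongrightarrow> 0 * (hat q x * hat q y)"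
    by (intro tendsto_intros LIMSEQ_realpow_zero) simp_all
  then have lim: "(\<lambda>N. (1 / 2) ^ N * (hat q x * hat q y)) \<longlonglongrightarrow> 0" by simp
  show "(\<lambda>N. hat p ((\<Sum>n<N. cscale (w ^ n) (GH (taylor_coeff z0 n) x y)) - star (z0 + w) x y)) \<longlonglongrightarrow> 0"
    by (rule tendsto_sandwich[OF _ _ tendsto_const lim]) (simp_all add: le hat_nonneg[OF p])
qed

lemma star_absolutely_convergent:
  assumes p: "csn p"
  shows "summable (\<lambda>n. norm z ^ n * hat p (GH (taylor_coeff 0 n) x y))"
proof -
  \<comment> \<open>The Cauchy estimate at a radius at least twice \<open>norm z\<close> leaves the
    ratio 1/2.\<close>
  define K where "K = 2 * (norm z + 1)"
  have K: "1 \<le> K" by (simp add: K_def)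
  obtain q where q: "dominating p K q" using dominating_exists[OF p K] ..
  then have csn_q: "csn q" by (simp add: dominating_def)
  note remainder = hat_GH_remainder[OF p q]
  show ?thesis
  proof (rule summable_comparison_test')
    show "summable (\<lambda>n. (1 / 2) ^ n * (hat q x * hat q y))"
      by (intro summable_mult2 summable_geometric) simp
    show "norm (norm z ^ n * hat p (GH (taylor_coeff 0 n) x y)) \<le> (1 / 2) ^ n * (hat q x * hat q y)" for n
    proof -
      have "hat p (GH (taylor_coeff 0 n) x y) \<le> 1 / K ^ n * (hat q x * hat q y)"
        using remainder[where a = "taylor_coeff 0 n" and b = "\<lambda>_. taylor_coeff 0 n" and A = "1 / K ^ n"
              and I = "{}" and d = "\<lambda>_. 0" and x = x and y = y]
          norm_taylor_coeff_le[OF K, of 0 n] K geometric_taylor_coeff by simp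
      then have "norm z ^ n * hat p (GH (taylor_coeff 0 n) x y) \<le> norm z ^ n * (1 / K ^ n * (hat q x * hat q y))"
        by (intro mult_left_mono) simp_all
      also have "\<dots> = (norm z / K) ^ n * (hat q x * hat q y)" by (simp add: power_divide)
      also have "\<dots> \<le> (1 / 2) ^ n * (hat q x * hat q y)"
      proof (intro mult_right_mono power_mono)
        have "0 < K" using K by simp
        then show "norm z / K \<le> 1 / 2" by (simp only: pos_divide_le_eq) (simp add: K_def)
      qed (use K in \<open>simp_all add: hat_nonneg[OF csn_q]\<close>)
      finally show ?thesis using hat_nonneg[OF p] by simp
    qed
  qed
qed

lemma star_differentiable:
  "((\<lambda>h. cscale (1 / h) (star (z + h) x y - star z x y)) \<longlongrightarrow> GH (taylor_coeff z 1) x y) (at 0)"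
proof (rule tendsto_if_hat)
  fix p assume p: "csn p"
  define c where "c = norm z + 1"
  have c: "1 \<le> c" by (simp add: c_def)
  obtain q where q: "dominating p c q" using dominating_exists[OF p c] ..
  then have csn_q: "csn q" by (simp add: dominating_def)
  note remainder = hat_GH_remainder[OF p q]
  let ?D = "\<lambda>h. cscale (1 / h) (star (z + h) x y - star z x y) - GH (taylor_coeff z 1) x y"
  have le: "hat p (?D h) \<le> norm h * (hat q x * hat q y)" if h: "h \<noteq> 0" "norm h \<le> 1" for h
  proof -
    \<comment> \<open>The remainder estimate with \<open>t = norm h\<close>, \<open>s = 1\<close>
      and \<open>N = 2\<close> is quadratic in \<open>h\<close>, so division by \<open>h\<close>
      still leaves a bound that tends to 0.\<close>
    have "norm ((z + h) ^ i - (\<Sum>n<2. h ^ n * taylor_coeff z n i)) \<le> norm h ^ 2 * c ^ i" for i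
      unfolding c_def using h by (intro taylor_remainder) simp_all
    then have 1: "hat p (star (z + h) x y - (\<Sum>n<2. cscale (h ^ n) (GH (taylor_coeff z n) x y))) \<le> norm h ^ 2 * (hat q x * hat q y)"
      by (intro remainder geometric_power geometric_taylor_coeff) simp_all
    have "taylor_coeff z 0 = (\<lambda>n. z ^ n)" by (simp add: taylor_coeff_def fun_eq_iff)
    then have 2: "(\<Sum>n<2. cscale (h ^ n) (GH (taylor_coeff z n) x y)) = star z x y + cscale h (GH (taylor_coeff z 1) x y)"
      by (simp add: numeral_2_eq_2)
    have 3: "?D h = cscale (1 / h) (star (z + h) x y - (star z x y + cscale h (GH (taylor_coeff z 1) x y)))"
      using h by (simp add: scale_right_diff_distrib scale_right_distrib)
    have "hat p (?D h) \<le> norm (1 / h) * hat p (star (z + h) x y - (star z x y + cscale h (GH (taylor_coeff z 1) x y)))"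
      unfolding 3 by (rule hat_scale[OF p])
    also have "\<dots> \<le> norm (1 / h) * (norm h ^ 2 * (hat q x * hat q y))"
      using 1 unfolding 2 by (rule mult_left_mono) simp
    also have "\<dots> = norm h * (hat q x * hat q y)"
      using h by (simp add: norm_divide power2_eq_square)
    finally show ?thesis .
  qed
  have "((\<lambda>h::'k. norm h * (hat q x * hat q y)) \<longlongrightarrow> norm (0::'k) * (hat q x * hat q y)) (at 0)"
    by (intro tendsto_mult tendsto_norm tendsto_ident_at tendsto_const)
  then have lim: "((\<lambda>h::'k. norm h * (hat q x * hat q y)) \<longlongrightarrow> 0) (at 0)" by simp
  have "\<forall>\<^sub>F h in at 0. hat p (?D h) \<le> norm h * (hat q x * hat q y)"
    unfolding eventually_at using le by (intro exI[of _ 1]) auto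
  then show "((\<lambda>h. hat p (?D h)) \<longlongrightarrow> 0) (at 0)"
    by (intro tendsto_sandwich[OF _ _ tendsto_const lim]) (simp_all add: hat_nonneg[OF p])
qed

section \<open>The algebra structure on the completion\<close>

lemma star_iota: "f \<in> ST \<Longrightarrow> g \<in> ST \<Longrightarrow> star z (\<iota> f) (\<iota> g) = \<iota> (gutt_star scl br z f g)"
  by (simp add: GH_iota geometric_power A.gutt_star_eq)

lemma gutt_star_closed: "f \<in> ST \<Longrightarrow> g \<in> ST \<Longrightarrow> gutt_star scl br z f g \<in> ST"
  by (simp add: A.gutt_star_eq GB_closed)

lemmas continuous_on_star = continuous_on_GH[OF geometric_power]

text \<open>Each law is an equality of continuous maps and holds on the dense image. In laws with
  three variables one variable is first restricted to the image, then the other two jointly.\<close>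

lemma continuous_assoc_product_star: "continuous_assoc_product cscale (star z)"
proof -
  note intros = closed_Collect_eq hat_continuous_intros continuous_on_star
  have add_left: "star z (x + y) w = star z x w + star z y w" for x y w
  proof (rule dense_induct[where P = "\<lambda>w. star z (x + y) w = star z x w + star z y w"])
    fix h assume h: "h \<in> ST"
    show "star z (x + y) (\<iota> h) = star z x (\<iota> h) + star z y (\<iota> h)"
      by (rule dense_induct2[where P = "\<lambda>x y. star z (x + y) (\<iota> h) = star z x (\<iota> h) + star z y (\<iota> h)"],
          intro intros)
        (simp add: h GH_iota geometric_power GB_add_left GB_closed ST_add flip: iota_add)
  qed (intro intros)
  have add_right: "star z w (x + y) = star z w x + star z w y" for x y w
  proof (rule dense_induct[where P = "\<lambda>w. star z w (x + y) = star z w x + star z w y"])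
    fix h assume h: "h \<in> ST"
    show "star z (\<iota> h) (x + y) = star z (\<iota> h) x + star z (\<iota> h) y"
      by (rule dense_induct2[where P = "\<lambda>x y. star z (\<iota> h) (x + y) = star z (\<iota> h) x + star z (\<iota> h) y"],
          intro intros)
        (simp add: h GH_iota geometric_power GB_add_right GB_closed ST_add flip: iota_add)
  qed (intro intros)
  have scale_left: "star z (cscale c x) y = cscale c (star z x y)" for c x y
    by (rule dense_induct2[where P = "\<lambda>x y. star z (cscale c x) y = cscale c (star z x y)"], intro intros)
      (simp add: GH_iota geometric_power GB_scale_left GB_closed ST_scale flip: iota_scale)
  have scale_right: "star z x (cscale c y) = cscale c (star z x y)" for c x y
    by (rule dense_induct2[where P = "\<lambda>x y. star z x (cscale c y) = cscale c (star z x y)"], intro intros)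
      (simp add: GH_iota geometric_power GB_scale_right GB_closed ST_scale flip: iota_scale)
  have assoc: "star z (star z x y) w = star z x (star z y w)" for x y w
  proof (rule dense_induct[where P = "\<lambda>w. star z (star z x y) w = star z x (star z y w)"])
    fix h assume h: "h \<in> ST"
    show "star z (star z x y) (\<iota> h) = star z x (star z y (\<iota> h))"
      by (rule dense_induct2[where P = "\<lambda>x y. star z (star z x y) (\<iota> h) = star z x (star z y (\<iota> h))"],
          intro intros)
        (simp add: h star_iota gutt_star_closed A.gutt_star_assoc)
  qed (intro intros)
  show ?thesis
    unfolding continuous_assoc_product_def
    using add_left add_right scale_left scale_right assoc
      continuous_on_ext_binary[OF continuous_biadditive_GB[OF geometric_power]]
    by blast
qed

lemma analytic_expansion:
  "analytic_map cscale (\<lambda>z. gutt_star_hat scl br \<iota> z x y) \<and>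
   (\<forall>z. (\<lambda>n. cscale (z ^ n) (gutt_C_hat scl br \<iota> n x y)) sums gutt_star_hat scl br \<iota> z x y) \<and>
   (\<forall>(z::'k) p. csn p \<longrightarrow> summable (\<lambda>n. norm z ^ n * hat p (gutt_C_hat scl br \<iota> n x y)))"
proof (intro conjI allI impI)
  show "analytic_map cscale (\<lambda>z. gutt_star_hat scl br \<iota> z x y)"
    unfolding analytic_map_def gutt_star_hat_eq
  proof
    fix z0
    have "(\<lambda>n. cscale ((z - z0) ^ n) (GH (taylor_coeff z0 n) x y)) sums star z x y" for z
      using star_sums[of "z - z0" z0 x y] by simp
    then show "\<exists>r>0. \<exists>a. \<forall>z. norm (z - z0) < r \<longrightarrow> (\<lambda>n. cscale ((z - z0) ^ n) (a n)) sums star z x y"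
      \<comment> \<open>The expansion converges on the whole field, so the radius 1 is an arbitrary
        choice.\<close>
      by (intro exI[of _ "1::real"] conjI exI[of _ "\<lambda>n. GH (taylor_coeff z0 n) x y"]) simp_all
  qed
  show "(\<lambda>n. cscale (z ^ n) (gutt_C_hat scl br \<iota> n x y)) sums gutt_star_hat scl br \<iota> z x y" for z
    using star_sums[of z 0 x y] by (simp add: gutt_star_hat_eq gutt_C_hat_eq)
  show "summable (\<lambda>n. norm z ^ n * hat p (gutt_C_hat scl br \<iota> n x y))" if "csn p" for z :: 'k and p
    unfolding gutt_C_hat_eq by (rule star_absolutely_convergent[OF that])
qed

end

theorem proposition5p3p7:
  fixes R :: real
    and sclR :: "real \<Rightarrow> 'g::{topological_ab_group_add, t2_space} \<Rightarrow> 'g"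
    and brR :: "'g \<Rightarrow> 'g \<Rightarrow> 'g"
    and csclR :: "real \<Rightarrow> 's::{topological_ab_group_add, t2_space} \<Rightarrow> 's"
    and \<iota>R :: "('g, real) tensor \<Rightarrow> 's"
    and sclC :: "complex \<Rightarrow> 'h::{topological_ab_group_add, t2_space} \<Rightarrow> 'h"
    and brC :: "'h \<Rightarrow> 'h \<Rightarrow> 'h"
    and csclC :: "complex \<Rightarrow> 't::{topological_ab_group_add, t2_space} \<Rightarrow> 't"
    and \<iota>C :: "('h, complex) tensor \<Rightarrow> 't"
  assumes "R \<ge> 1"
  shows
    "(AE_lie_algebra sclR brR \<and> sym_completion sclR R csclR \<iota>R \<longrightarrow>
       (\<forall>x y.
          analytic_map csclR (\<lambda>z. gutt_star_hat sclR brR \<iota>R z x y) \<and>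
          (\<forall>z. (\<lambda>n. csclR (z ^ n) (gutt_C_hat sclR brR \<iota>R n x y)) sums
                 gutt_star_hat sclR brR \<iota>R z x y) \<and>
          (\<forall>(z::real) p. continuous_seminorm sclR p \<longrightarrow>
             summable (\<lambda>n. norm z ^ n *
               tensor_seminorm_hat sclR R \<iota>R p (gutt_C_hat sclR brR \<iota>R n x y)))))
   \<and> (AE_lie_algebra sclC brC \<and> sym_completion sclC R csclC \<iota>C \<longrightarrow>
       (\<forall>x y.
          analytic_map csclC (\<lambda>z. gutt_star_hat sclC brC \<iota>C z x y) \<and>
          (\<forall>z. (\<lambda>n. csclC (z ^ n) (gutt_C_hat sclC brC \<iota>C n x y)) sums
                 gutt_star_hat sclC brC \<iota>C z x y) \<and>
          (\<forall>(z::complex) p. continuous_seminorm sclC p \<longrightarrow>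
             summable (\<lambda>n. norm z ^ n *
               tensor_seminorm_hat sclC R \<iota>C p (gutt_C_hat sclC brC \<iota>C n x y)))) \<and>
       entire_holomorphic_deformation csclC (symmult_hat sclC \<iota>C) (gutt_star_hat sclC brC \<iota>C))"
proof (intro conjI impI, goal_cases)
  case 1
  then interpret AE: AE_lie_algebra sclR brR + C: sym_completion sclR R csclR \<iota>R by simp_all
  interpret G: gutt_completion sclR R csclR \<iota>R brR by unfold_locales (rule assms)
  show ?case by (intro allI) (rule G.analytic_expansion)
next
  case 2
  then interpret AE: AE_lie_algebra sclC brC + C: sym_completion sclC R csclC \<iota>C by simp_all
  interpret G: gutt_completion sclC R csclC \<iota>C brC by unfold_locales (rule assms)
  show ?case by (intro allI) (rule G.analytic_expansion)
next
  case 3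
  then interpret AE: AE_lie_algebra sclC brC + C: sym_completion sclC R csclC \<iota>C by simp_all
  interpret G: gutt_completion sclC R csclC \<iota>C brC by unfold_locales (rule assms)
  show ?case
    unfolding entire_holomorphic_deformation_def entire_map_def G.gutt_star_hat_eq G.symmult_hat_eq
    using G.continuous_assoc_product_star G.star_differentiable by blast
qed

end
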